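(* For any $U\in H^{-1}(\Omega)^d$ there exist $\psi\in L^2(\Omega)$ and $\Psi\in H^{-1}(\Omega)^d$ such that $$U=\nabla\psi+\Psi\qquad\text{with}\qquad \nabla\cdot\Psi=0 .$$ In particular, if $U=\Phi^2\nabla a$ for some $a\in(\mathcal A)$, then $\psi$ is continuous at the points where $a$ is continuous, and discontinuous at the points where $a$ is discontinuous.
   Context: $\Omega\subset\mathbb R^d$, $d\in\{2,3\}$, is a bounded $\mathcal C^1$-domain, and $H^{-1}(\Omega)$ is the dual of $H^1_0(\Omega)$; the identities hold in the sense of distributions. Fix $D\Subset\Omega$, constants $0<\underline a\le\overline a$ and $a_0>0$. The class $(\mathcal A)\subset L^\infty(\Omega)$ consists of all functions $a=\sum_{i=0}^k a_i\mathbf 1_{A_i}$ where $k\ge1$; $A_1,\dots,A_k$ are smooth subdomains of $\Omega$ with connected boundaries $\partial A_i$, with $\overline{A_i}\cap\overline{A_j}=\emptyset$ for $i\ne j$ and $\bigcup_{i=1}^k\overline{A_i}\Subset D$; $a_i\in\mathcal C^2(\overline{A_i},[\underline a,\overline a])$ for $1\le i\le k$; $A_0=\Omega\setminus\bigcup_{i=1}^k\overline{A_i}$, on which $a$ equals the constant $a_0$. Here $\Phi\in\mathcal C^1(\Omega)$, and for $a\in(\mathcal A)$, $\Phi^2\nabla a$ is the element of $(H^1(\Omega)^d)^*\subset H^{-1}(\Omega)^d$ given by $\langle\Phi^2\nabla a,v\rangle=-\int_D(a-a_0)\,\nabla\cdot(\Phi^2v)\,dx$ for $v\in H^1(\Om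ega)^d$.
   Formalization: Discontinuity of ψ where a is discontinuous is claimed only at points with Φ ≠ 0: where Φ vanishes ψ is always continuous (e.g. Φ = 0 gives U = 0 and ψ harmonic), so the claim fails there. Continuity is understood up to null sets. *)

theory Defs
  imports "HOL-Analysis.Analysis"
begin

section \<open>Classical regularity\<close>

definition partial_deriv :: "'d \<Rightarrow> (real ^ 'd \<Rightarrow> real) \<Rightarrow> real ^ 'd \<Rightarrow> real" where
  "partial_deriv i f x = frechet_derivative f (at x) (axis i 1)"

text \<open>The next two predicates are meant for open sets only: derivatives at points of the set are
  taken with respect to the full neighbourhood filter.\<close>

fun Ck_on :: "nat \<Rightarrow> (real ^ 'd) set \<Rightarrow> (real ^ 'd \<Rightarrow> real) \<Rightarrow> bool" where
  "Ck_on 0 S f \<longleftrightarrow> continuous_on S f"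
| "Ck_on (Suc k) S f \<longleftrightarrow>
     (\<forall>x\<in>S. f differentiable (at x)) \<and> (\<forall>i. Ck_on k S (partial_deriv i f))"

definition smooth_on :: "(real ^ 'd) set \<Rightarrow> (real ^ 'd \<Rightarrow> real) \<Rightarrow> bool" where
  "smooth_on S f \<longleftrightarrow> (\<forall>k. Ck_on k S f)"

text \<open>The space of functions of class \<open>C\<^sup>k\<close> up to the boundary of an open set \<open>S\<close>: all partial
  derivatives of order at most \<open>k\<close> on \<open>S\<close> have continuous extensions to the closure.\<close>

fun Ck_closure :: "nat \<Rightarrow> (real ^ 'd) set \<Rightarrow> (real ^ 'd \<Rightarrow> real) \<Rightarrow> bool" where
  "Ck_closure 0 S f \<longleftrightarrow> continuous_on (closure S) f"
| "Ck_closure (Suc k) S f \<longleftrightarrow>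
     continuous_on (closure S) f \<and> (\<forall>x\<in>S. f differentiable (at x)) \<and>
     (\<forall>i. \<exists>g. (\<forall>x\<in>S. g x = partial_deriv i f x) \<and> Ck_closure k S g)"

text \<open>Near each boundary point the domain is the strict epigraph, in the direction of some unit
  vector \<open>e\<close>, of a function of the class \<open>reg\<close>. The function \<open>\<gamma>\<close> is only evaluated on the
  hyperplane orthogonal to \<open>e\<close>.\<close>

definition domain_of_class ::
    "((real ^ 'd \<Rightarrow> real) \<Rightarrow> bool) \<Rightarrow> (real ^ 'd) set \<Rightarrow> bool" where
  "domain_of_class reg S \<longleftrightarrow>
     open S \<and> connected S \<and> S \<noteq> {} \<and>
     (\<forall>p\<in>frontier S. \<exists>V e \<gamma>. open V \<and> p \<in> V \<and> norm e = 1 \<and> reg \<gamma> \<and>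
        S \<inter> V = {x \<in> V. \<gamma> (x - (x \<bullet> e) *\<^sub>R e) < x \<bullet> e})"

definition C1_domain :: "(real ^ 'd) set \<Rightarrow> bool" where
  "C1_domain S \<longleftrightarrow> domain_of_class (Ck_on 1 UNIV) S"

definition smooth_domain :: "(real ^ 'd) set \<Rightarrow> bool" where
  "smooth_domain S \<longleftrightarrow> domain_of_class (smooth_on UNIV) S"

definition compactly_contained :: "(real ^ 'd) set \<Rightarrow> (real ^ 'd) set \<Rightarrow> bool" where
  "compactly_contained S T \<longleftrightarrow> compact (closure S) \<and> closure S \<subseteq> T"

section \<open>Sobolev spaces and distributions\<close>

text \<open>Elements of the function spaces on \<open>\<Omega>\<close> are represented by total functions; only their
  values on \<open>\<Omega>\<close>, up to null sets, are relevant.\<close>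

definition test_functions :: "(real ^ 'd) set \<Rightarrow> (real ^ 'd \<Rightarrow> real) set" where
  "test_functions \<Omega> = {\<phi>. smooth_on UNIV \<phi> \<and> compactly_contained {x. \<phi> x \<noteq> 0} \<Omega>}"

definition L2 :: "(real ^ 'd) set \<Rightarrow> (real ^ 'd \<Rightarrow> real) set" where
  "L2 \<Omega> = {f. set_borel_measurable lebesgue \<Omega> f \<and> set_integrable lebesgue \<Omega> (\<lambda>x. (f x)\<^sup>2)}"

definition L1_loc :: "(real ^ 'd) set \<Rightarrow> (real ^ 'd \<Rightarrow> real) set" where
  "L1_loc \<Omega> = {f. \<forall>K. compact K \<and> K \<subseteq> \<Omega> \<longrightarrow> set_integrable lebesgue K f}"

definition is_weak_partial ::
    "(real ^ 'd) set \<Rightarrow> 'd \<Rightarrow> (real ^ 'd \<Rightarrow> real) \<Rightarrow> (real ^ 'd \<Rightarrow> real) \<Rightarrow> bool" where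
  "is_weak_partial \<Omega> i u g \<longleftrightarrow> u \<in> L1_loc \<Omega> \<and> g \<in> L1_loc \<Omega> \<and>
     (\<forall>\<phi>\<in>test_functions \<Omega>.
        (LINT x:\<Omega>|lebesgue. u x * partial_deriv i \<phi> x) = - (LINT x:\<Omega>|lebesgue. g x * \<phi> x))"

text \<open>Weak derivatives are unique up to null sets, so the choice below does not affect integrals.\<close>

definition weak_partial ::
    "(real ^ 'd) set \<Rightarrow> 'd \<Rightarrow> (real ^ 'd \<Rightarrow> real) \<Rightarrow> real ^ 'd \<Rightarrow> real" where
  "weak_partial \<Omega> i u = (SOME g. is_weak_partial \<Omega> i u g)"

definition H1 :: "(real ^ 'd) set \<Rightarrow> (real ^ 'd \<Rightarrow> real) set" where
  "H1 \<Omega> = {u \<in> L2 \<Omega>. \<forall>i. \<exists>g\<in>L2 \<Omega>. is_weak_partial \<Omega> i u g}"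

definition H1_norm :: "(real ^ 'd) set \<Rightarrow> (real ^ 'd \<Rightarrow> real) \<Rightarrow> real" where
  "H1_norm \<Omega> u = sqrt ((LINT x:\<Omega>|lebesgue. (u x)\<^sup>2) +
     (\<Sum>i\<in>UNIV. LINT x:\<Omega>|lebesgue. (weak_partial \<Omega> i u x)\<^sup>2))"

definition H10 :: "(real ^ 'd) set \<Rightarrow> (real ^ 'd \<Rightarrow> real) set" where
  "H10 \<Omega> = {u \<in> H1 \<Omega>. \<forall>\<epsilon>>0. \<exists>\<phi>\<in>test_functions \<Omega>. H1_norm \<Omega> (\<lambda>x. u x - \<phi> x) < \<epsilon>}"

text \<open>The dual of \<open>H10 \<Omega>\<close>. Boundedness forces the functionals to respect equality almost
  everywhere; their values off \<open>H10 \<Omega>\<close> are irrelevant.\<close>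

definition Hminus1 :: "(real ^ 'd) set \<Rightarrow> ((real ^ 'd \<Rightarrow> real) \<Rightarrow> real) set" where
  "Hminus1 \<Omega> = {F.
     (\<forall>u\<in>H10 \<Omega>. \<forall>v\<in>H10 \<Omega>. F (\<lambda>x. u x + v x) = F u + F v) \<and>
     (\<forall>c. \<forall>u\<in>H10 \<Omega>. F (\<lambda>x. c * u x) = c * F u) \<and>
     (\<exists>C. \<forall>u\<in>H10 \<Omega>. \<bar>F u\<bar> \<le> C * H1_norm \<Omega> u)}"

definition Hminus1_vec :: "(real ^ 'd) set \<Rightarrow> ('d \<Rightarrow> (real ^ 'd \<Rightarrow> real) \<Rightarrow> real) set" where
  "Hminus1_vec \<Omega> = {U. \<forall>i. U i \<in> Hminus1 \<Omega>}"

definition dist_grad ::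
    "(real ^ 'd) set \<Rightarrow> (real ^ 'd \<Rightarrow> real) \<Rightarrow> 'd \<Rightarrow> (real ^ 'd \<Rightarrow> real) \<Rightarrow> real" where
  "dist_grad \<Omega> \<psi> i \<phi> = - (LINT x:\<Omega>|lebesgue. \<psi> x * partial_deriv i \<phi> x)"

definition dist_div ::
    "('d::finite \<Rightarrow> (real ^ 'd \<Rightarrow> real) \<Rightarrow> real) \<Rightarrow> (real ^ 'd \<Rightarrow> real) \<Rightarrow> real" where
  "dist_div \<Psi> \<phi> = - (\<Sum>i\<in>UNIV. \<Psi> i (partial_deriv i \<phi>))"

section \<open>Piecewise smooth coefficients\<close>

definition class_A ::
    "(real ^ 'd) set \<Rightarrow> (real ^ 'd) set \<Rightarrow> real \<Rightarrow> real \<Rightarrow> real \<Rightarrow> (real ^ 'd \<Rightarrow> real) set" where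
  "class_A \<Omega> D alo ahi a0 = {a. \<exists>k A \<alpha>. 1 \<le> (k::nat) \<and>
     (\<forall>i\<in>{1..k}. smooth_domain (A i) \<and> A i \<subseteq> \<Omega> \<and> connected (frontier (A i))) \<and>
     (\<forall>i\<in>{1..k}. \<forall>j\<in>{1..k}. i \<noteq> j \<longrightarrow> closure (A i) \<inter> closure (A j) = {}) \<and>
     compactly_contained (\<Union>i\<in>{1..k}. closure (A i)) D \<and>
     (\<forall>i\<in>{1..k}. Ck_closure 2 (A i) (\<alpha> i) \<and> (\<forall>x\<in>closure (A i). \<alpha> i x \<in> {alo..ahi})) \<and>
     A 0 = \<Omega> - (\<Union>i\<in>{1..k}. closure (A i)) \<and>
     (\<forall>x\<in>A 0. \<alpha> 0 x = a0) \<and>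
     (\<forall>x\<in>\<Omega>. a x = (\<Sum>i=0..k. \<alpha> i x * indicator (A i) x))}"

definition weighted_grad ::
    "(real ^ 'd) set \<Rightarrow> (real ^ 'd) set \<Rightarrow> real \<Rightarrow> (real ^ 'd \<Rightarrow> real) \<Rightarrow> (real ^ 'd \<Rightarrow> real)
      \<Rightarrow> ('d \<Rightarrow> real ^ 'd \<Rightarrow> real) \<Rightarrow> real" where
  "weighted_grad \<Omega> D a0 \<Phi> a v =
     - (LINT x:D|lebesgue. (a x - a0) * (\<Sum>i\<in>UNIV. weak_partial \<Omega> i (\<lambda>y. (\<Phi> y)\<^sup>2 * v i y) x))"

definition is_weighted_grad ::
    "(real ^ 'd) set \<Rightarrow> (real ^ 'd) set \<Rightarrow> real \<Rightarrow> (real ^ 'd \<Rightarrow> real) \<Rightarrow> (real ^ 'd \<Rightarrow> real)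
      \<Rightarrow> ('d \<Rightarrow> (real ^ 'd \<Rightarrow> real) \<Rightarrow> real) \<Rightarrow> bool" where
  "is_weighted_grad \<Omega> D a0 \<Phi> a U \<longleftrightarrow>
     (\<forall>v. (\<forall>i. v i \<in> H10 \<Omega>) \<longrightarrow> (\<Sum>i\<in>UNIV. U i (v i)) = weighted_grad \<Omega> D a0 \<Phi> a v)"

text \<open>Continuity at a point for a class of functions modulo null sets: some representative is
  continuous there. The pointwise notion would be wrong here: it depends on the representative,
  and the sums defining \<open>class_A\<close> vanish on the interfaces, even where
  the two one-sided limits agree.\<close>

definition ess_continuous_at ::
    "(real ^ 'd) set \<Rightarrow> (real ^ 'd \<Rightarrow> real) \<Rightarrow> real ^ 'd \<Rightarrow> bool" where
  "ess_continuous_at \<Omega> f x \<longleftrightarrow> (\<exists>g. (AE y in lebesgue. y \<in> \<Omega> \<longrightarrow> g y = f y) \<and> isCont g x)"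

end

theory Submission
  imports Defs
begin

text \<open>
  The field \<open>U\<close> splits as \<open>\<nabla>\<psi> + \<Psi>\<close> with \<open>\<Psi>\<close> divergence free as soon as \<open>\<psi>\<close> solves
  \<open>\<Delta>\<psi> = div U\<close> in the very weak sense, that is \<open>\<integral> \<psi> \<Delta>\<phi> = - \<langle>U, \<nabla>\<phi>\<rangle>\<close> for all test functions
  \<open>\<phi>\<close>. Integration by parts and the Poincare inequality bound the \<open>H\<^sup>1\<close> norm of \<open>\<nabla>\<phi>\<close> by the \<open>L\<^sup>2\<close> norm of \<open>\<Delta>\<phi>\<close>
  (\<open>H1_norm_partial_le_laplacian\<close>), so \<open>\<Delta>\<phi> \<mapsto> \<langle>U, \<nabla>\<phi>\<rangle>\<close> is a bounded functional on a
  subspace of \<open>L\<^sup>2\<close>, and the Riesz theorem (\<open>Riesz_representation_graph\<close>) represents it. Then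
  \<open>\<Psi>\<close> is defined as \<open>U - \<nabla>\<psi>\<close> (\<open>ex_decomposition\<close>).

  Now let \<open>U = \<Phi>\<^sup>2 \<nabla>a\<close>. With the contrast \<open>b = a - a0\<close>, which vanishes outside \<open>D\<close>,
  \<open>U = \<nabla>(\<Phi>\<^sup>2 b) - b \<nabla>\<Phi>\<^sup>2\<close>, whence \<open>\<Delta>(\<psi> - \<Phi>\<^sup>2 b) = - div (b \<nabla>\<Phi>\<^sup>2)\<close>. The field on the right is
  bounded, and an integrable function whose Laplacian is the divergence of a bounded field agrees
  almost everywhere with a continuous function (\<open>weak_solution_AE_eq_continuous\<close>). So \<open>\<psi>\<close> and \<open>\<Phi>\<^sup>2 b\<close> differ by a
  continuous function: \<open>\<psi>\<close> is continuous where \<open>a\<close> is and, where \<open>\<Phi> \<noteq> 0\<close>, only there.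

  The continuity theorem combines Weyl's lemma with the estimate of a Newtonian potential. For a
  suitable bump \<open>\<kappa>\<close> the difference of its rescalings to the scales \<open>2\<^sup>-\<^sup>n\<close> and \<open>2\<^sup>-\<^sup>n\<^sup>-\<^sup>1\<close> is the
  Laplacian of a test function \<open>\<phi>\<^sub>n\<close> with \<open>\<parallel>\<nabla>\<phi>\<^sub>n\<parallel>\<^sub>1\<close> of order \<open>2\<^sup>-\<^sup>n\<close>
  (\<open>ex_dyadic_kernel\<close>). Testing the equation with translates of \<open>\<phi>\<^sub>n\<close> shows that the regularised
  functions converge locally uniformly. The limit is identified, and weak derivatives are shown to be
  unique, by the fundamental lemma of the calculus of variations
  (\<open>AE_zero_if_orthogonal_to_test_functions\<close>).
\<close>

section \<open>Calculus of smooth functions\<close>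

lemma partial_deriv_eqI:
  assumes "(f has_derivative f') (at x)"
  shows "partial_deriv i f x = f' (axis i 1)"
  using frechet_derivative_at[OF assms] by (simp add: partial_deriv_def)

lemma has_derivative_partials:
  fixes f :: "real ^ 'd \<Rightarrow> real"
  assumes "f differentiable (at x)"
  shows "(f has_derivative (\<lambda>v. \<Sum>i\<in>UNIV. v $ i * partial_deriv i f x)) (at x)"
proof -
  obtain f' where f': "(f has_derivative f') (at x)"
    using assms by (auto simp: differentiable_def)
  interpret linear f' using f' has_derivative_linear by blast
  have "f' = (\<lambda>v. \<Sum>i\<in>UNIV. v $ i * partial_deriv i f x)"
  proof
    fix v :: "real ^ 'd"
    have "f' v = f' (\<Sum>i\<in>UNIV. v $ i *\<^sub>R axis i 1)"
      using basis_expansion[of v] by (simp add: scalar_mult_eq_scaleR)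
    also have "\<dots> = (\<Sum>i\<in>UNIV. v $ i * partial_deriv i f x)"
      by (simp add: sum scaleR partial_deriv_eqI[OF f'])
    finally show "f' v = (\<Sum>i\<in>UNIV. v $ i * partial_deriv i f x)" .
  qed
  with f' show ?thesis by simp
qed

lemma partial_deriv_const [simp]: "partial_deriv i (\<lambda>x. c) = (\<lambda>x. 0)"
  by (simp add: partial_deriv_def fun_eq_iff)

lemma partial_deriv_add:
  assumes "f differentiable (at x)" "g differentiable (at x)"
  shows "partial_deriv i (\<lambda>x. f x + g x) x = partial_deriv i f x + partial_deriv i g x"
  using assms
  by (auto simp: differentiable_def partial_deriv_eqI dest: partial_deriv_eqI[OF has_derivative_add])

lemma partial_deriv_mult:
  assumes "f differentiable (at x)" "g differentiable (at x)"
  shows "partial_deriv i (\<lambda>x. f x * g x) x = f x * partial_deriv i g x + partial_deriv i f x * g x"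
  using assms
  by (auto simp: differentiable_def partial_deriv_eqI dest: partial_deriv_eqI[OF has_derivative_mult])

lemma partial_deriv_cmult:
  assumes "f differentiable (at x)"
  shows "partial_deriv i (\<lambda>x. c * f x) x = c * partial_deriv i f x"
  using partial_deriv_mult[of "\<lambda>x. c" x f i] assms by simp

lemma partial_deriv_nth: "partial_deriv i (\<lambda>x. x $ j) x = (if i = j then 1 else 0)"
  using partial_deriv_eqI[OF bounded_linear.has_derivative[OF bounded_linear_vec_nth has_derivative_ident],
      of i j x] by (simp add: axis_def)

lemma partial_deriv_cong_open:
  assumes "open S" "x \<in> S" "\<And>y. y \<in> S \<Longrightarrow> f y = g y"
  shows "partial_deriv i f x = partial_deriv i g x"
proof -
  have "(f has_derivative F) (at x) \<longleftrightarrow> (g has_derivative F) (at x)" for F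
    using has_derivative_transform_within_open[OF _ assms(1,2), of f F UNIV g]
      has_derivative_transform_within_open[OF _ assms(1,2), of g F UNIV f] assms(3) by auto
  then show ?thesis by (simp add: partial_deriv_def frechet_derivative_def)
qed

lemma differentiable_cong_open:
  assumes "open S" "x \<in> S" "\<And>y. y \<in> S \<Longrightarrow> f y = g y" "f differentiable (at x)"
  shows "g differentiable (at x)"
  using assms has_derivative_transform_within_open[OF _ assms(1,2), of f _ UNIV g]
  unfolding differentiable_def by metis

lemma Ck_on_imp_continuous_on: "Ck_on k S f \<Longrightarrow> continuous_on S f"
  by (cases k)
    (auto intro!: continuous_at_imp_continuous_on intro: differentiable_imp_continuous_within)

lemma Ck_on_SucD: "Ck_on (Suc k) S f \<Longrightarrow> Ck_on k S f"
proof (induction k arbitrary: f)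
  case 0
  then show ?case using Ck_on_imp_continuous_on[OF 0] by simp
next
  case (Suc k)
  then show ?case by (metis Ck_on.simps(2))
qed

lemma Ck_on_const [simp]: "Ck_on k S (\<lambda>x. c)"
  by (induction k arbitrary: c) auto

lemma Ck_on_add:
  "Ck_on k UNIV f \<Longrightarrow> Ck_on k UNIV g \<Longrightarrow> Ck_on k UNIV (\<lambda>x. f x + g x)"
proof (induction k arbitrary: f g)
  case (Suc k)
  have "partial_deriv i (\<lambda>x. f x + g x) = (\<lambda>x. partial_deriv i f x + partial_deriv i g x)" for i
    using Suc.prems by (intro ext partial_deriv_add) auto
  with Suc show ?case by auto
qed (auto intro: continuous_intros)

lemma Ck_on_mult:
  "Ck_on k UNIV f \<Longrightarrow> Ck_on k UNIV g \<Longrightarrow> Ck_on k UNIV (\<lambda>x. f x * g x)"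
proof (induction k arbitrary: f g)
  case (Suc k)
  have "partial_deriv i (\<lambda>x. f x * g x) = (\<lambda>x. f x * partial_deriv i g x + partial_deriv i f x * g x)" for i
    using Suc.prems by (intro ext partial_deriv_mult) auto
  moreover have "Ck_on k UNIV (\<lambda>x. f x * partial_deriv i g x + partial_deriv i f x * g x)" for i
    using Suc.prems Suc.IH Suc.prems[THEN Ck_on_SucD] by (intro Ck_on_add) auto
  ultimately show ?case using Suc.prems by auto
qed (auto intro: continuous_intros)

lemma Ck_on_prod:
  "finite I \<Longrightarrow> (\<And>j. j \<in> I \<Longrightarrow> Ck_on k UNIV (f j)) \<Longrightarrow> Ck_on k UNIV (\<lambda>x. \<Prod>j\<in>I. f j x)"
  by (induction I rule: finite_induct) (auto intro: Ck_on_mult)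

lemma Ck_on_sum:
  "finite I \<Longrightarrow> (\<And>j. j \<in> I \<Longrightarrow> Ck_on k UNIV (f j)) \<Longrightarrow> Ck_on k UNIV (\<lambda>x. \<Sum>j\<in>I. f j x)"
  by (induction I rule: finite_induct) (auto intro: Ck_on_add)

lemma Ck_on_nth: "Ck_on k UNIV (\<lambda>x. x $ j)"
proof (cases k)
  case (Suc l)
  have "partial_deriv i (\<lambda>x. x $ j) = (\<lambda>x. if i = j then 1 else 0)" for i :: 'a
    by (simp add: fun_eq_iff partial_deriv_nth)
  then show ?thesis
    using Suc by (auto intro!: bounded_linear_imp_differentiable bounded_linear_vec_nth)
qed (auto intro: continuous_intros)

lemma has_derivative_affine_comp:
  fixes f :: "real ^ 'd \<Rightarrow> real"
  assumes "f differentiable (at (v + s *\<^sub>R x))"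
  shows "((\<lambda>y. f (v + s *\<^sub>R y)) has_derivative
     (\<lambda>w. \<Sum>i\<in>UNIV. (s * w $ i) * partial_deriv i f (v + s *\<^sub>R x))) (at x)"
proof -
  have "((\<lambda>y. v + s *\<^sub>R y) has_derivative (\<lambda>w. s *\<^sub>R w)) (at x)"
    by (auto intro!: derivative_eq_intros)
  from has_derivative_compose[OF this, OF has_derivative_partials[OF assms]]
  show ?thesis by simp
qed

lemma partial_deriv_affine_comp:
  fixes f :: "real ^ 'd \<Rightarrow> real"
  assumes "f differentiable (at (v + s *\<^sub>R x))"
  shows "partial_deriv i (\<lambda>y. f (v + s *\<^sub>R y)) x = s * partial_deriv i f (v + s *\<^sub>R x)"
proof -
  have "(\<Sum>j\<in>UNIV. (s * axis i 1 $ j) * partial_deriv j f (v + s *\<^sub>R x))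
      = (\<Sum>j\<in>UNIV. if j = i then s * partial_deriv i f (v + s *\<^sub>R x) else 0)"
    by (intro sum.cong) (auto simp: axis_def)
  then show ?thesis
    using partial_deriv_eqI[OF has_derivative_affine_comp[OF assms], of i] by simp
qed

lemma Ck_on_affine_comp:
  "Ck_on k UNIV f \<Longrightarrow> Ck_on k UNIV (\<lambda>y. f (v + s *\<^sub>R y))"
proof (induction k arbitrary: f)
  case 0
  then show ?case by (auto intro!: continuous_intros continuous_on_compose2[where f="\<lambda>y. v + s *\<^sub>R y"])
next
  case (Suc k)
  have "partial_deriv i (\<lambda>y. f (v + s *\<^sub>R y)) = (\<lambda>y. s * partial_deriv i f (v + s *\<^sub>R y))" for i
    using Suc.prems by (intro ext partial_deriv_affine_comp) auto
  moreover have "(\<lambda>y. f (v + s *\<^sub>R y)) differentiable (at x)" for x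
    using has_derivative_affine_comp Suc.prems by (fastforce simp: differentiable_def)
  ultimately show ?case using Suc by (auto intro!: Ck_on_mult)
qed

text \<open>One-variable profiles are composed with polynomials below. The derivative is existentially
  quantified, so that antiderivatives qualify without a formula for them.\<close>

fun Ck_real :: "nat \<Rightarrow> (real \<Rightarrow> real) \<Rightarrow> bool" where
  "Ck_real 0 g \<longleftrightarrow> continuous_on UNIV g"
| "Ck_real (Suc k) g \<longleftrightarrow> (\<exists>g'. (\<forall>t. (g has_real_derivative g' t) (at t)) \<and> Ck_real k g')"

lemma Ck_real_SucD: "Ck_real (Suc k) g \<Longrightarrow> Ck_real k g"
proof (induction k arbitrary: g)
  case 0
  then show ?case
    by (auto intro!: continuous_at_imp_continuous_on intro: DERIV_isCont)
next
  case (Suc k)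
  then show ?case by (metis Ck_real.simps(2))
qed

lemma Ck_real_const [simp]: "Ck_real k (\<lambda>t. c)"
  by (induction k arbitrary: c) (auto intro!: exI[of _ "\<lambda>t. 0"])

lemma Ck_real_add: "Ck_real k f \<Longrightarrow> Ck_real k g \<Longrightarrow> Ck_real k (\<lambda>t. f t + g t)"
proof (induction k arbitrary: f g)
  case (Suc k)
  then obtain f' g' where "\<And>t. (f has_real_derivative f' t) (at t)" "Ck_real k f'"
    "\<And>t. (g has_real_derivative g' t) (at t)" "Ck_real k g'" by auto
  with Suc.IH[of f' g'] show ?case
    by (auto intro!: exI[of _ "\<lambda>t. f' t + g' t"] derivative_eq_intros)
qed (auto intro: continuous_intros)

lemma Ck_real_mult: "Ck_real k f \<Longrightarrow> Ck_real k g \<Longrightarrow> Ck_real k (\<lambda>t. f t * g t)"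
proof (induction k arbitrary: f g)
  case (Suc k)
  then obtain f' g' where *: "\<And>t. (f has_real_derivative f' t) (at t)" "Ck_real k f'"
    "\<And>t. (g has_real_derivative g' t) (at t)" "Ck_real k g'" by auto
  have "Ck_real k (\<lambda>t. f' t * g t + f t * g' t)"
    using Suc.IH * Suc.prems[THEN Ck_real_SucD] by (intro Ck_real_add) blast+
  with * show ?case
    by (auto intro!: exI[of _ "\<lambda>t. f' t * g t + f t * g' t"] derivative_eq_intros simp: mult.commute)
qed (auto intro: continuous_intros)

lemma Ck_real_affine: "Ck_real k f \<Longrightarrow> Ck_real k (\<lambda>t. f (c * t + e))"
proof (induction k arbitrary: f)
  case 0
  then show ?case by (auto intro!: continuous_intros continuous_on_compose2[where f="\<lambda>t. c * t + e"])
next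
  case (Suc k)
  then obtain f' where *: "\<And>t. (f has_real_derivative f' t) (at t)" "Ck_real k f'" by auto
  have "((\<lambda>t. f (c * t + e)) has_real_derivative f' (c * t + e) * c) (at t)" for t
    by (rule DERIV_chain2[OF *(1)]) (auto intro!: derivative_eq_intros)
  with Suc.IH[OF *(2)] show ?case by (auto intro!: exI[of _ "\<lambda>t. f' (c * t + e) * c"] Ck_real_mult)
qed

lemma Ck_real_antiderivative:
  "(\<And>t. (F has_real_derivative f t) (at t)) \<Longrightarrow> Ck_real k f \<Longrightarrow> Ck_real k F"
  by (rule Ck_real_SucD) auto

lemma partial_deriv_compose_real:
  assumes "(g has_real_derivative g') (at (f x))" "f differentiable (at x)"
  shows "(\<lambda>x. g (f x)) differentiable (at x)"
    and "partial_deriv i (\<lambda>x. g (f x)) x = g' * partial_deriv i f x"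
proof -
  obtain f' where f': "(f has_derivative f') (at x)"
    using assms(2) by (auto simp: differentiable_def)
  have *: "((\<lambda>x. g (f x)) has_derivative (\<lambda>v. g' * f' v)) (at x)"
    using has_derivative_compose[OF f', of g "\<lambda>h. g' * h"] assms(1)
    by (simp add: has_field_derivative_def)
  then show "(\<lambda>x. g (f x)) differentiable (at x)" by (auto simp: differentiable_def)
  show "partial_deriv i (\<lambda>x. g (f x)) x = g' * partial_deriv i f x"
    by (simp add: partial_deriv_eqI[OF *] partial_deriv_eqI[OF f'])
qed

lemma Ck_on_compose_real:
  "Ck_real k g \<Longrightarrow> Ck_on k UNIV f \<Longrightarrow> Ck_on k UNIV (\<lambda>x. g (f x))"
proof (induction k arbitrary: g f)
  case 0
  then show ?case by (auto intro: continuous_on_compose2)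
next
  case (Suc k)
  then obtain g' where g': "\<And>t. (g has_real_derivative g' t) (at t)" "Ck_real k g'" by auto
  have "partial_deriv i (\<lambda>x. g (f x)) = (\<lambda>x. g' (f x) * partial_deriv i f x)" for i
    by (intro ext partial_deriv_compose_real(2) g'(1)) (use Suc.prems(2) in simp)
  moreover have "Ck_on k UNIV (\<lambda>x. g' (f x) * partial_deriv i f x)" for i
    using Suc.IH[OF g'(2) Suc.prems(2)[THEN Ck_on_SucD]] Suc.prems(2) by (intro Ck_on_mult) auto
  ultimately show ?case
    using Suc.prems(2) by (auto intro!: partial_deriv_compose_real(1)[OF g'(1)])
qed

lemma Ck_on_norm_square: "Ck_on k UNIV (\<lambda>x::real^'d. x \<bullet> x)"
  unfolding inner_vec_def inner_real_def by (intro Ck_on_sum Ck_on_mult Ck_on_nth) auto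

text \<open>The functions \<open>exp (-1/t) / t^n\<close>, extended by zero to \<open>t \<le> 0\<close>, form a family that is
  closed under differentiation up to linear combinations; this makes the flat function
  \<open>exp (-1/t)\<close> smooth.\<close>

definition flat :: "nat \<Rightarrow> real \<Rightarrow> real" where
  "flat n t = (if 0 < t then exp (- inverse t) * inverse t ^ n else 0)"

lemma flat_tendsto_0: "(flat n \<longlongrightarrow> 0) (at 0)"
proof -
  have "((\<lambda>x::real. x ^ n / exp x) \<longlongrightarrow> 0) at_top" by (rule tendsto_power_div_exp_0)
  from filterlim_compose[OF this filterlim_inverse_at_top_right]
  have "((\<lambda>t::real. inverse t ^ n / exp (inverse t)) \<longlongrightarrow> 0) (at_right 0)" .
  then have "(flat n \<longlongrightarrow> 0) (at_right 0)"
    by (rule Lim_transform_eventually)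
      (auto simp: flat_def eventually_at_right_less exp_minus field_simps intro: eventually_at_rightI[of 0 1])
  moreover have "(flat n \<longlongrightarrow> 0) (at_left 0)"
    by (rule Lim_transform_eventually[OF tendsto_const[of 0]])
      (auto simp: flat_def intro: eventually_at_leftI[of "-1" 0])
  ultimately show ?thesis by (simp add: filterlim_at_split)
qed

lemma flat_has_derivative:
  "(flat n has_real_derivative (flat (n + 2) t - n * flat (n + 1) t)) (at t)"
proof -
  consider "t < 0" | "t = 0" | "t > 0" by linarith
  then show ?thesis
  proof cases
    case 1
    have "((\<lambda>t. 0) has_real_derivative 0) (at t)" by simp
    then have "(flat n has_real_derivative 0) (at t)"
      by (rule has_field_derivative_transform_within_open[of _ _ _ "{..<0}"])
        (use 1 in \<open>auto simp: flat_def\<close>)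
    with 1 show ?thesis by (simp add: flat_def)
  next
    case 2
    have "((\<lambda>h. (flat n (0 + h) - flat n 0) / h) \<longlongrightarrow> 0) (at 0)"
      by (rule Lim_transform_eventually[OF flat_tendsto_0[of "n + 1"]])
        (auto simp: flat_def field_simps eventually_at_filter)
    with 2 show ?thesis by (simp add: DERIV_def flat_def)
  next
    case 3
    have "((\<lambda>t. exp (- inverse t) * inverse t ^ n) has_real_derivative
        exp (- inverse t) * (inverse t * inverse t) * inverse t ^ n
        - exp (- inverse t) * (n * inverse t ^ (n - 1) * (inverse t * inverse t))) (at t)"
      using 3 by (auto intro!: derivative_eq_intros)
    moreover have "exp (- inverse t) * (inverse t * inverse t) * inverse t ^ n
        - exp (- inverse t) * (n * inverse t ^ (n - 1) * (inverse t * inverse t))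
        = flat (n + 2) t - n * flat (n + 1) t"
      using 3 by (cases n) (simp_all add: flat_def power2_eq_square)
    ultimately have "((\<lambda>t. exp (- inverse t) * inverse t ^ n) has_real_derivative
        (flat (n + 2) t - n * flat (n + 1) t)) (at t)" by simp
    then show ?thesis
      by (rule has_field_derivative_transform_within_open[of _ _ _ "{0<..}"])
        (use 3 in \<open>auto simp: flat_def\<close>)
  qed
qed

lemma Ck_real_flat: "Ck_real k (flat n)"
proof (induction k arbitrary: n)
  case 0
  then show ?case
    by (auto intro!: continuous_at_imp_continuous_on DERIV_isCont flat_has_derivative)
next
  case (Suc k)
  have "Ck_real k (\<lambda>t. flat (n + 2) t + (- real n) * flat (n + 1) t)"
    using Suc by (intro Ck_real_add Ck_real_mult) auto
  then show ?case
    using flat_has_derivative[of n] by (auto intro!: exI[of _ "\<lambda>t. flat (n+2) t - n * flat (n+1) t"])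
qed

text \<open>The singularity of the power at \<open>0\<close> is harmless because \<open>N\<close> vanishes up to \<open>r > 0\<close>. The
  exponent is arbitrary since it drops by one with each derivative.\<close>

lemma Ck_real_powr_mult:
  assumes "0 < r" "Ck_real k N" "\<And>t. t \<le> r \<Longrightarrow> N t = 0"
  shows "Ck_real k (\<lambda>t. t powr \<alpha> * N t)"
  using assms(2,3)
proof (induction k arbitrary: N \<alpha>)
  case 0
  have "isCont (\<lambda>t. t powr \<alpha> * N t) t" for t
  proof (cases "t < r")
    case True
    then have "\<forall>\<^sub>F y in nhds t. y powr \<alpha> * N y = 0"
      using 0(2) by (auto intro!: eventually_nhds_in_open[of "{..<r}", THEN eventually_mono])
    from isCont_cong[OF this] show ?thesis by simp
  next
    case False
    with assms(1) have "isCont (\<lambda>t. t powr \<alpha>) t" by (intro continuous_intros) auto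
    moreover have "isCont N t"
      using 0(1) continuous_on_eq_continuous_at[OF open_UNIV, of N] by simp
    ultimately show ?thesis by (intro continuous_mult)
  qed
  then show ?case by (auto intro: continuous_at_imp_continuous_on)
next
  case (Suc k)
  then obtain N' where N': "\<And>t. (N has_real_derivative N' t) (at t)" "Ck_real k N'" by auto
  have zero: "N' t = 0" if "t \<le> r" for t
  proof -
    \<comment> \<open>At \<open>t = r\<close> only the left difference quotients are known to vanish, which suffices.\<close>
    have "(N has_real_derivative N' t) (at t within {..t})"
      using N'(1) has_field_derivative_at_within by blast
    moreover have "(N has_real_derivative 0) (at t within {..t})"
      by (rule has_field_derivative_transform_within[of "\<lambda>t. 0" _ _ _ 1])
        (use Suc.prems(2) that in auto)
    ultimately show ?thesis
      by (rule has_field_derivative_unique) (simp add: trivial_limit_at_left_real at_within_Iic_at_left)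
  qed
  have "((\<lambda>t. t powr \<alpha> * N t) has_real_derivative
      \<alpha> * (t powr (\<alpha> - 1) * N t) + t powr \<alpha> * N' t) (at t)" for t
  proof (cases "t < r")
    case True
    have "((\<lambda>t. t powr \<alpha> * N t) has_real_derivative 0) (at t)"
      by (rule has_field_derivative_transform_within_open[of "\<lambda>t. 0" _ _ "{..<r}"])
        (use True Suc.prems(2) in auto)
    then show ?thesis using True Suc.prems(2) zero by simp
  next
    case False
    with assms(1) have "t > 0" by simp
    then show ?thesis by (auto intro!: derivative_eq_intros N'(1))
  qed
  moreover have "Ck_real k (\<lambda>t. \<alpha> * (t powr (\<alpha> - 1) * N t) + t powr \<alpha> * N' t)"
    using Suc.IH N' zero Suc.prems(2) Suc.prems(1)[THEN Ck_real_SucD] by (intro Ck_real_add Ck_real_mult[OF Ck_real_const]) auto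
  ultimately show ?case unfolding Ck_real.simps
    by (intro exI[of _ "\<lambda>t. \<alpha> * (t powr (\<alpha> - 1) * N t) + t powr \<alpha> * N' t"]) blast
qed

lemma ex_antiderivative:
  fixes f :: "real \<Rightarrow> real"
  assumes "continuous_on UNIV f"
  shows "\<exists>F. \<forall>t. (F has_real_derivative f t) (at t)"
  using einterval_antiderivative[of "-\<infinity>" "\<infinity>" f] assms
  by (auto simp: has_real_derivative_iff_has_vector_derivative continuous_on_eq_continuous_at)

lemma constant_on_interval_DERIV_zero:
  fixes g :: "real \<Rightarrow> real"
  assumes "convex T" "\<And>t. (g has_real_derivative g' t) (at t)" "\<And>t. t \<in> T \<Longrightarrow> g' t = 0"
    "s \<in> T" "t \<in> T"
  shows "g s = g t"
proof -
  have "(g has_real_derivative 0) (at t within T)" if "t \<in> T" for t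
    using assms(2)[of t] assms(3)[OF that] has_field_derivative_at_within by force
  from has_field_derivative_zero_constant[OF assms(1) this] show ?thesis
    using assms(4,5) by metis
qed

section \<open>Symmetry of second derivatives\<close>

lemma DERIV_line:
  fixes f :: "real ^ 'd \<Rightarrow> real"
  assumes "f differentiable (at (x + t *\<^sub>R axis i 1))"
  shows "((\<lambda>t. f (x + t *\<^sub>R axis i 1)) has_real_derivative partial_deriv i f (x + t *\<^sub>R axis i 1)) (at t)"
proof -
  obtain f' where f': "(f has_derivative f') (at (x + t *\<^sub>R axis i 1))"
    using assms by (auto simp: differentiable_def)
  interpret linear f' using f' has_derivative_linear by blast
  have "((\<lambda>t. x + t *\<^sub>R axis i 1) has_derivative (\<lambda>h. h *\<^sub>R axis i 1)) (at t)"
    by (auto intro!: derivative_eq_intros)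
  from has_derivative_compose[OF this f'] show ?thesis
    by (simp add: has_field_derivative_def partial_deriv_eqI[OF f'] scaleR mult_commute_abs)
qed

text \<open>The second difference quotient in the directions \<open>i\<close> and \<open>j\<close> is symmetric, and two
  applications of the mean value theorem turn it into a mixed derivative at a nearby point.\<close>

lemma second_difference_mean_value:
  fixes f :: "real ^ 'd \<Rightarrow> real"
  assumes "Ck_on 2 UNIV f" "0 < h"
  shows "\<exists>s t. 0 < s \<and> s < h \<and> 0 < t \<and> t < h \<and>
    f (x + h *\<^sub>R axis i 1 + h *\<^sub>R axis j 1) - f (x + h *\<^sub>R axis i 1) - f (x + h *\<^sub>R axis j 1) + f x
      = h * h * partial_deriv j (partial_deriv i f) (x + s *\<^sub>R axis i 1 + t *\<^sub>R axis j 1)"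
proof -
  have d1: "f differentiable (at y)" "partial_deriv i f differentiable (at y)" for y i
    using assms(1) by (auto simp: numeral_2_eq_2)
  define g where "g s = f ((x + h *\<^sub>R axis j 1) + s *\<^sub>R axis i 1) - f (x + s *\<^sub>R axis i 1)" for s
  have "(g has_real_derivative (partial_deriv i f ((x + h *\<^sub>R axis j 1) + s *\<^sub>R axis i 1)
      - partial_deriv i f (x + s *\<^sub>R axis i 1))) (at s)" for s
    unfolding g_def by (intro DERIV_diff DERIV_line d1)
  from MVT2[OF assms(2) this] obtain s where s: "0 < s" "s < h"
    "g h - g 0 = h * (partial_deriv i f ((x + h *\<^sub>R axis j 1) + s *\<^sub>R axis i 1)
      - partial_deriv i f (x + s *\<^sub>R axis i 1))" by auto
  define k where "k t = partial_deriv i f ((x + s *\<^sub>R axis i 1) + t *\<^sub>R axis j 1)" for t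
  have "(k has_real_derivative
     partial_deriv j (partial_deriv i f) ((x + s *\<^sub>R axis i 1) + t *\<^sub>R axis j 1)) (at t)" for t
    unfolding k_def by (intro DERIV_line d1)
  from MVT2[OF assms(2) this] obtain t where t: "0 < t" "t < h"
    "k h - k 0 = h * partial_deriv j (partial_deriv i f) ((x + s *\<^sub>R axis i 1) + t *\<^sub>R axis j 1)" by auto
  have "f (x + h *\<^sub>R axis i 1 + h *\<^sub>R axis j 1) - f (x + h *\<^sub>R axis i 1) - f (x + h *\<^sub>R axis j 1) + f x
      = g h - g 0"
    by (simp add: g_def algebra_simps)
  also have "\<dots> = h * (k h - k 0)" by (simp add: s k_def algebra_simps)
  also have "\<dots> = h * h * partial_deriv j (partial_deriv i f) ((x + s *\<^sub>R axis i 1) + t *\<^sub>R axis j 1)"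
    by (simp add: t)
  finally show ?thesis using s t by (intro exI[of _ s] exI[of _ t]) simp
qed

lemma partial_deriv_commute:
  fixes f :: "real ^ 'd \<Rightarrow> real"
  assumes "Ck_on 2 UNIV f"
  shows "partial_deriv i (partial_deriv j f) x = partial_deriv j (partial_deriv i f) x"
proof -
  define h where "h n = 1 / real (Suc n)" for n
  have h: "0 < h n" for n by (simp add: h_def)
  have h0: "h \<longlonglongrightarrow> 0" unfolding h_def by (rule lim_1_over_n[THEN LIMSEQ_Suc])
  define \<Delta> where "\<Delta> n = (f (x + h n *\<^sub>R axis i 1 + h n *\<^sub>R axis j 1) - f (x + h n *\<^sub>R axis i 1)
     - f (x + h n *\<^sub>R axis j 1) + f x) / (h n * h n)" for n
  have lim: "(\<lambda>n. partial_deriv q (partial_deriv p f) (x + s n *\<^sub>R axis p 1 + t n *\<^sub>R axis q 1))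
      \<longlonglongrightarrow> partial_deriv q (partial_deriv p f) x"
    if "\<And>n. 0 < s n \<and> s n < h n" "\<And>n. 0 < t n \<and> t n < h n" for s t p q
  proof -
    have st: "s \<longlonglongrightarrow> 0" "t \<longlonglongrightarrow> 0"
      using that by (auto intro!: tendsto_sandwich[OF _ _ tendsto_const h0] always_eventually less_imp_le)
    have "(\<lambda>n. x + s n *\<^sub>R axis p 1 + t n *\<^sub>R axis q 1) \<longlonglongrightarrow> x + 0 *\<^sub>R axis p 1 + 0 *\<^sub>R axis q 1"
      by (intro tendsto_intros st)
    moreover have "isCont (partial_deriv q (partial_deriv p f)) x"
      using assms by (auto simp: numeral_2_eq_2 continuous_on_eq_continuous_at)
    ultimately show ?thesis by (auto intro: isCont_tendsto_compose)
  qed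
  have \<Delta>_lim: "\<Delta> \<longlonglongrightarrow> partial_deriv q (partial_deriv p f) x"
    if \<Delta>: "\<And>n. \<Delta> n * (h n * h n) = f (x + h n *\<^sub>R axis p 1 + h n *\<^sub>R axis q 1)
      - f (x + h n *\<^sub>R axis p 1) - f (x + h n *\<^sub>R axis q 1) + f x" for p q
  proof -
    have "\<forall>n. \<exists>s t. 0 < s \<and> s < h n \<and> 0 < t \<and> t < h n \<and>
       \<Delta> n = partial_deriv q (partial_deriv p f) (x + s *\<^sub>R axis p 1 + t *\<^sub>R axis q 1)"
    proof
      fix n
      obtain s t where st: "0 < s" "s < h n" "0 < t" "t < h n" "\<Delta> n * (h n * h n)
        = h n * h n * partial_deriv q (partial_deriv p f) (x + s *\<^sub>R axis p 1 + t *\<^sub>R axis q 1)"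
        using second_difference_mean_value[OF assms h[of n], of x p q] \<Delta>[of n] by metis
      then have "\<Delta> n = partial_deriv q (partial_deriv p f) (x + s *\<^sub>R axis p 1 + t *\<^sub>R axis q 1)"
        using h[of n] by (simp add: mult.commute)
      with st show "\<exists>s t. 0 < s \<and> s < h n \<and> 0 < t \<and> t < h n \<and>
         \<Delta> n = partial_deriv q (partial_deriv p f) (x + s *\<^sub>R axis p 1 + t *\<^sub>R axis q 1)"
        by blast
    qed
    then obtain s t where "\<And>n. 0 < s n \<and> s n < h n" "\<And>n. 0 < t n \<and> t n < h n"
      and "\<And>n. \<Delta> n = partial_deriv q (partial_deriv p f) (x + s n *\<^sub>R axis p 1 + t n *\<^sub>R axis q 1)"
      unfolding choice_iff by blast
    then show ?thesis using lim[of s t q p] by presburger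
  qed
  have "\<Delta> n * (h n * h n) = f (x + h n *\<^sub>R axis i 1 + h n *\<^sub>R axis j 1)
      - f (x + h n *\<^sub>R axis i 1) - f (x + h n *\<^sub>R axis j 1) + f x" for n
    using h[of n] by (simp add: \<Delta>_def)
  note \<Delta>_eq = this
  have A: "\<Delta> \<longlonglongrightarrow> partial_deriv j (partial_deriv i f) x"
    by (rule \<Delta>_lim) (rule \<Delta>_eq)
  have "\<Delta> \<longlonglongrightarrow> partial_deriv i (partial_deriv j f) x"
    by (rule \<Delta>_lim) (simp add: \<Delta>_eq algebra_simps)
  with A show ?thesis using LIMSEQ_unique by blast
qed

section \<open>Test functions and integration by parts\<close>

lemma smooth_on_Ck: "smooth_on S f \<Longrightarrow> Ck_on k S f"
  by (simp add: smooth_on_def)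

lemma smooth_on_differentiable: "smooth_on UNIV f \<Longrightarrow> f differentiable (at x)"
  using smooth_on_Ck[of UNIV f "Suc 0"] by simp

lemma smooth_on_continuous_on: "smooth_on S f \<Longrightarrow> continuous_on S f"
  using smooth_on_Ck[of S f 0] by simp

lemma smooth_on_partial_deriv: "smooth_on S f \<Longrightarrow> smooth_on S (partial_deriv i f)"
  unfolding smooth_on_def by (metis Ck_on.simps(2))

lemma smooth_on_const: "smooth_on S (\<lambda>x. c)"
  by (simp add: smooth_on_def)

lemma smooth_on_add:
  "smooth_on UNIV f \<Longrightarrow> smooth_on UNIV g \<Longrightarrow> smooth_on UNIV (\<lambda>x. f x + g x)"
  by (simp add: smooth_on_def Ck_on_add)

lemma smooth_on_mult:
  "smooth_on UNIV f \<Longrightarrow> smooth_on UNIV g \<Longrightarrow> smooth_on UNIV (\<lambda>x. f x * g x)"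
  by (simp add: smooth_on_def Ck_on_mult)

lemma test_functionsI:
  assumes "smooth_on UNIV \<phi>" "compact K" "K \<subseteq> \<Omega>" "\<And>x. x \<notin> K \<Longrightarrow> \<phi> x = 0"
  shows "\<phi> \<in> test_functions \<Omega>"
proof -
  have sub: "closure {x. \<phi> x \<noteq> 0} \<subseteq> K"
    using assms by (intro closure_minimal) (auto intro: compact_imp_closed)
  moreover have "compact (closure {x. \<phi> x \<noteq> 0})"
    using sub assms(2) by (meson bounded_subset closed_closure compact_eq_bounded_closed)
  ultimately show ?thesis
    using assms by (auto simp: test_functions_def compactly_contained_def)
qed

lemma test_functions_support:
  assumes "\<phi> \<in> test_functions \<Omega>"
  shows "\<exists>K. compact K \<and> K \<subseteq> \<Omega> \<and> (\<forall>x. x \<notin> K \<longrightarrow> \<phi> x = 0)"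
  using assms closure_subset[of "{x. \<phi> x \<noteq> 0}"]
  by (intro exI[of _ "closure {x. \<phi> x \<noteq> 0}"])
    (auto simp: test_functions_def compactly_contained_def)

lemma test_functions_smooth: "\<phi> \<in> test_functions \<Omega> \<Longrightarrow> smooth_on UNIV \<phi>"
  by (simp add: test_functions_def)

lemmas test_functions_differentiable = test_functions_smooth[THEN smooth_on_differentiable]
lemmas test_functions_continuous = test_functions_smooth[THEN smooth_on_continuous_on]

lemma test_functions_zero: "(\<lambda>x. 0) \<in> test_functions \<Omega>"
  by (rule test_functionsI[of _ "{}"]) (auto simp: smooth_on_const)

lemma test_functions_add:
  assumes "\<phi> \<in> test_functions \<Omega>" "\<eta> \<in> test_functions \<Omega>"
  shows "(\<lambda>x. \<phi> x + \<eta> x) \<in> test_functions \<Omega>"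
proof -
  obtain K where "compact K" "K \<subseteq> \<Omega>" "\<And>x. x \<notin> K \<Longrightarrow> \<phi> x = 0"
    using test_functions_support[OF assms(1)] by blast
  moreover obtain L where "compact L" "L \<subseteq> \<Omega>" "\<And>x. x \<notin> L \<Longrightarrow> \<eta> x = 0"
    using test_functions_support[OF assms(2)] by blast
  ultimately show ?thesis
    using assms by (intro test_functionsI[of _ "K \<union> L"] smooth_on_add) (auto simp: test_functions_smooth)
qed

lemma test_functions_mult:
  assumes "\<phi> \<in> test_functions \<Omega>" "smooth_on UNIV g"
  shows "(\<lambda>x. g x * \<phi> x) \<in> test_functions \<Omega>"
proof -
  obtain K where "compact K" "K \<subseteq> \<Omega>" "\<And>x. x \<notin> K \<Longrightarrow> \<phi> x = 0"
    using test_functions_support[OF assms(1)] by blast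
  then show ?thesis
    using assms by (intro test_functionsI[of _ K] smooth_on_mult) (auto simp: test_functions_smooth)
qed

lemma test_functions_cmult:
  "\<phi> \<in> test_functions \<Omega> \<Longrightarrow> (\<lambda>x. c * \<phi> x) \<in> test_functions \<Omega>"
  by (rule test_functions_mult) (simp_all add: smooth_on_const)

lemma test_functions_sum:
  "finite I \<Longrightarrow> (\<And>j. j \<in> I \<Longrightarrow> \<phi> j \<in> test_functions \<Omega>) \<Longrightarrow>
     (\<lambda>x. \<Sum>j\<in>I. \<phi> j x) \<in> test_functions \<Omega>"
  by (induction I rule: finite_induct) (auto intro: test_functions_add test_functions_zero)

lemma partial_deriv_zero_off_support:
  assumes "closed K" "\<And>x. x \<notin> K \<Longrightarrow> f x = 0" "x \<notin> K"
  shows "partial_deriv i f x = 0"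
  using partial_deriv_cong_open[of "- K" x f "\<lambda>x. 0"] assms by auto

lemma test_functions_partial:
  assumes "\<phi> \<in> test_functions \<Omega>"
  shows "partial_deriv i \<phi> \<in> test_functions \<Omega>"
proof -
  obtain K where "compact K" "K \<subseteq> \<Omega>" "\<And>x. x \<notin> K \<Longrightarrow> \<phi> x = 0"
    using test_functions_support[OF assms] by blast
  then show ?thesis
    using assms partial_deriv_zero_off_support[of K \<phi>]
    by (intro test_functionsI[of _ K] smooth_on_partial_deriv)
      (auto simp: test_functions_smooth compact_imp_closed)
qed

lemma integrable_continuous_compact_support:
  fixes f :: "'a::euclidean_space \<Rightarrow> real"
  assumes "continuous_on UNIV f" "compact K" "\<And>x. x \<notin> K \<Longrightarrow> f x = 0"
  shows "integrable lborel f"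
proof -
  have "integrable lborel (\<lambda>x. indicator K x *\<^sub>R f x)"
    using assms by (intro borel_integrable_compact) (auto intro: continuous_on_subset)
  also have "(\<lambda>x. indicator K x *\<^sub>R f x) = f"
    using assms(3) by (auto simp: indicator_def fun_eq_iff)
  finally show ?thesis .
qed

lemma continuous_compact_support_bounded:
  fixes f :: "'a::euclidean_space \<Rightarrow> real"
  assumes "continuous_on UNIV f" "compact K" "\<And>x. x \<notin> K \<Longrightarrow> f x = 0"
  shows "\<exists>B\<ge>0. \<forall>x. \<bar>f x\<bar> \<le> B"
proof -
  have "bounded (f ` K)"
    using assms by (intro compact_imp_bounded compact_continuous_image) (auto intro: continuous_on_subset)
  then obtain B where B: "0 < B" "\<And>x. x \<in> K \<Longrightarrow> \<bar>f x\<bar> \<le> B"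
    unfolding bounded_pos by auto
  have "\<bar>f x\<bar> \<le> B" for x
    using B(1) B(2)[of x] assms(3)[of x] by (cases "x \<in> K") auto
  with B(1) show ?thesis by (intro exI[of _ B]) auto
qed

text \<open>The difference quotients of \<open>f\<close> have integral zero because Lebesgue measure is invariant under
  translations. By the mean value theorem they are dominated, so this passes to the limit without
  integrating along one coordinate first.\<close>

lemma integral_partial_deriv_eq_0:
  fixes f :: "real ^ 'd \<Rightarrow> real"
  assumes diff: "\<And>x. f differentiable (at x)" and cont: "continuous_on UNIV (partial_deriv i f)"
    and K: "compact K" "\<And>x. x \<notin> K \<Longrightarrow> f x = 0"
  shows "integral\<^sup>L lborel (partial_deriv i f) = 0"
proof -
  let ?e = "axis i (1::real)"
  define h where "h n = 1 / real (Suc n)" for n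
  have h: "0 < h n" "h n \<le> 1" for n by (auto simp: h_def)
  have h0: "h \<longlonglongrightarrow> 0" unfolding h_def by (rule lim_1_over_n[THEN LIMSEQ_Suc])
  have contf: "continuous_on UNIV f"
    using diff by (auto intro!: continuous_at_imp_continuous_on differentiable_imp_continuous_within)
  have off: "partial_deriv i f x = 0" if "x \<notin> K" for x
    using K that by (auto intro: partial_deriv_zero_off_support compact_imp_closed)
  have "\<exists>B\<ge>0. \<forall>x. \<bar>partial_deriv i f x\<bar> \<le> B"
    by (rule continuous_compact_support_bounded[OF cont K(1)]) (rule off)
  then obtain B where B: "0 \<le> B" "\<forall>x. \<bar>partial_deriv i f x\<bar> \<le> B" by blast
  obtain R where "\<forall>x\<in>K. norm x \<le> R"
    using compact_imp_bounded[OF K(1)] unfolding bounded_iff by blast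
  then have R: "K \<subseteq> cball 0 R" by auto
  have intf: "integrable lborel f"
    using contf K by (rule integrable_continuous_compact_support)
  define F where "F n x = (f (h n *\<^sub>R ?e + x) - f x) / h n" for n x
  have shift: "integrable lborel (\<lambda>x. f (c + x))" "integral\<^sup>L lborel (\<lambda>x. f (c + x)) = integral\<^sup>L lborel f" for c
  proof -
    have "integrable (distr lborel borel ((+) c)) f" using intf by (simp add: lborel_distr_plus)
    then show "integrable lborel (\<lambda>x. f (c + x))" by (subst (asm) integrable_distr_eq) (use intf in auto)
    have "integral\<^sup>L lborel f = integral\<^sup>L (distr lborel borel ((+) c)) f" by (simp add: lborel_distr_plus)
    also have "\<dots> = integral\<^sup>L lborel (\<lambda>x. f (c + x))" by (subst integral_distr) (use intf in auto)
    finally show "integral\<^sup>L lborel (\<lambda>x. f (c + x)) = integral\<^sup>L lborel f" by simp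
  qed
  have F0: "integral\<^sup>L lborel (F n) = 0" for n
    unfolding F_def using shift intf by simp
  have "(\<lambda>n. integral\<^sup>L lborel (F n)) \<longlonglongrightarrow> integral\<^sup>L lborel (partial_deriv i f)"
  proof (rule integral_dominated_convergence[where w = "\<lambda>x. B * indicator (cball 0 (R + 1)) x"])
    show "partial_deriv i f \<in> borel_measurable lborel"
      using cont by (simp add: borel_measurable_continuous_onI)
    show "F n \<in> borel_measurable lborel" for n
      unfolding F_def using shift intf by (intro borel_measurable_divide borel_measurable_diff) auto
    show "integrable lborel (\<lambda>x. B * indicator (cball 0 (R + 1) :: (real ^ 'd) set) x :: real)"
      using emeasure_compact_finite[OF compact_cball, of "0 :: real ^ 'd" "R + 1"]
      by (intro integrable_mult_right integrable_real_indicator) auto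
    show "AE x in lborel. norm (F n x) \<le> B * indicator (cball 0 (R + 1)) x" for n
    proof (rule AE_I2)
      fix x
      show "norm (F n x) \<le> B * indicator (cball 0 (R + 1)) x"
      proof (cases "x \<in> cball 0 (R + 1)")
        case True
        have "\<exists>z>0. z < h n \<and> f (x + h n *\<^sub>R ?e) - f (x + 0 *\<^sub>R ?e)
            = (h n - 0) * partial_deriv i f (x + z *\<^sub>R ?e)"
          by (rule MVT2[OF h(1)]) (intro DERIV_line diff)
        then obtain z where "f (x + h n *\<^sub>R ?e) - f x = h n * partial_deriv i f (x + z *\<^sub>R ?e)" by auto
        then have "F n x = partial_deriv i f (x + z *\<^sub>R ?e)"
          using h(1)[of n] by (simp add: F_def add.commute)
        with B True show ?thesis by simp
      next
        case False
        have "norm (h n *\<^sub>R ?e) \<le> 1" using h[of n] by (simp add: norm_axis_1)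
        then have "norm (h n *\<^sub>R ?e + x) \<ge> norm x - 1"
          using norm_diff_ineq[of x "h n *\<^sub>R ?e"] by (simp add: add.commute)
        with False have "h n *\<^sub>R ?e + x \<notin> cball 0 R" "x \<notin> cball 0 R" by auto
        then have "f (h n *\<^sub>R ?e + x) = 0" "f x = 0" using R K by blast+
        then show ?thesis using B by (simp add: F_def)
      qed
    qed
    show "AE x in lborel. (\<lambda>n. F n x) \<longlonglongrightarrow> partial_deriv i f x"
    proof (rule AE_I2)
      fix x
      have "((\<lambda>t. f (x + t *\<^sub>R ?e)) has_real_derivative partial_deriv i f (x + 0 *\<^sub>R ?e)) (at 0)"
        by (intro DERIV_line diff)
      then have "((\<lambda>t. (f (x + t *\<^sub>R ?e) - f x) / t) \<longlongrightarrow> partial_deriv i f x) (at 0)"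
        by (simp add: DERIV_def)
      moreover have "filterlim h (at 0) sequentially"
        using h h0 by (auto simp: filterlim_at intro!: always_eventually less_imp_neq[symmetric])
      ultimately have "(\<lambda>n. (f (x + h n *\<^sub>R ?e) - f x) / h n) \<longlonglongrightarrow> partial_deriv i f x"
        by (rule filterlim_compose)
      then show "(\<lambda>n. F n x) \<longlonglongrightarrow> partial_deriv i f x" by (simp add: F_def add.commute)
    qed
  qed
  then show ?thesis using F0 LIMSEQ_unique[OF _ tendsto_const] by simp
qed

lemma integral_by_parts_compact_support:
  fixes f g :: "real ^ 'd \<Rightarrow> real"
  assumes f: "\<And>x. f differentiable (at x)" "continuous_on UNIV (partial_deriv i f)"
    and g: "\<And>x. g differentiable (at x)" "continuous_on UNIV (partial_deriv i g)"
    and K: "compact K" "\<And>x. x \<notin> K \<Longrightarrow> f x = 0"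
  shows "integral\<^sup>L lborel (\<lambda>x. f x * partial_deriv i g x) = - integral\<^sup>L lborel (\<lambda>x. partial_deriv i f x * g x)"
proof -
  have cont: "continuous_on UNIV f" "continuous_on UNIV g"
    using f g by (auto intro!: continuous_at_imp_continuous_on differentiable_imp_continuous_within)
  have off: "partial_deriv i f x = 0" if "x \<notin> K" for x
    using K that by (auto intro: partial_deriv_zero_off_support compact_imp_closed)
  have eq: "partial_deriv i (\<lambda>x. f x * g x) = (\<lambda>x. f x * partial_deriv i g x + partial_deriv i f x * g x)"
    by (intro ext partial_deriv_mult f g)
  have "integral\<^sup>L lborel (partial_deriv i (\<lambda>x. f x * g x)) = 0"
    unfolding eq[symmetric] 
  proof (rule integral_partial_deriv_eq_0[OF _ _ K(1)])
    show "continuous_on UNIV (partial_deriv i (\<lambda>x. f x * g x))"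
      unfolding eq by (intro continuous_intros cont f g)
  qed (use f g K in auto)
  moreover have "integrable lborel (\<lambda>x. f x * partial_deriv i g x)"
    by (rule integrable_continuous_compact_support[OF _ K(1)]) (use K in \<open>auto intro!: continuous_intros cont f g\<close>)
  moreover have "integrable lborel (\<lambda>x. partial_deriv i f x * g x)"
    by (rule integrable_continuous_compact_support[OF _ K(1)]) (use off in \<open>auto intro!: continuous_intros cont f g\<close>)
  ultimately show ?thesis by (simp add: eq)
qed

lemma test_functions_by_parts:
  assumes "\<phi> \<in> test_functions UNIV" "\<eta> \<in> test_functions UNIV"
  shows "integral\<^sup>L lborel (\<lambda>x. \<phi> x * partial_deriv i \<eta> x) = - integral\<^sup>L lborel (\<lambda>x. partial_deriv i \<phi> x * \<eta> x)"
proof -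
  obtain K where K: "compact K" "\<And>x. x \<notin> K \<Longrightarrow> \<phi> x = 0"
    using test_functions_support[OF assms(1)] by blast
  show ?thesis
    by (rule integral_by_parts_compact_support[OF
          test_functions_differentiable[OF assms(1)]
          test_functions_continuous[OF test_functions_partial[OF assms(1)]]
          test_functions_differentiable[OF assms(2)]
          test_functions_continuous[OF test_functions_partial[OF assms(2)]] K])
qed

lemma test_functions_mono: "\<phi> \<in> test_functions \<Omega> \<Longrightarrow> \<Omega> \<subseteq> \<Omega>' \<Longrightarrow> \<phi> \<in> test_functions \<Omega>'"
  unfolding test_functions_def compactly_contained_def by blast

lemma test_functions_integrable_mult:
  assumes "\<phi> \<in> test_functions \<Omega>" "continuous_on UNIV g"
  shows "integrable lborel (\<lambda>x. \<phi> x * g x)"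
proof -
  obtain K where K: "compact K" "\<And>x. x \<notin> K \<Longrightarrow> \<phi> x = 0"
    using test_functions_support[OF assms(1)] by blast
  have "continuous_on UNIV (\<lambda>x. \<phi> x * g x)"
    by (intro continuous_on_mult assms test_functions_continuous[OF assms(1)])
  then show ?thesis
    by (rule integrable_continuous_compact_support[OF _ K(1)]) (simp add: K)
qed

lemma set_integral_lebesgue_eq_lborel:
  fixes f :: "'a::euclidean_space \<Rightarrow> real"
  assumes "f \<in> borel_measurable borel" "\<And>x. x \<notin> S \<Longrightarrow> f x = 0"
  shows "(LINT x:S|lebesgue. f x) = integral\<^sup>L lborel f"
proof -
  have "(\<lambda>x. indicator S x *\<^sub>R f x) = f"
    using assms(2) by (auto simp: indicator_def fun_eq_iff)
  then show ?thesis
    using assms(1) by (simp add: set_lebesgue_integral_def integral_completion)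
qed

section \<open>The fundamental lemma of the calculus of variations\<close>

text \<open>Test functions increasing to the indicator of an open box: the one-dimensional profile
  \<open>exp (-1/(n t))\<close> tends to \<open>1\<close> for \<open>t > 0\<close>.\<close>

definition box_bump :: "real ^ 'd \<Rightarrow> real ^ 'd \<Rightarrow> nat \<Rightarrow> real ^ 'd \<Rightarrow> real" where
  "box_bump a b n x = (\<Prod>j\<in>UNIV. flat 0 (real (Suc n) * ((x $ j - a $ j) * (b $ j - x $ j))))"

lemma smooth_box_bump: "smooth_on UNIV (box_bump a b n)"
proof -
  have "Ck_on k UNIV (\<lambda>x. flat 0 (real (Suc n) * ((x $ j - a $ j) * (b $ j - x $ j))))" for k j
  proof (rule Ck_on_compose_real[OF Ck_real_flat])
    have "Ck_on k UNIV (\<lambda>x. real (Suc n) * ((x $ j + - a $ j) * (b $ j + (-1) * x $ j)))"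
      by (intro Ck_on_mult Ck_on_add Ck_on_nth Ck_on_const)
    then show "Ck_on k UNIV (\<lambda>x. real (Suc n) * ((x $ j - a $ j) * (b $ j - x $ j)))" by simp
  qed
  then show ?thesis unfolding smooth_on_def box_bump_def by (auto intro: Ck_on_prod)
qed

lemma flat_0_bounds: "0 \<le> flat 0 t" "flat 0 t \<le> 1"
  by (auto simp: flat_def)

lemma box_bump_bounds: "0 \<le> box_bump a b n x" "box_bump a b n x \<le> 1"
  unfolding box_bump_def by (auto intro!: prod_nonneg prod_le_1 flat_0_bounds)

lemma box_bump_outside:
  assumes "box a b \<noteq> {}" "x \<notin> box a b"
  shows "box_bump a b n x = 0"
proof -
  obtain j where j: "\<not> (a $ j < x $ j \<and> x $ j < b $ j)"
    using assms(2) by (auto simp: mem_box_cart)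
  \<comment> \<open>For an empty box both factors below could be negative, and their product positive.\<close>
  have "a $ j < b $ j"
    using assms(1) by (auto simp: mem_box_cart) (meson less_trans)
  then have "(x $ j - a $ j) * (b $ j - x $ j) \<le> 0"
    using j by (intro mult_le_0_iff[THEN iffD2]) auto
  then have "flat 0 (real (Suc n) * ((x $ j - a $ j) * (b $ j - x $ j))) = 0"
    by (simp add: flat_def mult_le_0_iff not_less mult_nonneg_nonpos)
  then show ?thesis unfolding box_bump_def by (intro prod_zero) auto
qed

lemma flat_0_tendsto_1:
  assumes "0 < t"
  shows "(\<lambda>n. flat 0 (real (Suc n) * t)) \<longlonglongrightarrow> 1"
proof -
  have "(\<lambda>n. exp (- (inverse (real (Suc n)) * inverse t))) \<longlonglongrightarrow> exp (- (0 * inverse t))"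
    by (intro tendsto_intros LIMSEQ_inverse_real_of_nat)
  then show ?thesis using assms by (simp add: flat_def)
qed

lemma box_bump_tendsto:
  assumes "box a b \<noteq> {}"
  shows "(\<lambda>n. box_bump a b n x) \<longlonglongrightarrow> indicator (box a b) x"
proof (cases "x \<in> box a b")
  case True
  then have "(\<lambda>n. box_bump a b n x) \<longlonglongrightarrow> (\<Prod>j\<in>(UNIV::'a set). 1)"
    unfolding box_bump_def by (intro tendsto_prod flat_0_tendsto_1) (auto simp: mem_box_cart)
  with True show ?thesis by simp
next
  case False
  then show ?thesis using box_bump_outside[OF assms] by simp
qed

lemma box_bump_test_function:
  assumes "box a b \<noteq> {}" "cbox a b \<subseteq> \<Omega>"
  shows "box_bump a b n \<in> test_functions \<Omega>"
  using assms box_subset_cbox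
  by (intro test_functionsI[of _ "cbox a b"] smooth_box_bump) (auto intro!: box_bump_outside)

lemma L1_loc_integrable_indicator:
  assumes "w \<in> L1_loc \<Omega>" "compact K" "K \<subseteq> \<Omega>" "S \<subseteq> K" "S \<in> sets lebesgue"
  shows "integrable lebesgue (\<lambda>x. indicator S x * w x)"
proof -
  have "set_integrable lebesgue K w" using assms by (auto simp: L1_loc_def)
  then have "set_integrable lebesgue S w" by (rule set_integrable_subset) (use assms in auto)
  then show ?thesis by (simp add: set_integrable_def)
qed

lemma integral_box_eq_0:
  assumes w: "w \<in> L1_loc \<Omega>" and orth: "\<forall>\<phi>\<in>test_functions \<Omega>. (LINT x:\<Omega>|lebesgue. w x * \<phi> x) = 0"
    and sub: "cbox a b \<subseteq> \<Omega>"
  shows "integral\<^sup>L lebesgue (\<lambda>x. indicator (box a b) x * w x) = 0"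
proof (cases "box a b = {}")
  case False
  have int: "integrable lebesgue (\<lambda>x. indicator (cbox a b) x * w x)"
    by (rule L1_loc_integrable_indicator[OF w _ sub]) auto
  have intb: "integrable lebesgue (\<lambda>x. indicator (box a b) x * w x)"
    by (rule L1_loc_integrable_indicator[OF w _ sub]) (auto simp: box_subset_cbox)
  have eq: "box_bump a b n x * (indicator (cbox a b) x * w x) = indicator \<Omega> x *\<^sub>R (w x * box_bump a b n x)" for n x
    using box_bump_outside[OF False, of x n] box_subset_cbox[of a b] sub
    by (auto simp: indicator_def)
  have "(\<lambda>n. integral\<^sup>L lebesgue (\<lambda>x. box_bump a b n x * (indicator (cbox a b) x * w x)))
      \<longlonglongrightarrow> integral\<^sup>L lebesgue (\<lambda>x. indicator (box a b) x * w x)"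
  proof (rule integral_dominated_convergence[where w = "\<lambda>x. norm (indicator (cbox a b) x * w x)"])
    show "(\<lambda>x. indicator (box a b) x * w x) \<in> borel_measurable lebesgue" using intb by auto
    have "box_bump a b n \<in> borel_measurable lebesgue" for n
      using smooth_on_continuous_on[OF smooth_box_bump, of a b n]
      by (intro measurable_completion) (auto intro: borel_measurable_continuous_onI)
    then show "(\<lambda>x. box_bump a b n x * (indicator (cbox a b) x * w x)) \<in> borel_measurable lebesgue" for n
      by (rule borel_measurable_times[OF _ borel_measurable_integrable[OF int]])
    show "integrable lebesgue (\<lambda>x. norm (indicator (cbox a b) x * w x))" using int by (rule integrable_norm)
    show "AE x in lebesgue. (\<lambda>n. box_bump a b n x * (indicator (cbox a b) x * w x))
        \<longlonglongrightarrow> indicator (box a b) x * w x"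
    proof (rule AE_I2)
      fix x
      have "(\<lambda>n. box_bump a b n x * (indicator (cbox a b) x * w x))
          \<longlonglongrightarrow> indicator (box a b) x * (indicator (cbox a b) x * w x)"
        by (intro tendsto_intros box_bump_tendsto False)
      also have "indicator (box a b) x * (indicator (cbox a b) x * w x) = indicator (box a b) x * w x"
        using box_subset_cbox[of a b] by (auto simp: indicator_def)
      finally show "(\<lambda>n. box_bump a b n x * (indicator (cbox a b) x * w x))
        \<longlonglongrightarrow> indicator (box a b) x * w x" .
    qed
    show "AE x in lebesgue. norm (box_bump a b n x * (indicator (cbox a b) x * w x))
        \<le> norm (indicator (cbox a b) x * w x)" for n
      by (intro AE_I2) (simp add: abs_mult mult_left_le_one_le box_bump_bounds del: abs_indicator)
  qed
  moreover have "integral\<^sup>L lebesgue (\<lambda>x. box_bump a b n x * (indicator (cbox a b) x * w x)) = 0" for n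
    using bspec[OF orth box_bump_test_function[OF False sub, of n]]
    by (simp add: eq set_lebesgue_integral_def)
  ultimately show ?thesis using LIMSEQ_unique[OF _ tendsto_const] by simp
qed simp

lemma box_Int_box_cart: "\<exists>a b. box (p::real^'d) q \<inter> box c d = box a b"
  by (rule exI[of _ "\<chi> i. max (p $ i) (c $ i)"], rule exI[of _ "\<chi> i. min (q $ i) (d $ i)"])
    (auto simp: set_eq_iff mem_box_cart)

text \<open>The open boxes are stable under intersection and generate the Borel sets. Hence integrals that vanish
  over all boxes vanish over all Borel sets.\<close>

lemma AE_zero_on_box:
  fixes w :: "real ^ 'd \<Rightarrow> real"
  assumes w: "w \<in> L1_loc \<Omega>" and orth: "\<forall>\<phi>\<in>test_functions \<Omega>. (LINT x:\<Omega>|lebesgue. w x * \<phi> x) = 0"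
    and sub: "cbox c d \<subseteq> \<Omega>"
  shows "AE x in lebesgue. x \<in> box c d \<longrightarrow> w x = 0"
proof -
  define w1 where "w1 x = indicator (box c d) x * w x" for x
  have w1: "integrable lebesgue w1"
    unfolding w1_def by (rule L1_loc_integrable_indicator[OF w _ sub]) (auto simp: box_subset_cbox)
  obtain w' where w': "w' \<in> borel_measurable lborel" "AE x in lborel. w1 x = w' x"
    using completion_ex_borel_measurable_real[OF borel_measurable_integrable[OF w1]] by blast
  have ae: "AE x in lebesgue. w1 x = w' x" using w'(2) by (rule AE_completion)
  have intw': "integrable lborel w'"
  proof -
    have "integrable lebesgue w'"
      using w1 ae w'(1) by (subst integrable_cong_AE[of w' _ w1]) (auto intro: measurable_completion)
    then show ?thesis using w'(1) by (simp add: integrable_completion)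
  qed
  have set_eq: "(LINT x:A|lborel. w' x) = integral\<^sup>L lebesgue (\<lambda>x. indicator A x * w1 x)" if "A \<in> sets borel" for A
  proof -
    have "(LINT x:A|lborel. w' x) = integral\<^sup>L lebesgue (\<lambda>x. indicator A x * w' x)"
      using that w'(1) by (simp add: set_lebesgue_integral_def integral_completion)
    also have "\<dots> = integral\<^sup>L lebesgue (\<lambda>x. indicator A x * w1 x)"
    proof (rule integral_cong_AE)
      have "indicat_real A \<in> borel_measurable lebesgue"
        using that by (intro borel_measurable_indicator) auto
      then show "(\<lambda>x. indicator A x * w' x) \<in> borel_measurable lebesgue"
        "(\<lambda>x. indicator A x * w1 x) \<in> borel_measurable lebesgue"
        using measurable_completion[OF w'(1)] borel_measurable_integrable[OF w1] by auto
      show "AE x in lebesgue. indicat_real A x * w' x = indicat_real A x * w1 x"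
        using ae by eventually_elim simp
    qed
    finally show ?thesis .
  qed
  have total: "integral\<^sup>L lborel w' = 0"
  proof -
    have "integral\<^sup>L lborel w' = (LINT x:UNIV|lborel. w' x)" by (simp add: set_lebesgue_integral_def)
    also have "\<dots> = 0"
      by (subst set_eq) (auto simp: w1_def integral_box_eq_0[OF w orth sub])
    finally show ?thesis .
  qed
  have iset: "set_integrable lborel A w'" if "A \<in> sets borel" for A
    using intw' that unfolding set_integrable_def by (intro integrable_mult_indicator) auto
  have "(LINT x:A|lborel. w' x) = 0" if "A \<in> sets borel" for A
  proof -
    let ?G = "range (\<lambda>(a, b). box a b) :: (real ^ 'd) set set"
    have G: "sigma_sets UNIV ?G = sets borel"
      by (subst borel_eq_box) (simp add: sets_measure_of)
    have stable: "Int_stable ?G"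
    proof (rule Int_stableI)
      fix X Y :: "(real ^ 'd) set" assume "X \<in> ?G" "Y \<in> ?G"
      then obtain a b p q where "X = box a b" "Y = box p q" by auto
      moreover obtain r s where "box a b \<inter> box p q = box r s" using box_Int_box_cart by blast
      ultimately show "X \<inter> Y \<in> ?G" by (auto intro: range_eqI[of _ _ "(r, s)"])
    qed
    have subG: "?G \<subseteq> Pow UNIV" by simp
    have "A \<in> sigma_sets UNIV ?G"
      using that by (simp only: G)
    from stable subG this show ?thesis
    proof (induction rule: sigma_sets_induct_disjoint)
      case (basic A)
      then obtain a b where A: "A = box a b" by auto
      obtain p q where pq: "box a b \<inter> box c d = box p q" using box_Int_box_cart by blast
      have "(LINT x:A|lborel. w' x) = integral\<^sup>L lebesgue (\<lambda>x. indicator (box p q) x * w x)"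
        by (subst set_eq) (auto simp: A w1_def pq[symmetric] indicator_inter_arith mult.assoc)
      also have "\<dots> = 0"
      proof (cases "box p q = {}")
        case False
        have "box p q \<subseteq> cbox c d" using pq box_subset_cbox[of c d] by auto
        then have "closure (box p q) \<subseteq> cbox c d" by (intro closure_minimal) auto
        then have "cbox p q \<subseteq> \<Omega>" using closure_box[OF False] sub by auto
        then show ?thesis by (rule integral_box_eq_0[OF w orth])
      qed simp
      finally show ?case .
    next
      case empty
      show ?case by (simp add: set_lebesgue_integral_def)
    next
      case (compl A)
      then have A: "A \<in> sets borel" by (simp only: G)
      have "(LINT x:(UNIV - A) \<union> A|lborel. w' x) = (LINT x:(UNIV - A)|lborel. w' x) + (LINT x:A|lborel. w' x)"
        using A by (intro set_integral_Un iset) auto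
      moreover have "(UNIV - A) \<union> A = UNIV" by auto
      ultimately show ?case using compl total by (simp add: set_lebesgue_integral_def)
    next
      case (union A)
      then have A: "A i \<in> sets borel" for i by (auto simp only: G)
      have "(LINT x:(\<Union>i. A i)|lborel. w' x) = (\<Sum>i. (LINT x:A i|lborel. w' x))"
        using A union by (intro lebesgue_integral_countable_add iset) (auto simp: disjoint_family_on_def)
      then show ?case using union by simp
    qed
  qed
  then have "AE x in lborel. w' x = 0"
    using intw' by (intro sigma_finite_measure.density_zero[OF sigma_finite_lborel]) auto
  then have "AE x in lebesgue. w' x = 0" by (rule AE_completion)
  with ae show ?thesis by eventually_elim (auto simp: w1_def)
qed

lemma AE_zero_if_orthogonal_to_test_functions:
  assumes "open \<Omega>" "w \<in> L1_loc \<Omega>" "\<forall>\<phi>\<in>test_functions \<Omega>. (LINT x:\<Omega>|lebesgue. w x * \<phi> x) = 0"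
  shows "AE x in lebesgue. x \<in> \<Omega> \<longrightarrow> w x = 0"
proof -
  \<comment> \<open>By the Lindelof property countably many boxes suffice, so the exceptional null sets add up to a null set.\<close>
  define \<F> where "\<F> = {X. \<exists>a b. X = box a b \<and> cbox a b \<subseteq> \<Omega>}"
  obtain \<D> where D: "\<D> \<subseteq> \<F>" "countable \<D>" "\<Union>\<D> = \<Union>\<F>"
    using Lindelof[of \<F>] by (auto simp: \<F>_def open_box)
  have "\<Omega> \<subseteq> \<Union>\<F>"
  proof
    fix x assume "x \<in> \<Omega>"
    then obtain a b where "cbox a b \<subseteq> \<Omega>" "x \<in> box a b"
      using open_contains_cbox[OF assms(1)] by metis
    then show "x \<in> \<Union>\<F>" by (auto simp: \<F>_def)
  qed
  have "AE x in lebesgue. x \<in> X \<longrightarrow> w x = 0" if "X \<in> \<D>" for X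
    using D(1) that AE_zero_on_box[OF assms(2,3)] unfolding \<F>_def by blast
  then have "AE x in lebesgue. \<forall>X\<in>\<D>. x \<in> X \<longrightarrow> w x = 0"
    using D(2) by (subst AE_ball_countable) auto
  then show ?thesis by eventually_elim (use D(3) \<open>\<Omega> \<subseteq> \<Union>\<F>\<close> in auto)
qed

section \<open>Square integrable functions and the Riesz representation theorem\<close>

definition square_integrable :: "'a measure \<Rightarrow> ('a \<Rightarrow> real) \<Rightarrow> bool" where
  "square_integrable M f \<longleftrightarrow> f \<in> borel_measurable M \<and> integrable M (\<lambda>x. (f x)\<^sup>2)"

lemma square_integrable_measurable: "square_integrable M f \<Longrightarrow> f \<in> borel_measurable M"
  by (simp add: square_integrable_def)

lemma square_integrable_integrable_power2: "square_integrable M f \<Longrightarrow> integrable M (\<lambda>x. (f x)\<^sup>2)"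
  by (simp add: square_integrable_def)

lemma square_integrable_mult:
  assumes "square_integrable M f" "square_integrable M g"
  shows "integrable M (\<lambda>x. f x * g x)"
proof (rule Bochner_Integration.integrable_bound)
  show "integrable M (\<lambda>x. (f x)\<^sup>2 + (g x)\<^sup>2)"
    using assms by (auto simp: square_integrable_def)
  show "(\<lambda>x. f x * g x) \<in> borel_measurable M"
    using assms by (auto simp: square_integrable_def)
  have "\<bar>a * b\<bar> \<le> \<bar>a\<^sup>2 + b\<^sup>2\<bar>" for a b :: real
  proof -
    have "0 \<le> (\<bar>a\<bar> - \<bar>b\<bar>)\<^sup>2" by simp
    then have "2 * \<bar>a * b\<bar> \<le> a\<^sup>2 + b\<^sup>2" by (simp add: power2_diff abs_mult)
    then show ?thesis using abs_ge_zero[of "a * b"] by linarith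
  qed
  then show "AE x in M. norm (f x * g x) \<le> norm ((f x)\<^sup>2 + (g x)\<^sup>2)" by simp
qed

lemma square_integrable_lincomb:
  assumes "square_integrable M f" "square_integrable M g"
  shows "square_integrable M (\<lambda>x. a * f x + b * g x)"
    and "(\<integral>x. (a * f x + b * g x)\<^sup>2 \<partial>M)
      = a\<^sup>2 * (\<integral>x. (f x)\<^sup>2 \<partial>M) + 2 * a * b * (\<integral>x. f x * g x \<partial>M) + b\<^sup>2 * (\<integral>x. (g x)\<^sup>2 \<partial>M)"
proof -
  have eq: "(\<lambda>x. (a * f x + b * g x)\<^sup>2)
      = (\<lambda>x. a\<^sup>2 * (f x)\<^sup>2 + 2 * a * b * (f x * g x) + b\<^sup>2 * (g x)\<^sup>2)"
    by (simp add: fun_eq_iff power2_sum power_mult_distrib algebra_simps)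
  have int: "integrable M (\<lambda>x. a\<^sup>2 * (f x)\<^sup>2)" "integrable M (\<lambda>x. 2 * a * b * (f x * g x))"
      "integrable M (\<lambda>x. b\<^sup>2 * (g x)\<^sup>2)"
    using assms square_integrable_mult[OF assms] by (auto simp: square_integrable_def)
  then show "square_integrable M (\<lambda>x. a * f x + b * g x)"
    using assms unfolding square_integrable_def eq by auto
  show "(\<integral>x. (a * f x + b * g x)\<^sup>2 \<partial>M)
      = a\<^sup>2 * (\<integral>x. (f x)\<^sup>2 \<partial>M) + 2 * a * b * (\<integral>x. f x * g x \<partial>M) + b\<^sup>2 * (\<integral>x. (g x)\<^sup>2 \<partial>M)"
    unfolding eq using int by simp
qed

lemma square_integrable_diff:
  assumes "square_integrable M f" "square_integrable M g"
  shows "square_integrable M (\<lambda>x. f x - g x)"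
  using square_integrable_lincomb(1)[OF assms, of 1 "-1"] by simp

lemma quadratic_nonneg_imp:
  fixes a b c :: real
  assumes "\<And>t. 0 \<le> a + 2 * t * b + t\<^sup>2 * c" "0 \<le> c"
  shows "b\<^sup>2 \<le> a * c"
proof (cases "c = 0")
  case True
  have "b = 0"
  proof (rule ccontr)
    assume "b \<noteq> 0"
    then have "a + 2 * (- (a + 1) / (2 * b)) * b + (- (a + 1) / (2 * b))\<^sup>2 * c = -1"
      using True by (simp add: field_simps)
    with assms(1)[of "- (a + 1) / (2 * b)"] show False by simp
  qed
  then show ?thesis using True by simp
next
  case False
  with assms(2) have "c > 0" by simp
  have "0 \<le> a + 2 * (- b / c) * b + (- b / c)\<^sup>2 * c" by (rule assms(1))
  also have "\<dots> = a - b\<^sup>2 / c" using False by (simp add: field_simps power2_eq_square)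
  finally show ?thesis using \<open>c > 0\<close> by (simp add: field_simps)
qed

lemma Cauchy_Schwarz_integral:
  assumes "square_integrable M f" "square_integrable M g"
  shows "\<bar>\<integral>x. f x * g x \<partial>M\<bar> \<le> sqrt (\<integral>x. (f x)\<^sup>2 \<partial>M) * sqrt (\<integral>x. (g x)\<^sup>2 \<partial>M)"
proof -
  have "(\<integral>x. f x * g x \<partial>M)\<^sup>2 \<le> (\<integral>x. (f x)\<^sup>2 \<partial>M) * (\<integral>x. (g x)\<^sup>2 \<partial>M)"
  proof (rule quadratic_nonneg_imp)
    fix t :: real
    have "0 \<le> (\<integral>x. (1 * f x + t * g x)\<^sup>2 \<partial>M)" by simp
    then show "0 \<le> (\<integral>x. (f x)\<^sup>2 \<partial>M) + 2 * t * (\<integral>x. f x * g x \<partial>M) + t\<^sup>2 * (\<integral>x. (g x)\<^sup>2 \<partial>M)"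
      unfolding square_integrable_lincomb(2)[OF assms] by simp
  qed simp
  then have "sqrt ((\<integral>x. f x * g x \<partial>M)\<^sup>2) \<le> sqrt ((\<integral>x. (f x)\<^sup>2 \<partial>M) * (\<integral>x. (g x)\<^sup>2 \<partial>M))"
    by (rule real_sqrt_le_mono)
  then show ?thesis by (simp add: real_sqrt_mult)
qed

lemma (in finite_measure) square_integrable_const: "square_integrable M (\<lambda>x. c)"
  by (simp add: square_integrable_def)

lemma (in finite_measure) square_integrable_imp_integrable:
  assumes "square_integrable M f"
  shows "integrable M f"
  using square_integrable_mult[OF assms square_integrable_const[of 1]] by simp

lemma (in finite_measure) integral_abs_le_L2:
  assumes "square_integrable M f"
  shows "(\<integral>x. \<bar>f x\<bar> \<partial>M) \<le> sqrt (\<integral>x. (f x)\<^sup>2 \<partial>M) * sqrt (measure M (space M))"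
proof -
  have "square_integrable M (\<lambda>x. \<bar>f x\<bar>)"
    using assms by (auto simp: square_integrable_def)
  from Cauchy_Schwarz_integral[OF this square_integrable_const[of 1]] show ?thesis by simp
qed

text \<open>Fatou's lemma for a bound that only holds eventually, as it comes from the Cauchy property.\<close>

lemma integral_limit_le:
  fixes f :: "nat \<Rightarrow> 'a \<Rightarrow> real"
  assumes f: "\<And>n. integrable M (f n)" "\<And>n x. 0 \<le> f n x"
    and lim: "AE x in M. (\<lambda>n. f n x) \<longlonglongrightarrow> g x" and g: "g \<in> borel_measurable M" "\<And>x. 0 \<le> g x"
    and bound: "eventually (\<lambda>n. integral\<^sup>L M (f n) \<le> c) sequentially"
  shows "integrable M g" "integral\<^sup>L M g \<le> c"
proof -
  have c: "0 \<le> c"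
  proof -
    obtain n where "integral\<^sup>L M (f n) \<le> c"
      using bound unfolding eventually_sequentially by blast
    moreover have "0 \<le> integral\<^sup>L M (f n)" using f(2) by (intro Bochner_Integration.integral_nonneg)
    ultimately show ?thesis by linarith
  qed
  have "(\<integral>\<^sup>+x. ennreal (g x) \<partial>M) = (\<integral>\<^sup>+x. liminf (\<lambda>n. ennreal (f n x)) \<partial>M)"
  proof (rule nn_integral_cong_AE)
    show "AE x in M. ennreal (g x) = liminf (\<lambda>n. ennreal (f n x))"
      using lim
    proof eventually_elim
      case (elim x)
      then have "(\<lambda>n. ennreal (f n x)) \<longlonglongrightarrow> ennreal (g x)" by (rule tendsto_ennrealI)
      then show ?case by (simp add: lim_imp_Liminf)
    qed
  qed
  also have "\<dots> \<le> liminf (\<lambda>n. \<integral>\<^sup>+x. ennreal (f n x) \<partial>M)"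
    using f(1) by (intro nn_integral_liminf) auto
  also have "\<dots> \<le> ennreal c"
  proof (rule Liminf_le)
    show "\<forall>\<^sub>F n in sequentially. (\<integral>\<^sup>+x. ennreal (f n x) \<partial>M) \<le> ennreal c"
      using bound
    proof eventually_elim
      case (elim n)
      have "(\<integral>\<^sup>+x. ennreal (f n x) \<partial>M) = ennreal (integral\<^sup>L M (f n))"
        using f by (intro nn_integral_eq_integral) auto
      then show ?case using elim by (simp add: ennreal_leI)
    qed
  qed simp
  finally have le: "(\<integral>\<^sup>+x. ennreal (g x) \<partial>M) \<le> ennreal c" .
  show "integrable M g"
    using g le by (intro integrableI_nonneg) (auto simp: less_top[symmetric] top_unique intro: le_less_trans)
  show "integral\<^sup>L M g \<le> c"
    using g le c by (subst integral_eq_nn_integral) (auto simp: enn2real_leI)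
qed

text \<open>Completeness of \<open>L\<^sup>2\<close> for a sequence that is Cauchy at a given rate. On a finite measure
  space such a sequence is Cauchy in \<open>L\<^sup>1\<close>, so a subsequence converges almost everywhere, and
  Fatou's lemma shows that the pointwise limit is also the limit in \<open>L\<^sup>2\<close>.\<close>

lemma (in finite_measure) L2_complete:
  fixes v :: "nat \<Rightarrow> 'a \<Rightarrow> real"
  assumes v: "\<And>n. square_integrable M (v n)"
    and \<epsilon>: "\<epsilon> \<longlonglongrightarrow> 0"
    and cauchy: "\<And>m n. (\<integral>x. (v m x - v n x)\<^sup>2 \<partial>M) \<le> \<epsilon> m + \<epsilon> n"
  shows "\<exists>\<psi>. square_integrable M \<psi> \<and> (\<lambda>n. \<integral>x. (\<psi> x - v n x)\<^sup>2 \<partial>M) \<longlonglongrightarrow> 0"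
proof -
  have d: "square_integrable M (\<lambda>x. v m x - v n x)" for m n
    using v by (intro square_integrable_diff)
  obtain r where r: "strict_mono r" "AE x in M. Cauchy (\<lambda>i. v (r i) x)"
  proof (rule cauchy_L1_AE_cauchy_subseq[of M v])
    show "integrable M (v n)" for n using v by (rule square_integrable_imp_integrable)
    fix e :: real assume e: "0 < e"
    define K where "K = sqrt (measure M (space M)) + 1"
    have K: "K > 0" by (simp add: K_def add_nonneg_pos)
    obtain N where N: "\<And>n. n \<ge> N \<Longrightarrow> \<bar>\<epsilon> n\<bar> < (e / K)\<^sup>2 / 2"
      using LIMSEQ_D[OF \<epsilon>, of "(e / K)\<^sup>2 / 2"] e K by auto
    have "(LINT x|M. norm (v i x - v j x)) < e" if "i \<ge> N" "j \<ge> N" for i j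
    proof -
      have "(\<integral>x. (v i x - v j x)\<^sup>2 \<partial>M) \<le> (e / K)\<^sup>2"
        using cauchy[of i j] N[OF that(1)] N[OF that(2)] by linarith
      then have le: "sqrt (\<integral>x. (v i x - v j x)\<^sup>2 \<partial>M) \<le> e / K"
        using e K by (intro real_le_lsqrt) auto
      have "(LINT x|M. norm (v i x - v j x))
          \<le> sqrt (\<integral>x. (v i x - v j x)\<^sup>2 \<partial>M) * sqrt (measure M (space M))"
        using integral_abs_le_L2[OF d[of i j]] by simp
      also have "\<dots> \<le> e / K * sqrt (measure M (space M))"
        using le by (intro mult_right_mono) auto
      also have "\<dots> < e / K * K" using e K by (intro mult_strict_left_mono) (auto simp: K_def)
      also have "\<dots> = e" using K by simp
      finally show ?thesis .
    qed
    then show "\<exists>N. \<forall>i\<ge>N. \<forall>j\<ge>N. (LINT x|M. norm (v i x - v j x)) < e" by blast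
  qed (use that in blast)
  define \<psi> where "\<psi> x = lim (\<lambda>i. v (r i) x)" for x
  have meas: "\<psi> \<in> borel_measurable M"
    unfolding \<psi>_def using v by (intro borel_measurable_lim_metric) (simp add: square_integrable_def)
  have lim: "AE x in M. (\<lambda>i. v (r i) x) \<longlonglongrightarrow> \<psi> x"
    using r(2) by eventually_elim (simp add: \<psi>_def Cauchy_convergent convergent_LIMSEQ_iff[symmetric])
  have \<epsilon>r: "(\<lambda>i. \<epsilon> (r i)) \<longlonglongrightarrow> 0" using LIMSEQ_subseq_LIMSEQ[OF \<epsilon> r(1)] by (simp add: o_def)
  have fatou: "integrable M (\<lambda>x. (\<psi> x - v n x)\<^sup>2) \<and> (\<integral>x. (\<psi> x - v n x)\<^sup>2 \<partial>M) \<le> \<epsilon> n + \<delta>"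
    if "\<delta> > 0" for n \<delta>
  proof -
    have lim2: "AE x in M. (\<lambda>i. (v (r i) x - v n x)\<^sup>2) \<longlonglongrightarrow> (\<psi> x - v n x)\<^sup>2"
      using lim by eventually_elim (intro tendsto_intros)
    have ev: "eventually (\<lambda>i. (\<integral>x. (v (r i) x - v n x)\<^sup>2 \<partial>M) \<le> \<epsilon> n + \<delta>) sequentially"
      using order_tendstoD(2)[OF \<epsilon>r that]
    proof eventually_elim
      case (elim i)
      then show ?case using cauchy[of "r i" n] by linarith
    qed
    have m: "(\<lambda>x. (\<psi> x - v n x)\<^sup>2) \<in> borel_measurable M"
      using meas square_integrable_measurable[OF v[of n]]
      by (intro borel_measurable_power borel_measurable_diff)
    show ?thesis
      using integral_limit_le[of M "\<lambda>i x. (v (r i) x - v n x)\<^sup>2" "\<lambda>x. (\<psi> x - v n x)\<^sup>2" "\<epsilon> n + \<delta>"] lim2 ev m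
        square_integrable_integrable_power2[OF d] by simp
  qed
  have sq: "square_integrable M (\<lambda>x. \<psi> x - v n x)" for n
    using fatou[of 1 n] borel_measurable_diff[OF meas square_integrable_measurable[OF v[of n]]]
    by (simp add: square_integrable_def)
  have "square_integrable M \<psi>"
    using square_integrable_lincomb(1)[OF sq[of 0] v[of 0], of 1 1] by simp
  moreover have "(\<integral>x. (\<psi> x - v n x)\<^sup>2 \<partial>M) \<le> \<epsilon> n" for n
  proof (rule field_le_epsilon)
    fix e :: real assume "0 < e"
    then show "(\<integral>x. (\<psi> x - v n x)\<^sup>2 \<partial>M) \<le> \<epsilon> n + e" using fatou[of e n] by simp
  qed
  then have "(\<lambda>n. \<integral>x. (\<psi> x - v n x)\<^sup>2 \<partial>M) \<longlonglongrightarrow> 0"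
    by (intro tendsto_sandwich[OF _ _ tendsto_const \<epsilon>] always_eventually) auto
  ultimately show ?thesis by blast
qed

text \<open>The bounded functional is given by its graph \<open>P\<close> over a subspace of \<open>L\<^sup>2\<close>, so that it need
  not be written as a function on equivalence classes. The representing element is the limit of
  a minimising sequence of \<open>\<parallel>v\<parallel>\<^sup>2 - 2 r\<close> over the graph.\<close>

lemma (in finite_measure) Riesz_representation_graph:
  fixes P :: "(('a \<Rightarrow> real) \<times> real) set"
  assumes ne: "P \<noteq> {}"
    and sq: "\<forall>(v, r)\<in>P. square_integrable M v"
    and lin: "\<forall>(v, r)\<in>P. \<forall>(w, s)\<in>P. \<forall>a b. ((\<lambda>x. a * v x + b * w x), a * r + b * s) \<in> P"
    and bound: "\<forall>(v, r)\<in>P. \<bar>r\<bar> \<le> C * sqrt (\<integral>x. (v x)\<^sup>2 \<partial>M)"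
  shows "\<exists>\<psi>. square_integrable M \<psi> \<and> (\<forall>(v, r)\<in>P. r = (\<integral>x. \<psi> x * v x \<partial>M))"
proof -
  define E where "E v = (\<integral>x. (v x)\<^sup>2 \<partial>M)" for v :: "'a \<Rightarrow> real"
  define J where "J p = E (fst p) - 2 * snd p" for p :: "('a \<Rightarrow> real) \<times> real"
  have E0: "0 \<le> E v" for v by (simp add: E_def)
  have below: "- (C\<^sup>2) \<le> J p" if "p \<in> P" for p
  proof -
    have "snd p \<le> C * sqrt (E (fst p))"
      using bound that by (cases p) (auto simp: E_def dest!: bspec)
    moreover have "0 \<le> (sqrt (E (fst p)) - C)\<^sup>2" by simp
    ultimately show ?thesis using E0[of "fst p"] by (simp add: J_def power2_diff algebra_simps)
  qed
  define I where "I = Inf (J ` P)"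
  have I_le: "I \<le> J p" if "p \<in> P" for p
    unfolding I_def using that below by (intro cInf_lower bdd_belowI2) auto
  have "\<exists>p\<in>P. J p < I + 1 / real (Suc n)" for n
    using cInf_lessD[of "J ` P" "I + 1 / real (Suc n)"] ne by (auto simp: I_def)
  then obtain p where p: "\<And>n. p n \<in> P" "\<And>n. J (p n) < I + 1 / real (Suc n)" by metis
  define v where "v n = fst (p n)" for n
  define r where "r n = snd (p n)" for n
  have vr: "(v n, r n) \<in> P" for n using p(1)[of n] by (simp add: v_def r_def)
  have sqv: "square_integrable M (v n)" for n using bspec[OF sq vr[of n]] by simp
  have Jp: "J (p n) = E (v n) - 2 * r n" for n by (simp add: J_def v_def r_def)
  define \<epsilon> where "\<epsilon> n = 2 * (1 / real (Suc n))" for n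
  have \<epsilon>0: "\<epsilon> \<longlonglongrightarrow> 0"
    unfolding \<epsilon>_def by (rule tendsto_mult_right_zero) (rule lim_1_over_n[THEN LIMSEQ_Suc])
  \<comment> \<open>Parallelogram identity: the midpoint of two almost minimisers has value at least \<open>I\<close>.\<close>
  have "(\<integral>x. (v m x - v n x)\<^sup>2 \<partial>M) \<le> \<epsilon> m + \<epsilon> n" for m n
  proof -
    have "((\<lambda>x. 1/2 * v m x + 1/2 * v n x), 1/2 * r m + 1/2 * r n) \<in> P"
      using bspec[OF lin vr[of m]] vr[of n] by fast
    from I_le[OF this] have "I \<le> E (\<lambda>x. 1/2 * v m x + 1/2 * v n x) - (r m + r n)"
      by (simp add: J_def)
    moreover have "E (\<lambda>x. 1/2 * v m x + 1/2 * v n x)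
        = E (v m) / 4 + (\<integral>x. v m x * v n x \<partial>M) / 2 + E (v n) / 4"
      unfolding E_def square_integrable_lincomb(2)[OF sqv sqv] by (simp add: power2_eq_square)
    moreover have "(\<integral>x. (v m x - v n x)\<^sup>2 \<partial>M) = E (v m) - 2 * (\<integral>x. v m x * v n x \<partial>M) + E (v n)"
      using square_integrable_lincomb(2)[OF sqv[of m] sqv[of n], of 1 "-1"] by (simp add: E_def)
    ultimately show ?thesis
      using p(2)[of m] p(2)[of n] unfolding Jp \<epsilon>_def by argo
  qed
  from L2_complete[OF sqv \<epsilon>0 this] obtain \<psi> where \<psi>: "square_integrable M \<psi>"
    "(\<lambda>n. \<integral>x. (\<psi> x - v n x)\<^sup>2 \<partial>M) \<longlonglongrightarrow> 0" by blast
  have "s = (\<integral>x. \<psi> x * w x \<partial>M)" if ws: "(w, s) \<in> P" for w s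
  proof -
    let ?c = "\<integral>x. \<psi> x * w x \<partial>M"
    have sqw: "square_integrable M w" using bspec[OF sq ws] by simp
    have lim: "(\<lambda>n. \<integral>x. v n x * w x \<partial>M) \<longlonglongrightarrow> ?c"
    proof (rule Lim_null[THEN iffD2], rule Lim_null_comparison)
      show "(\<lambda>n. sqrt (\<integral>x. (\<psi> x - v n x)\<^sup>2 \<partial>M) * sqrt (E w)) \<longlonglongrightarrow> 0"
        using tendsto_mult[OF tendsto_real_sqrt[OF \<psi>(2)] tendsto_const[of "sqrt (E w)"]] by simp
      have "norm ((\<integral>x. v n x * w x \<partial>M) - ?c)
          \<le> sqrt (\<integral>x. (\<psi> x - v n x)\<^sup>2 \<partial>M) * sqrt (E w)" for n
      proof -
        have "(\<integral>x. (\<psi> x - v n x) * w x \<partial>M) = ?c - (\<integral>x. v n x * w x \<partial>M)"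
          using square_integrable_mult[OF \<psi>(1) sqw] square_integrable_mult[OF sqv sqw]
          by (simp add: left_diff_distrib)
        then show ?thesis
          using Cauchy_Schwarz_integral[OF square_integrable_diff[OF \<psi>(1) sqv[of n]] sqw]
          by (simp add: E_def abs_minus_commute)
      qed
      then show "\<forall>\<^sub>F n in sequentially. norm ((\<integral>x. v n x * w x \<partial>M) - ?c)
          \<le> sqrt (\<integral>x. (\<psi> x - v n x)\<^sup>2 \<partial>M) * sqrt (E w)" by simp
    qed
    \<comment> \<open>First variation: moving the minimising sequence by \<open>t w\<close> cannot lead below the infimum.\<close>
    have "0 \<le> 0 + 2 * t * (?c - s) + t\<^sup>2 * E w" for t
    proof (rule LIMSEQ_le_const)
      show "(\<lambda>n. 1 / real (Suc n) + 2 * t * ((\<integral>x. v n x * w x \<partial>M) - s) + t\<^sup>2 * E w)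
          \<longlonglongrightarrow> 0 + 2 * t * (?c - s) + t\<^sup>2 * E w"
        by (intro tendsto_intros lim lim_1_over_n[THEN LIMSEQ_Suc])
      have "0 \<le> 1 / real (Suc n) + 2 * t * ((\<integral>x. v n x * w x \<partial>M) - s) + t\<^sup>2 * E w" for n
      proof -
        have "((\<lambda>x. 1 * v n x + t * w x), 1 * r n + t * s) \<in> P"
          using bspec[OF lin vr[of n]] ws by fast
        from I_le[OF this] have "I \<le> E (\<lambda>x. 1 * v n x + t * w x) - 2 * (r n + t * s)"
          by (simp add: J_def)
        moreover have "E (\<lambda>x. 1 * v n x + t * w x)
            = E (v n) + 2 * t * (\<integral>x. v n x * w x \<partial>M) + t\<^sup>2 * E w"
          unfolding E_def square_integrable_lincomb(2)[OF sqv sqw] by simp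
        ultimately show ?thesis using p(2)[of n] unfolding Jp by (simp add: algebra_simps)
      qed
      then show "\<exists>N. \<forall>n\<ge>N. 0 \<le> 1 / real (Suc n) + 2 * t * ((\<integral>x. v n x * w x \<partial>M) - s) + t\<^sup>2 * E w"
        by blast
    qed
    from quadratic_nonneg_imp[OF this E0] show ?thesis by simp
  qed
  with \<psi>(1) show ?thesis by blast
qed

section \<open>Weak derivatives and the dual of the Sobolev space\<close>

lemma LINT_lebesgue_on:
  fixes f :: "'a::euclidean_space \<Rightarrow> real"
  shows "open \<Omega> \<Longrightarrow> (LINT x:\<Omega>|lebesgue. f x) = integral\<^sup>L (lebesgue_on \<Omega>) f"
  by (simp add: set_lebesgue_integral_def integral_restrict_space)

lemma integrable_lebesgue_on_iff:
  fixes f :: "'a::euclidean_space \<Rightarrow> real"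
  shows "open \<Omega> \<Longrightarrow> integrable (lebesgue_on \<Omega>) f \<longleftrightarrow> integrable lebesgue (\<lambda>x. indicator \<Omega> x * f x)"
  by (simp add: integrable_restrict_space)

lemma measurable_lebesgue_on_iff:
  fixes f :: "'a::euclidean_space \<Rightarrow> real"
  shows "open \<Omega> \<Longrightarrow> f \<in> borel_measurable (lebesgue_on \<Omega>) \<longleftrightarrow> (\<lambda>x. indicator \<Omega> x * f x) \<in> borel_measurable lebesgue"
  by (simp add: borel_measurable_restrict_space_iff)

lemma AE_lebesgue_on_iff:
  "open \<Omega> \<Longrightarrow> (AE x in lebesgue_on \<Omega>. P x) \<longleftrightarrow> (AE x in lebesgue. x \<in> \<Omega> \<longrightarrow> P x)"
  by (simp add: AE_restrict_space_iff)

lemma L2_iff_square_integrable: "open \<Omega> \<Longrightarrow> f \<in> L2 \<Omega> \<longleftrightarrow> square_integrable (lebesgue_on \<Omega>) f"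
  by (simp add: L2_def square_integrable_def set_borel_measurable_def set_integrable_def
      borel_measurable_restrict_space_iff integrable_restrict_space)

text \<open>Lebesgue measure is complete. This gives measurability of weak derivatives, which are picked by
  choice.\<close>

lemma measurable_lebesgue_on_cong_AE:
  fixes f g :: "'a::euclidean_space \<Rightarrow> real"
  assumes "open \<Omega>" "f \<in> borel_measurable (lebesgue_on \<Omega>)" "AE x in lebesgue_on \<Omega>. f x = g x"
  shows "g \<in> borel_measurable (lebesgue_on \<Omega>)"
proof -
  have "AE x in lebesgue. indicator \<Omega> x * f x = indicator \<Omega> x * g x"
    using assms(3)[unfolded AE_lebesgue_on_iff[OF assms(1)]]
    by eventually_elim (auto simp: indicator_def)
  then show ?thesis
    using assms(2) unfolding measurable_lebesgue_on_iff[OF assms(1)] by (rule borel_measurable_AE[rotated])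
qed

lemma square_integrable_cong_AE:
  fixes f g :: "'a::euclidean_space \<Rightarrow> real"
  assumes "open \<Omega>" "square_integrable (lebesgue_on \<Omega>) f" "AE x in lebesgue_on \<Omega>. f x = g x"
  shows "square_integrable (lebesgue_on \<Omega>) g"
proof -
  let ?M = "lebesgue_on \<Omega>"
  have g: "g \<in> borel_measurable (?M)"
    using assms by (auto simp: square_integrable_def intro: measurable_lebesgue_on_cong_AE)
  have "integrable (?M) (\<lambda>x. (f x)\<^sup>2)" using assms(2) by (simp add: square_integrable_def)
  moreover have "(\<lambda>x. (g x)\<^sup>2) \<in> borel_measurable (?M)" using g by simp
  moreover have "AE x in ?M. (f x)\<^sup>2 = (g x)\<^sup>2" using assms(3) by eventually_elim simp
  ultimately have "integrable (?M) (\<lambda>x. (g x)\<^sup>2)"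
    by (rule integrable_cong_AE_imp)
  with g show ?thesis by (simp add: square_integrable_def)
qed

lemma continuous_imp_L1_loc:
  fixes f :: "real ^ 'd \<Rightarrow> real"
  assumes "continuous_on UNIV f"
  shows "f \<in> L1_loc \<Omega>"
  unfolding L1_loc_def
proof safe
  fix K :: "(real ^ 'd) set" assume "compact K" 
  then have "integrable lborel (\<lambda>x. indicator K x *\<^sub>R f x)"
    using assms by (intro borel_integrable_compact) (auto intro: continuous_on_subset)
  then show "set_integrable lebesgue K f"
    unfolding set_integrable_def by (rule integrable_completion[THEN iffD2, rotated]) (use \<open>integrable lborel _\<close> in auto)
qed

lemma L1_loc_mult_test_integrable:
  assumes "open \<Omega>" "w \<in> L1_loc \<Omega>" "\<phi> \<in> test_functions \<Omega>"
  shows "integrable (lebesgue_on \<Omega>) (\<lambda>x. w x * \<phi> x)"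
proof -
  obtain K where K: "compact K" "K \<subseteq> \<Omega>" "\<forall>x. x \<notin> K \<longrightarrow> \<phi> x = 0"
    using test_functions_support[OF assms(3)] by blast
  obtain B where B: "0 \<le> B" "\<forall>x. \<bar>\<phi> x\<bar> \<le> B"
    using continuous_compact_support_bounded[OF test_functions_continuous[OF assms(3)] K(1)] K(3) by blast
  have i: "integrable lebesgue (\<lambda>x. indicator K x * w x)"
    using assms(2) K by (auto simp: L1_loc_def set_integrable_def)
  have "integrable lebesgue (\<lambda>x. \<phi> x * (indicator K x * w x))"
  proof (rule Bochner_Integration.integrable_bound[OF integrable_mult_right[OF i, of B]])
    have "\<phi> \<in> borel_measurable lebesgue"
      using test_functions_continuous[OF assms(3)]
      by (intro measurable_completion) (auto intro: borel_measurable_continuous_onI)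
    then show "(\<lambda>x. \<phi> x * (indicator K x * w x)) \<in> borel_measurable lebesgue"
      by (rule borel_measurable_times[OF _ borel_measurable_integrable[OF i]])
    show "AE x in lebesgue. norm (\<phi> x * (indicator K x * w x)) \<le> norm (B * (indicator K x * w x))"
      using B by (intro AE_I2) (simp add: abs_mult mult_right_mono)
  qed
  also have "(\<lambda>x. \<phi> x * (indicator K x * w x)) = (\<lambda>x. indicator \<Omega> x * (w x * \<phi> x))"
    using K by (auto simp: indicator_def fun_eq_iff)
  finally show ?thesis by (simp add: integrable_lebesgue_on_iff[OF assms(1)])
qed

lemma L1_loc_diff: "f \<in> L1_loc \<Omega> \<Longrightarrow> g \<in> L1_loc \<Omega> \<Longrightarrow> (\<lambda>x. f x - g x) \<in> L1_loc \<Omega>"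
  by (auto simp: L1_loc_def set_integrable_def right_diff_distrib)

lemma L1_loc_lincomb:
  "f \<in> L1_loc \<Omega> \<Longrightarrow> g \<in> L1_loc \<Omega> \<Longrightarrow> (\<lambda>x. a * f x + b * g x) \<in> L1_loc \<Omega>"
  by (auto simp: L1_loc_def)

lemma weak_partial_unique:
  assumes "open \<Omega>" "is_weak_partial \<Omega> i u g" "is_weak_partial \<Omega> i u h"
  shows "AE x in lebesgue_on \<Omega>. g x = h x"
proof -
  have L: "g \<in> L1_loc \<Omega>" "h \<in> L1_loc \<Omega>" using assms by (auto simp: is_weak_partial_def)
  have "(LINT x:\<Omega>|lebesgue. (g x - h x) * \<phi> x) = 0" if "\<phi> \<in> test_functions \<Omega>" for \<phi>
  proof -
    have "(LINT x:\<Omega>|lebesgue. g x * \<phi> x) = (LINT x:\<Omega>|lebesgue. h x * \<phi> x)"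
      using assms(2,3) that by (simp add: is_weak_partial_def)
    then show ?thesis
      using L1_loc_mult_test_integrable[OF assms(1) L(1) that] L1_loc_mult_test_integrable[OF assms(1) L(2) that]
      by (simp add: LINT_lebesgue_on[OF assms(1)] left_diff_distrib)
  qed
  then have "AE x in lebesgue. x \<in> \<Omega> \<longrightarrow> g x - h x = 0"
    using AE_zero_if_orthogonal_to_test_functions[OF assms(1) L1_loc_diff[OF L]] by blast
  then show ?thesis by (simp add: AE_lebesgue_on_iff[OF assms(1)])
qed

lemma weak_partial_AE_eq:
  assumes "open \<Omega>" "is_weak_partial \<Omega> i u g"
  shows "AE x in lebesgue_on \<Omega>. weak_partial \<Omega> i u x = g x"
proof -
  have "is_weak_partial \<Omega> i u (weak_partial \<Omega> i u)"
    unfolding weak_partial_def by (rule someI[of "is_weak_partial \<Omega> i u", OF assms(2)])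
  with assms show ?thesis by (blast intro: weak_partial_unique)
qed

lemma is_weak_partial_lincomb:
  assumes \<Omega>: "open \<Omega>" and u: "is_weak_partial \<Omega> i u g" and v: "is_weak_partial \<Omega> i v h"
  shows "is_weak_partial \<Omega> i (\<lambda>x. a * u x + b * v x) (\<lambda>x. a * g x + b * h x)"
  unfolding is_weak_partial_def
proof safe
  have L: "u \<in> L1_loc \<Omega>" "g \<in> L1_loc \<Omega>" "v \<in> L1_loc \<Omega>" "h \<in> L1_loc \<Omega>"
    using u v by (auto simp: is_weak_partial_def)
  then show "(\<lambda>x. a * u x + b * v x) \<in> L1_loc \<Omega>" "(\<lambda>x. a * g x + b * h x) \<in> L1_loc \<Omega>"
    by (auto intro: L1_loc_lincomb)
  fix \<phi> assume \<phi>: "\<phi> \<in> test_functions \<Omega>"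
  note \<phi>' = test_functions_partial[OF \<phi>, of i]
  note int = L1_loc_mult_test_integrable[OF \<Omega> L(1) \<phi>'] L1_loc_mult_test_integrable[OF \<Omega> L(3) \<phi>']
    L1_loc_mult_test_integrable[OF \<Omega> L(2) \<phi>] L1_loc_mult_test_integrable[OF \<Omega> L(4) \<phi>]
  have "(LINT x:\<Omega>|lebesgue. u x * partial_deriv i \<phi> x) = - (LINT x:\<Omega>|lebesgue. g x * \<phi> x)"
    "(LINT x:\<Omega>|lebesgue. v x * partial_deriv i \<phi> x) = - (LINT x:\<Omega>|lebesgue. h x * \<phi> x)"
    using u v \<phi> by (auto simp: is_weak_partial_def)
  then show "(LINT x:\<Omega>|lebesgue. (a * u x + b * v x) * partial_deriv i \<phi> x)
      = - (LINT x:\<Omega>|lebesgue. (a * g x + b * h x) * \<phi> x)"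
    using int by (simp add: LINT_lebesgue_on[OF \<Omega>] distrib_right mult.assoc)
qed

lemma is_weak_partial_C1:
  fixes u :: "real ^ 'd \<Rightarrow> real"
  assumes u: "\<And>x. u differentiable (at x)" "continuous_on UNIV (partial_deriv i u)"
  shows "is_weak_partial \<Omega> i u (partial_deriv i u)"
  unfolding is_weak_partial_def
proof safe
  have cont: "continuous_on UNIV u"
    using u(1) by (auto intro!: continuous_at_imp_continuous_on differentiable_imp_continuous_within)
  then show "u \<in> L1_loc \<Omega>" by (rule continuous_imp_L1_loc)
  show "partial_deriv i u \<in> L1_loc \<Omega>" using u(2) by (rule continuous_imp_L1_loc)
  fix \<phi> assume \<phi>: "\<phi> \<in> test_functions \<Omega>"
  obtain K where K: "compact K" "K \<subseteq> \<Omega>" "\<forall>x. x \<notin> K \<longrightarrow> \<phi> x = 0"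
    using test_functions_support[OF \<phi>] by blast
  note \<phi>' = test_functions_partial[OF \<phi>, of i]
  have K': "\<forall>x. x \<notin> K \<longrightarrow> partial_deriv i \<phi> x = 0"
    using partial_deriv_zero_off_support[of K \<phi>] K by (auto simp: compact_imp_closed)
  have ibp: "integral\<^sup>L lborel (\<lambda>x. \<phi> x * partial_deriv i u x) = - integral\<^sup>L lborel (\<lambda>x. partial_deriv i \<phi> x * u x)"
    by (rule integral_by_parts_compact_support[OF test_functions_differentiable[OF \<phi>]
          test_functions_continuous[OF \<phi>'] u K(1)]) (use K in auto)
  have "(LINT x:\<Omega>|lebesgue. u x * partial_deriv i \<phi> x) = integral\<^sup>L lborel (\<lambda>x. u x * partial_deriv i \<phi> x)"
    using K K' by (intro set_integral_lebesgue_eq_lborel borel_measurable_continuous_onI continuous_on_mult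
        cont test_functions_continuous[OF \<phi>']) auto
  moreover have "(LINT x:\<Omega>|lebesgue. partial_deriv i u x * \<phi> x) = integral\<^sup>L lborel (\<lambda>x. partial_deriv i u x * \<phi> x)"
    using K by (intro set_integral_lebesgue_eq_lborel borel_measurable_continuous_onI continuous_on_mult
        u(2) test_functions_continuous[OF \<phi>]) auto
  ultimately show "(LINT x:\<Omega>|lebesgue. u x * partial_deriv i \<phi> x) = - (LINT x:\<Omega>|lebesgue. partial_deriv i u x * \<phi> x)"
    using ibp by (simp add: mult.commute)
qed

lemma is_weak_partial_test_function:
  assumes "\<phi> \<in> test_functions \<Omega>"
  shows "is_weak_partial \<Omega>' i \<phi> (partial_deriv i \<phi>)"
  by (rule is_weak_partial_C1[OF test_functions_differentiable[OF assms]
        test_functions_continuous[OF test_functions_partial[OF assms]]])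

lemma H1_weak_partial_L2:
  assumes "open \<Omega>" "u \<in> H1 \<Omega>"
  shows "square_integrable (lebesgue_on \<Omega>) (weak_partial \<Omega> i u)"
    and "is_weak_partial \<Omega> i u (weak_partial \<Omega> i u)"
proof -
  obtain g where g: "g \<in> L2 \<Omega>" "is_weak_partial \<Omega> i u g" using assms(2) by (auto simp: H1_def)
  have "AE x in lebesgue_on \<Omega>. g x = weak_partial \<Omega> i u x"
    using weak_partial_AE_eq[OF assms(1) g(2)] by eventually_elim simp
  then show "square_integrable (lebesgue_on \<Omega>) (weak_partial \<Omega> i u)"
    using g(1) assms(1) by (auto simp: L2_iff_square_integrable intro: square_integrable_cong_AE)
  show "is_weak_partial \<Omega> i u (weak_partial \<Omega> i u)"
    unfolding weak_partial_def by (rule someI[of "is_weak_partial \<Omega> i u", OF g(2)])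
qed

lemma test_function_square_integrable:
  assumes "open \<Omega>" "\<phi> \<in> test_functions \<Omega>"
  shows "square_integrable (lebesgue_on \<Omega>) \<phi>"
    and "(\<integral>x. (\<phi> x)\<^sup>2 \<partial>lebesgue_on \<Omega>) = (\<integral>x. (\<phi> x)\<^sup>2 \<partial>lborel)"
proof -
  let ?M = "lebesgue_on \<Omega>"
  have zero: "\<phi> x = 0" if "x \<notin> \<Omega>" for x
    using test_functions_support[OF assms(2)] that by blast
  have \<phi>: "\<phi> \<in> borel_measurable borel"
    by (intro borel_measurable_continuous_onI test_functions_continuous[OF assms(2)])
  then have m: "\<phi> \<in> borel_measurable lebesgue" by (intro measurable_completion) simp
  then have "\<phi> \<in> borel_measurable (?M)" by (rule measurable_restrict_space1)
  moreover have "integrable (?M) (\<lambda>x. (\<phi> x)\<^sup>2)"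
    using L1_loc_mult_test_integrable[OF assms(1) continuous_imp_L1_loc assms(2),
        OF test_functions_continuous[OF assms(2)]] by (simp add: power2_eq_square)
  ultimately show "square_integrable (?M) \<phi>" by (simp add: square_integrable_def)
  show "(\<integral>x. (\<phi> x)\<^sup>2 \<partial>?M) = (\<integral>x. (\<phi> x)\<^sup>2 \<partial>lborel)"
    unfolding LINT_lebesgue_on[OF assms(1), symmetric]
    using zero \<phi> by (intro set_integral_lebesgue_eq_lborel) auto
qed

lemma test_function_H1:
  assumes "open \<Omega>" "\<phi> \<in> test_functions \<Omega>"
  shows "\<phi> \<in> H1 \<Omega>"
proof -
  have "\<phi> \<in> L2 \<Omega>" "partial_deriv i \<phi> \<in> L2 \<Omega>" for i
    using test_function_square_integrable(1)[OF assms]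
      test_function_square_integrable(1)[OF assms(1) test_functions_partial[OF assms(2)]]
    by (simp_all add: L2_iff_square_integrable[OF assms(1)])
  then show ?thesis using is_weak_partial_test_function[OF assms(2)] unfolding H1_def by blast
qed

lemma H1_norm_test_function:
  assumes "open \<Omega>" "\<phi> \<in> test_functions \<Omega>"
  shows "H1_norm \<Omega> \<phi> = sqrt ((\<integral>x. (\<phi> x)\<^sup>2 \<partial>lborel) + (\<Sum>i\<in>UNIV. \<integral>x. (partial_deriv i \<phi> x)\<^sup>2 \<partial>lborel))"
proof -
  let ?M = "lebesgue_on \<Omega>"
  have "(\<integral>x. (weak_partial \<Omega> i \<phi> x)\<^sup>2 \<partial>?M) = (\<integral>x. (partial_deriv i \<phi> x)\<^sup>2 \<partial>lborel)" for i
  proof -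
    have "(\<integral>x. (weak_partial \<Omega> i \<phi> x)\<^sup>2 \<partial>?M) = (\<integral>x. (partial_deriv i \<phi> x)\<^sup>2 \<partial>?M)"
    proof (rule integral_cong_AE)
      show "(\<lambda>x. (weak_partial \<Omega> i \<phi> x)\<^sup>2) \<in> borel_measurable (?M)"
        using H1_weak_partial_L2(1)[OF assms(1) test_function_H1[OF assms], of i]
        by (auto simp: square_integrable_def)
      show "(\<lambda>x. (partial_deriv i \<phi> x)\<^sup>2) \<in> borel_measurable (?M)"
        using test_function_square_integrable(1)[OF assms(1) test_functions_partial[OF assms(2)], of i]
        by (auto simp: square_integrable_def)
      show "AE x in ?M. (weak_partial \<Omega> i \<phi> x)\<^sup>2 = (partial_deriv i \<phi> x)\<^sup>2"
        using weak_partial_AE_eq[OF assms(1) is_weak_partial_test_function[OF assms(2)], of i]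
        by eventually_elim simp
    qed
    then show ?thesis
      using test_function_square_integrable(2)[OF assms(1) test_functions_partial[OF assms(2)]] by simp
  qed
  then show ?thesis
    by (simp add: H1_norm_def LINT_lebesgue_on[OF assms(1)] test_function_square_integrable(2)[OF assms])
qed

lemma test_function_H10:
  assumes "open \<Omega>" "\<phi> \<in> test_functions \<Omega>"
  shows "\<phi> \<in> H10 \<Omega>"
proof -
  have "H1_norm \<Omega> (\<lambda>x. \<phi> x - \<phi> x) = 0"
    using H1_norm_test_function[OF assms(1) test_functions_zero] by simp
  then show ?thesis
    using test_function_H1[OF assms] assms(2) unfolding H10_def by (auto intro!: bexI[of _ \<phi>])
qed

lemma L2_norm_weak_partial_le_H1_norm:
  assumes "open \<Omega>"
  shows "sqrt (\<integral>x. (weak_partial \<Omega> i u x)\<^sup>2 \<partial>lebesgue_on \<Omega>) \<le> H1_norm \<Omega> u"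
proof -
  have "(\<integral>x. (weak_partial \<Omega> i u x)\<^sup>2 \<partial>lebesgue_on \<Omega>)
      \<le> (\<Sum>i\<in>UNIV. \<integral>x. (weak_partial \<Omega> i u x)\<^sup>2 \<partial>lebesgue_on \<Omega>)"
    by (rule member_le_sum) auto
  moreover have "0 \<le> (\<integral>x. (u x)\<^sup>2 \<partial>lebesgue_on \<Omega>)" by simp
  ultimately show ?thesis
    unfolding H1_norm_def LINT_lebesgue_on[OF assms] by (intro real_sqrt_le_mono) linarith
qed

text \<open>Uniqueness of weak derivatives almost everywhere makes the chosen weak derivative linear under the
  integral.\<close>

lemma Hminus1_derivative_of_L2:
  assumes \<Omega>: "open \<Omega>" and \<psi>: "\<psi> \<in> L2 \<Omega>"
  shows "(\<lambda>u. \<integral>x. \<psi> x * weak_partial \<Omega> i u x \<partial>lebesgue_on \<Omega>) \<in> Hminus1 \<Omega>"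
proof -
  let ?M = "lebesgue_on \<Omega>"
  let ?F = "\<lambda>u. \<integral>x. \<psi> x * weak_partial \<Omega> i u x \<partial>?M"
  have sq: "square_integrable (?M) \<psi>" using assms by (simp add: L2_iff_square_integrable)
  have lin: "?F (\<lambda>x. a * u x + b * v x)
      = a * ?F u
        + b * ?F v"
    if u: "u \<in> H10 \<Omega>" and v: "v \<in> H10 \<Omega>" for a b u v
  proof -
    have H: "u \<in> H1 \<Omega>" "v \<in> H1 \<Omega>" using u v by (auto simp: H10_def)
    note wu = H1_weak_partial_L2[OF \<Omega> H(1), of i] and wv = H1_weak_partial_L2[OF \<Omega> H(2), of i]
    have ae: "AE x in ?M. weak_partial \<Omega> i (\<lambda>x. a * u x + b * v x) x
        = a * weak_partial \<Omega> i u x + b * weak_partial \<Omega> i v x"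
      by (rule weak_partial_AE_eq[OF \<Omega> is_weak_partial_lincomb[OF \<Omega> wu(2) wv(2)]])
    have m: "(\<lambda>x. a * weak_partial \<Omega> i u x + b * weak_partial \<Omega> i v x) \<in> borel_measurable (?M)"
      using square_integrable_lincomb(1)[OF wu(1) wv(1)] by (rule square_integrable_measurable)
    have m2: "weak_partial \<Omega> i (\<lambda>x. a * u x + b * v x) \<in> borel_measurable (?M)"
      by (rule measurable_lebesgue_on_cong_AE[OF \<Omega> m]) (use ae in eventually_elim, simp)
    have "?F (\<lambda>x. a * u x + b * v x)
       = (\<integral>x. a * (\<psi> x * weak_partial \<Omega> i u x) + b * (\<psi> x * weak_partial \<Omega> i v x) \<partial>?M)"
    proof (rule integral_cong_AE)
      show "(\<lambda>x. \<psi> x * weak_partial \<Omega> i (\<lambda>x. a * u x + b * v x) x) \<in> borel_measurable (?M)"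
        by (intro borel_measurable_times m2 square_integrable_measurable[OF sq])
      show "(\<lambda>x. a * (\<psi> x * weak_partial \<Omega> i u x) + b * (\<psi> x * weak_partial \<Omega> i v x)) \<in> borel_measurable (?M)"
        using square_integrable_mult[OF sq wu(1)] square_integrable_mult[OF sq wv(1)] by auto
      show "AE x in ?M. \<psi> x * weak_partial \<Omega> i (\<lambda>x. a * u x + b * v x) x
          = a * (\<psi> x * weak_partial \<Omega> i u x) + b * (\<psi> x * weak_partial \<Omega> i v x)"
        using ae by eventually_elim (simp add: algebra_simps)
    qed
    then show ?thesis
      using square_integrable_mult[OF sq wu(1)] square_integrable_mult[OF sq wv(1)] by simp
  qed
  have bound: "\<bar>?F u\<bar>
      \<le> sqrt (\<integral>x. (\<psi> x)\<^sup>2 \<partial>?M) * H1_norm \<Omega> u" if "u \<in> H10 \<Omega>" for u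
  proof -
    have "u \<in> H1 \<Omega>" using that by (simp add: H10_def)
    from Cauchy_Schwarz_integral[OF sq H1_weak_partial_L2(1)[OF \<Omega> this, of i]]
    show ?thesis
      using L2_norm_weak_partial_le_H1_norm[OF \<Omega>, of i u]
      by (rule order_trans[OF _ mult_left_mono]) simp
  qed
  show ?thesis
    unfolding Hminus1_def
  proof (safe)
    fix u v assume "u \<in> H10 \<Omega>" "v \<in> H10 \<Omega>"
    from lin[OF this, of 1 1]
    show "?F (\<lambda>x. u x + v x)
      = ?F u
        + ?F v" by simp
  next
    fix c u assume "u \<in> H10 \<Omega>"
    from lin[OF this this, of c 0]
    show "?F (\<lambda>x. c * u x)
      = c * ?F u" by simp
  next
    show "\<exists>C. \<forall>u\<in>H10 \<Omega>. \<bar>?F u\<bar> \<le> C * H1_norm \<Omega> u"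
      using bound by blast
  qed
qed

lemma Hminus1_add:
  assumes "F \<in> Hminus1 \<Omega>" "G \<in> Hminus1 \<Omega>"
  shows "(\<lambda>u. F u + G u) \<in> Hminus1 \<Omega>"
proof -
  obtain C D where C: "\<forall>u\<in>H10 \<Omega>. \<bar>F u\<bar> \<le> C * H1_norm \<Omega> u" and D: "\<forall>u\<in>H10 \<Omega>. \<bar>G u\<bar> \<le> D * H1_norm \<Omega> u"
    using assms by (auto simp: Hminus1_def)
  have "\<bar>F u + G u\<bar> \<le> (C + D) * H1_norm \<Omega> u" if "u \<in> H10 \<Omega>" for u
    using bspec[OF C that] bspec[OF D that] by (simp add: distrib_right)
  then show ?thesis
    using assms unfolding Hminus1_def by (auto simp: algebra_simps intro!: exI[of _ "C + D"])
qed

section \<open>Existence of the decomposition\<close>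

definition laplacian :: "(real ^ 'd \<Rightarrow> real) \<Rightarrow> real ^ 'd \<Rightarrow> real" where
  "laplacian f x = (\<Sum>i\<in>UNIV. partial_deriv i (partial_deriv i f) x)"

lemma laplacian_test_function: "\<phi> \<in> test_functions \<Omega> \<Longrightarrow> laplacian \<phi> \<in> test_functions \<Omega>"
  unfolding laplacian_def[abs_def] by (intro test_functions_sum test_functions_partial) auto

lemma test_functions_partial_lincomb:
  assumes "\<phi> \<in> test_functions \<Omega>" "\<eta> \<in> test_functions \<Omega>"
  shows "partial_deriv i (\<lambda>x. a * \<phi> x + b * \<eta> x) = (\<lambda>x. a * partial_deriv i \<phi> x + b * partial_deriv i \<eta> x)"
proof
  fix x
  note d = test_functions_differentiable[OF test_functions_cmult[OF assms(1)]]
    test_functions_differentiable[OF test_functions_cmult[OF assms(2)]]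
  show "partial_deriv i (\<lambda>x. a * \<phi> x + b * \<eta> x) x = a * partial_deriv i \<phi> x + b * partial_deriv i \<eta> x"
    by (simp add: partial_deriv_add[OF d] partial_deriv_cmult
        test_functions_differentiable[OF assms(1)] test_functions_differentiable[OF assms(2)])
qed

lemma test_functions_lincomb:
  assumes "\<phi> \<in> test_functions \<Omega>" "\<eta> \<in> test_functions \<Omega>"
  shows "(\<lambda>x. a * \<phi> x + b * \<eta> x) \<in> test_functions \<Omega>"
  by (intro test_functions_add test_functions_cmult assms)

lemma laplacian_lincomb:
  assumes "\<phi> \<in> test_functions \<Omega>" "\<eta> \<in> test_functions \<Omega>"
  shows "laplacian (\<lambda>x. a * \<phi> x + b * \<eta> x) = (\<lambda>x. a * laplacian \<phi> x + b * laplacian \<eta> x)"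
  by (simp add: fun_eq_iff laplacian_def test_functions_partial_lincomb[OF assms]
      test_functions_partial_lincomb[OF test_functions_partial[OF assms(1)] test_functions_partial[OF assms(2)]]
      sum.distrib sum_distrib_left)

text \<open>Integrating \<open>\<partial>\<^sub>j x\<^sub>j = 1\<close> against \<open>\<phi>\<^sup>2\<close> by parts gives the Poincare inequality.\<close>

lemma poincare_inequality:
  assumes "\<phi> \<in> test_functions \<Omega>" "\<And>x. x \<in> \<Omega> \<Longrightarrow> norm x \<le> R"
  shows "(\<integral>x. (\<phi> x)\<^sup>2 \<partial>lborel) \<le> 4 * R\<^sup>2 * (\<integral>x. (partial_deriv j \<phi> x)\<^sup>2 \<partial>lborel)"
proof -
  let ?p = "partial_deriv j \<phi>"
  note \<phi> = assms(1) and \<phi>' = test_functions_partial[OF assms(1), of j]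
  obtain K where K: "compact K" "K \<subseteq> \<Omega>" "\<forall>x. x \<notin> K \<longrightarrow> \<phi> x = 0"
    using test_functions_support[OF \<phi>] by blast
  have c: "continuous_on UNIV \<phi>" "continuous_on UNIV (?p)" "continuous_on UNIV (\<lambda>x. x $ j :: real)"
    using test_functions_continuous[OF \<phi>] test_functions_continuous[OF \<phi>'] by (auto intro: continuous_intros)
  have pd: "partial_deriv j (\<lambda>x. \<phi> x * \<phi> x) = (\<lambda>x. \<phi> x * ?p x + ?p x * \<phi> x)"
    by (intro ext partial_deriv_mult test_functions_differentiable[OF \<phi>])
  have "integral\<^sup>L lborel (\<lambda>x. (\<phi> x * \<phi> x) * partial_deriv j (\<lambda>x. x $ j) x)
      = - integral\<^sup>L lborel (\<lambda>x. partial_deriv j (\<lambda>x. \<phi> x * \<phi> x) x * x $ j)"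
  proof (rule integral_by_parts_compact_support[OF _ _ _ _ K(1)])
    show "(\<lambda>x. \<phi> x * \<phi> x) differentiable (at x)" for x
      by (intro differentiable_mult test_functions_differentiable[OF \<phi>])
    show "continuous_on UNIV (partial_deriv j (\<lambda>x. \<phi> x * \<phi> x))"
      unfolding pd by (intro continuous_intros c)
    show "(\<lambda>x. x $ j :: real) differentiable (at x)" for x
      by (intro bounded_linear_imp_differentiable bounded_linear_vec_nth)
    show "continuous_on UNIV (partial_deriv j (\<lambda>x. x $ j))"
      by (simp add: partial_deriv_nth[abs_def])
  qed (use K in auto)
  then have eq: "(\<integral>x. (\<phi> x)\<^sup>2 \<partial>lborel) = (\<integral>x. - (2 * \<phi> x * ?p x * x $ j) \<partial>lborel)"
    by (simp add: partial_deriv_nth pd power2_eq_square algebra_simps)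
  have i1: "integrable lborel (\<lambda>x. - (2 * \<phi> x * ?p x * x $ j))"
  proof -
    have "continuous_on UNIV (\<lambda>x. - 2 * ?p x * x $ j)"
      by (intro continuous_on_mult continuous_on_const c)
    from test_functions_integrable_mult[OF \<phi> this] show ?thesis
      by (rule back_subst[of "integrable lborel"]) (simp add: fun_eq_iff)
  qed
  have i2: "integrable lborel (\<lambda>x. (\<phi> x)\<^sup>2)" "integrable lborel (\<lambda>x. (?p x)\<^sup>2)"
    using test_functions_integrable_mult[OF \<phi> c(1)] test_functions_integrable_mult[OF \<phi>' c(2)]
    by (auto simp: power2_eq_square)
  have "(\<integral>x. - (2 * \<phi> x * ?p x * x $ j) \<partial>lborel)
      \<le> (\<integral>x. (\<phi> x)\<^sup>2 / 2 + 2 * R\<^sup>2 * (?p x)\<^sup>2 \<partial>lborel)"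
  proof (rule integral_mono[OF i1])
    show "integrable lborel (\<lambda>x. (\<phi> x)\<^sup>2 / 2 + 2 * R\<^sup>2 * (?p x)\<^sup>2)" using i2 by auto
    fix x
    show "- (2 * \<phi> x * ?p x * x $ j) \<le> (\<phi> x)\<^sup>2 / 2 + 2 * R\<^sup>2 * (?p x)\<^sup>2"
    proof (cases "x \<in> \<Omega>")
      case True
      have "\<bar>x $ j\<bar> \<le> R" using component_le_norm_cart[of x j] assms(2)[OF True] by linarith
      then have "(x $ j)\<^sup>2 \<le> R\<^sup>2" by (metis abs_ge_zero power2_abs power_mono)
      then have "(?p x)\<^sup>2 * (x $ j)\<^sup>2 \<le> (?p x)\<^sup>2 * R\<^sup>2"
        by (intro mult_left_mono) auto
      moreover have "0 \<le> (\<phi> x + 2 * (?p x * x $ j))\<^sup>2" by simp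
      ultimately show ?thesis by (simp add: power2_sum power_mult_distrib algebra_simps)
    next
      case False
      with K have "\<phi> x = 0" by blast
      then show ?thesis by simp
    qed
  qed
  also have "\<dots> = (\<integral>x. (\<phi> x)\<^sup>2 \<partial>lborel) / 2 + 2 * R\<^sup>2 * (\<integral>x. (?p x)\<^sup>2 \<partial>lborel)"
    using i2 by simp
  finally show ?thesis unfolding eq[symmetric] by simp
qed

lemma test_functions_partial_commute:
  assumes "\<phi> \<in> test_functions \<Omega>"
  shows "partial_deriv i (partial_deriv j \<phi>) = partial_deriv j (partial_deriv i \<phi>)"
  by (intro ext partial_deriv_commute smooth_on_Ck test_functions_smooth[OF assms])

text \<open>Two integrations by parts move the derivatives in the Hessian so that only pure second
  derivatives remain.\<close>

lemma hessian_L2_norm: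
  assumes "\<phi> \<in> test_functions \<Omega>"
  shows "(\<Sum>i\<in>UNIV. \<Sum>j\<in>UNIV. \<integral>x. (partial_deriv j (partial_deriv i \<phi>) x)\<^sup>2 \<partial>lborel)
    = (\<integral>x. (laplacian \<phi> x)\<^sup>2 \<partial>lborel)"
proof -
  have T: "\<phi> \<in> test_functions UNIV" using assms by (rule test_functions_mono) simp
  note D1 = test_functions_partial[OF T]
  note D2 = test_functions_partial[OF D1]
  have eq: "(\<integral>x. (partial_deriv j (partial_deriv i \<phi>) x)\<^sup>2 \<partial>lborel)
      = (\<integral>x. partial_deriv i (partial_deriv i \<phi>) x * partial_deriv j (partial_deriv j \<phi>) x \<partial>lborel)" for i j
  proof -
    have "(\<integral>x. (partial_deriv j (partial_deriv i \<phi>) x)\<^sup>2 \<partial>lborel)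
        = - (\<integral>x. partial_deriv j (partial_deriv j (partial_deriv i \<phi>)) x * partial_deriv i \<phi> x \<partial>lborel)"
      using test_functions_by_parts[OF D2 D1, of j i j i] by (simp add: power2_eq_square)
    also have "partial_deriv j (partial_deriv j (partial_deriv i \<phi>)) = partial_deriv i (partial_deriv j (partial_deriv j \<phi>))"
      by (simp add: test_functions_partial_commute[OF T, of j i] test_functions_partial_commute[OF D1, of j i j])
    also have "- (\<integral>x. partial_deriv i (partial_deriv j (partial_deriv j \<phi>)) x * partial_deriv i \<phi> x \<partial>lborel)
        = (\<integral>x. partial_deriv j (partial_deriv j \<phi>) x * partial_deriv i (partial_deriv i \<phi>) x \<partial>lborel)"
      using test_functions_by_parts[OF D2 D1, of j j i i] by simp
    finally show ?thesis by (simp add: mult.commute)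
  qed
  have int: "integrable lborel (\<lambda>x. partial_deriv i (partial_deriv i \<phi>) x * partial_deriv j (partial_deriv j \<phi>) x)" for i j
    by (rule test_functions_integrable_mult[OF D2 test_functions_continuous[OF D2]])
  have "(laplacian \<phi> x)\<^sup>2 = (\<Sum>i\<in>UNIV. \<Sum>j\<in>UNIV.
      partial_deriv i (partial_deriv i \<phi>) x * partial_deriv j (partial_deriv j \<phi>) x)" for x
    by (simp add: laplacian_def power2_eq_square sum_product)
  then have "(\<integral>x. (laplacian \<phi> x)\<^sup>2 \<partial>lborel) = (\<Sum>i\<in>UNIV. \<Sum>j\<in>UNIV.
      \<integral>x. partial_deriv i (partial_deriv i \<phi>) x * partial_deriv j (partial_deriv j \<phi>) x \<partial>lborel)"
    using int by simp
  then show ?thesis by (simp add: eq)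
qed

text \<open>The Hessian identity controls the second derivatives, and the Poincare inequality for
  \<open>\<partial>\<^sub>i\<phi>\<close> controls the first ones by the second ones.\<close>

lemma H1_norm_partial_le_laplacian:
  assumes \<Omega>: "open \<Omega>" and \<phi>: "\<phi> \<in> test_functions \<Omega>" and R: "\<And>x. x \<in> \<Omega> \<Longrightarrow> norm x \<le> R"
  shows "H1_norm \<Omega> (partial_deriv i \<phi>) \<le> sqrt (4 * R\<^sup>2 + 1) * sqrt (\<integral>x. (laplacian \<phi> x)\<^sup>2 \<partial>lborel)"
proof -
  let ?H = "\<lambda>i j. \<integral>x. (partial_deriv j (partial_deriv i \<phi>) x)\<^sup>2 \<partial>lborel"
  let ?L = "\<integral>x. (laplacian \<phi> x)\<^sup>2 \<partial>lborel"
  have row: "(\<Sum>j\<in>UNIV. ?H i j) \<le> ?L"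
    unfolding hessian_L2_norm[OF \<phi>, symmetric]
    by (rule member_le_sum[of i UNIV "\<lambda>i. \<Sum>j\<in>UNIV. ?H i j"]) (auto intro: sum_nonneg)
  moreover have "?H i i \<le> (\<Sum>j\<in>UNIV. ?H i j)"
    by (rule member_le_sum) auto
  ultimately have "4 * R\<^sup>2 * ?H i i \<le> 4 * R\<^sup>2 * ?L" by (intro mult_left_mono) auto
  moreover have "(\<integral>x. (partial_deriv i \<phi> x)\<^sup>2 \<partial>lborel) \<le> 4 * R\<^sup>2 * ?H i i"
    by (rule poincare_inequality[OF test_functions_partial[OF \<phi>] R])
  ultimately have "(\<integral>x. (partial_deriv i \<phi> x)\<^sup>2 \<partial>lborel) + (\<Sum>j\<in>UNIV. ?H i j) \<le> (4 * R\<^sup>2 + 1) * ?L"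
    using row by (simp add: distrib_right)
  then show ?thesis
    unfolding H1_norm_test_function[OF \<Omega> test_functions_partial[OF \<phi>]] real_sqrt_mult[symmetric]
    by (rule real_sqrt_le_mono)
qed

lemma Hminus1_test_lincomb:
  assumes "open \<Omega>" "F \<in> Hminus1 \<Omega>" "\<phi> \<in> test_functions \<Omega>" "\<eta> \<in> test_functions \<Omega>"
  shows "F (\<lambda>x. a * \<phi> x + b * \<eta> x) = a * F \<phi> + b * F \<eta>"
proof -
  have add: "\<forall>u\<in>H10 \<Omega>. \<forall>v\<in>H10 \<Omega>. F (\<lambda>x. u x + v x) = F u + F v"
    and scale: "\<forall>c. \<forall>u\<in>H10 \<Omega>. F (\<lambda>x. c * u x) = c * F u"
    using assms(2) by (auto simp: Hminus1_def)
  note H10 = test_function_H10[OF assms(1)]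
  show ?thesis
    using bspec[OF bspec[OF add H10[OF test_functions_cmult[OF assms(3), of a]]]
        H10[OF test_functions_cmult[OF assms(4), of b]]]
      scale H10[OF assms(3)] H10[OF assms(4)] by simp
qed

text \<open>The very weak formulation of \<open>\<Delta>\<psi> = - div U\<close>; the sign of \<open>\<psi>\<close> is changed in the decomposition. By the
  estimate above, \<open>\<Delta>\<phi> \<mapsto> \<langle>U, \<nabla>\<phi>\<rangle>\<close> is a bounded functional on a subspace of \<open>L\<^sup>2\<close>.\<close>

lemma ex_very_weak_solution:
  fixes \<Omega> :: "(real ^ 'd) set"
  assumes \<Omega>: "open \<Omega>" "bounded \<Omega>" and U: "U \<in> Hminus1_vec \<Omega>"
  shows "\<exists>\<psi>. square_integrable (lebesgue_on \<Omega>) \<psi> \<and>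
    (\<forall>\<phi>\<in>test_functions \<Omega>. (\<Sum>i\<in>UNIV. U i (partial_deriv i \<phi>)) = (\<integral>x. \<psi> x * laplacian \<phi> x \<partial>lebesgue_on \<Omega>))"
proof -
  let ?M = "lebesgue_on \<Omega>"
  have Ui: "U i \<in> Hminus1 \<Omega>" for i using U by (simp add: Hminus1_vec_def)
  obtain R where R: "\<forall>x\<in>\<Omega>. norm x \<le> R" using \<Omega>(2) by (auto simp: bounded_iff)
  have "\<forall>i. \<exists>C. \<forall>u\<in>H10 \<Omega>. \<bar>U i u\<bar> \<le> C * H1_norm \<Omega> u" using Ui by (auto simp: Hminus1_def)
  then obtain C where C: "\<forall>i. \<forall>u\<in>H10 \<Omega>. \<bar>U i u\<bar> \<le> C i * H1_norm \<Omega> u" by metis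
  define P where "P = (\<lambda>\<phi>. (laplacian \<phi>, \<Sum>i\<in>UNIV. U i (partial_deriv i \<phi>))) ` test_functions \<Omega>"
  define B where "B = (\<Sum>i\<in>UNIV. \<bar>C i\<bar> * sqrt (4 * R\<^sup>2 + 1))"
  interpret finite_measure "?M"
    using \<Omega> by (intro finite_measure_lebesgue_on bounded_set_imp_lmeasurable) auto
  have bound: "\<bar>\<Sum>i\<in>UNIV. U i (partial_deriv i \<phi>)\<bar> \<le> B * sqrt (\<integral>x. (laplacian \<phi> x)\<^sup>2 \<partial>?M)"
    if \<phi>: "\<phi> \<in> test_functions \<Omega>" for \<phi>
  proof -
    let ?L = "\<integral>x. (laplacian \<phi> x)\<^sup>2 \<partial>lborel"
    have "\<bar>U i (partial_deriv i \<phi>)\<bar> \<le> \<bar>C i\<bar> * sqrt (4 * R\<^sup>2 + 1) * sqrt ?L" for i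
    proof -
      have "\<bar>U i (partial_deriv i \<phi>)\<bar> \<le> C i * H1_norm \<Omega> (partial_deriv i \<phi>)"
        using C test_function_H10[OF \<Omega>(1) test_functions_partial[OF \<phi>]] by blast
      also have "\<dots> \<le> \<bar>C i\<bar> * H1_norm \<Omega> (partial_deriv i \<phi>)"
        by (intro mult_right_mono)
          (auto simp: H1_norm_test_function[OF \<Omega>(1) test_functions_partial[OF \<phi>]] intro!: add_nonneg_nonneg sum_nonneg)
      also have "\<dots> \<le> \<bar>C i\<bar> * (sqrt (4 * R\<^sup>2 + 1) * sqrt ?L)"
        using H1_norm_partial_le_laplacian[OF \<Omega>(1) \<phi>, of R i] R by (intro mult_left_mono) auto
      finally show ?thesis by (simp add: mult.assoc)
    qed
    then have "(\<Sum>i\<in>UNIV. \<bar>U i (partial_deriv i \<phi>)\<bar>) \<le> (\<Sum>i\<in>UNIV. \<bar>C i\<bar> * sqrt (4 * R\<^sup>2 + 1) * sqrt ?L)"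
      by (intro sum_mono)
    also have "\<dots> = B * sqrt ?L" by (simp add: B_def sum_distrib_right)
    finally have "\<bar>\<Sum>i\<in>UNIV. U i (partial_deriv i \<phi>)\<bar> \<le> B * sqrt ?L"
      using sum_abs[of "\<lambda>i. U i (partial_deriv i \<phi>)" UNIV] by linarith
    then show ?thesis
      using test_function_square_integrable(2)[OF \<Omega>(1) laplacian_test_function[OF \<phi>]] by simp
  qed
  have "\<exists>\<psi>. square_integrable (?M) \<psi> \<and> (\<forall>(v, r)\<in>P. r = (\<integral>x. \<psi> x * v x \<partial>?M))"
  proof (rule Riesz_representation_graph)
    show "P \<noteq> {}" using test_functions_zero[of \<Omega>] by (auto simp: P_def)
    show "\<forall>(v, r)\<in>P. square_integrable (?M) v"
      using test_function_square_integrable(1)[OF \<Omega>(1) laplacian_test_function] by (auto simp: P_def)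
    show "\<forall>(v, r)\<in>P. \<bar>r\<bar> \<le> B * sqrt (\<integral>x. (v x)\<^sup>2 \<partial>?M)"
      using bound by (auto simp: P_def)
    have "((\<lambda>x. a * laplacian \<phi> x + b * laplacian \<eta> x),
        a * (\<Sum>i\<in>UNIV. U i (partial_deriv i \<phi>)) + b * (\<Sum>i\<in>UNIV. U i (partial_deriv i \<eta>))) \<in> P"
      if "\<phi> \<in> test_functions \<Omega>" "\<eta> \<in> test_functions \<Omega>" for a b \<phi> \<eta>
    proof -
      have "(\<Sum>i\<in>UNIV. U i (partial_deriv i (\<lambda>x. a * \<phi> x + b * \<eta> x)))
          = a * (\<Sum>i\<in>UNIV. U i (partial_deriv i \<phi>)) + b * (\<Sum>i\<in>UNIV. U i (partial_deriv i \<eta>))"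
        by (simp add: test_functions_partial_lincomb[OF that] Hminus1_test_lincomb[OF \<Omega>(1) Ui
              test_functions_partial[OF that(1)] test_functions_partial[OF that(2)]] sum.distrib sum_distrib_left)
      then show ?thesis
        unfolding P_def using test_functions_lincomb[OF that, of a b] laplacian_lincomb[OF that, of a b]
        by (intro image_eqI[of _ _ "\<lambda>x. a * \<phi> x + b * \<eta> x"]) auto
    qed
    then show "\<forall>(v, r)\<in>P. \<forall>(w, s)\<in>P. \<forall>a b. ((\<lambda>x. a * v x + b * w x), a * r + b * s) \<in> P"
      by (auto simp: P_def[THEN eq_reflection] ball_simps)
  qed
  then show ?thesis by (auto simp: P_def)
qed

text \<open>Once \<open>\<psi>\<close> is found, \<open>\<Psi> = U - \<nabla>\<psi>\<close> is extended from test functions to the Sobolev space by means of weak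
  derivatives; its divergence vanishes by the equation for \<open>\<psi>\<close>.\<close>

lemma ex_decomposition:
  fixes \<Omega> :: "(real ^ 'd) set"
  assumes \<Omega>: "open \<Omega>" "bounded \<Omega>" and U: "U \<in> Hminus1_vec \<Omega>"
  shows "\<exists>\<psi>\<in>L2 \<Omega>. \<exists>\<Psi>\<in>Hminus1_vec \<Omega>.
    (\<forall>\<phi>\<in>test_functions \<Omega>. \<forall>i. U i \<phi> = dist_grad \<Omega> \<psi> i \<phi> + \<Psi> i \<phi>) \<and>
    (\<forall>\<phi>\<in>test_functions \<Omega>. dist_div \<Psi> \<phi> = 0)"
proof -
  let ?M = "lebesgue_on \<Omega>"
  obtain \<psi>0 where \<psi>0: "square_integrable (?M) \<psi>0"
    "\<forall>\<phi>\<in>test_functions \<Omega>. (\<Sum>i\<in>UNIV. U i (partial_deriv i \<phi>)) = (\<integral>x. \<psi>0 x * laplacian \<phi> x \<partial>?M)"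
    using ex_very_weak_solution[OF assms] by blast
  define \<psi> where "\<psi> x = - \<psi>0 x" for x
  define \<Psi> where "\<Psi> i u = U i u + (\<integral>x. \<psi> x * weak_partial \<Omega> i u x \<partial>?M)" for i u
  have sq: "square_integrable (?M) \<psi>"
    using square_integrable_lincomb(1)[OF \<psi>0(1) \<psi>0(1), of "-1" 0] by (simp add: \<psi>_def[abs_def])
  then have \<psi>: "\<psi> \<in> L2 \<Omega>" by (simp add: L2_iff_square_integrable[OF \<Omega>(1)])
  have \<Psi>: "\<Psi> \<in> Hminus1_vec \<Omega>"
    using U Hminus1_add[OF _ Hminus1_derivative_of_L2[OF \<Omega>(1) \<psi>]]
    by (simp add: Hminus1_vec_def \<Psi>_def[abs_def])
  have \<Psi>_test: "\<Psi> i \<phi> = U i \<phi> + (\<integral>x. \<psi> x * partial_deriv i \<phi> x \<partial>?M)"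
    if \<phi>: "\<phi> \<in> test_functions \<Omega>" for i \<phi>
  proof -
    have "(\<integral>x. \<psi> x * weak_partial \<Omega> i \<phi> x \<partial>?M) = (\<integral>x. \<psi> x * partial_deriv i \<phi> x \<partial>?M)"
    proof (rule integral_cong_AE)
      show "(\<lambda>x. \<psi> x * weak_partial \<Omega> i \<phi> x) \<in> borel_measurable (?M)"
        using H1_weak_partial_L2(1)[OF \<Omega>(1) test_function_H1[OF \<Omega>(1) \<phi>], of i]
        by (intro borel_measurable_integrable square_integrable_mult[OF sq])
      show "(\<lambda>x. \<psi> x * partial_deriv i \<phi> x) \<in> borel_measurable (?M)"
        using test_function_square_integrable(1)[OF \<Omega>(1) test_functions_partial[OF \<phi>], of i]
        by (intro borel_measurable_integrable square_integrable_mult[OF sq])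
      show "AE x in ?M. \<psi> x * weak_partial \<Omega> i \<phi> x = \<psi> x * partial_deriv i \<phi> x"
        using weak_partial_AE_eq[OF \<Omega>(1) is_weak_partial_test_function[OF \<phi>], of i] by eventually_elim simp
    qed
    then show ?thesis by (simp add: \<Psi>_def)
  qed
  have "U i \<phi> = dist_grad \<Omega> \<psi> i \<phi> + \<Psi> i \<phi>" if "\<phi> \<in> test_functions \<Omega>" for \<phi> i
    using \<Psi>_test[OF that] by (simp add: dist_grad_def LINT_lebesgue_on[OF \<Omega>(1)])
  moreover have "dist_div \<Psi> \<phi> = 0" if \<phi>: "\<phi> \<in> test_functions \<Omega>" for \<phi>
  proof -
    note D1 = test_functions_partial[OF \<phi>]
    have int: "integrable (?M) (\<lambda>x. \<psi> x * partial_deriv i (partial_deriv i \<phi>) x)" for i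
      by (rule square_integrable_mult[OF sq test_function_square_integrable(1)[OF \<Omega>(1) test_functions_partial[OF D1]]])
    have "(\<Sum>i\<in>UNIV. \<integral>x. \<psi> x * partial_deriv i (partial_deriv i \<phi>) x \<partial>?M)
        = (\<integral>x. \<psi> x * laplacian \<phi> x \<partial>?M)"
      using int by (simp add: laplacian_def sum_distrib_left)
    also have "\<dots> = - (\<Sum>i\<in>UNIV. U i (partial_deriv i \<phi>))"
      using \<psi>0(2) \<phi> by (simp add: \<psi>_def)
    finally show ?thesis
      by (simp add: dist_div_def \<Psi>_test[OF D1] sum.distrib)
  qed
  ultimately show ?thesis using \<psi> \<Psi> by blast
qed

section \<open>A kernel for regularising at all dyadic scales\<close>

lemma has_derivative_norm_square_partial:
  "partial_deriv i (\<lambda>x::real^'d. x \<bullet> x) x = 2 * x $ i"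
proof -
  have "((\<lambda>x::real^'d. x \<bullet> x) has_derivative (\<lambda>h. 2 * (x \<bullet> h))) (at x)"
    by (auto intro!: derivative_eq_intros simp: inner_commute)
  from partial_deriv_eqI[OF this] show ?thesis by (simp add: inner_axis)
qed

lemma laplacian_radial:
  fixes P p p' :: "real \<Rightarrow> real"
  assumes P: "\<And>t. (P has_real_derivative p t) (at t)" and p: "\<And>t. (p has_real_derivative p' t) (at t)"
  shows "laplacian (\<lambda>x::real^'d. P (x \<bullet> x)) x = 4 * (x \<bullet> x) * p' (x \<bullet> x) + 2 * real CARD('d) * p (x \<bullet> x)"
proof -
  have dsq: "(\<lambda>x::real^'d. x \<bullet> x) differentiable (at x)" for x
    by (auto intro!: derivative_eq_intros simp: differentiable_def)
  have dnth: "(\<lambda>x::real^'d. 2 * x $ i) differentiable (at x)" for i x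
    by (intro differentiable_mult differentiable_const bounded_linear_imp_differentiable bounded_linear_vec_nth)
  have 1: "partial_deriv i (\<lambda>x::real^'d. P (x \<bullet> x)) = (\<lambda>x. p (x \<bullet> x) * (2 * x $ i))" for i
    by (intro ext) (simp add: partial_deriv_compose_real(2)[OF P dsq] has_derivative_norm_square_partial)
  have 2: "partial_deriv i (\<lambda>x::real^'d. p (x \<bullet> x) * (2 * x $ i)) x
      = 4 * (x $ i * x $ i) * p' (x \<bullet> x) + 2 * p (x \<bullet> x)" for i
  proof -
    have "partial_deriv i (\<lambda>x::real^'d. 2 * x $ i) x = 2"
      by (subst partial_deriv_cmult) (auto simp: partial_deriv_nth intro!: bounded_linear_imp_differentiable bounded_linear_vec_nth)
    then show ?thesis
      by (simp add: partial_deriv_mult[OF partial_deriv_compose_real(1)[OF p dsq] dnth]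
          partial_deriv_compose_real(2)[OF p dsq] has_derivative_norm_square_partial)
  qed
  have "laplacian (\<lambda>x::real^'d. P (x \<bullet> x)) x
      = (\<Sum>i\<in>UNIV. 4 * (x $ i * x $ i) * p' (x \<bullet> x) + 2 * p (x \<bullet> x))"
    by (simp only: laplacian_def 1 2)
  also have "\<dots> = 4 * (\<Sum>i\<in>UNIV. x $ i * x $ i) * p' (x \<bullet> x) + 2 * real CARD('d) * p (x \<bullet> x)"
    by (simp add: sum.distrib flip: sum_distrib_left sum_distrib_right)
  also have "(\<Sum>i\<in>UNIV. x $ i * x $ i) = x \<bullet> x" by (simp add: inner_vec_def)
  finally show ?thesis .
qed

text \<open>Let \<open>E\<close> be a multiple of the fundamental solution, smoothed inside the unit ball. Then \<open>\<kappa> = \<Delta>E\<close> is supported in the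
  unit ball, and \<open>E(x) - 2\<^sup>d\<^sup>-\<^sup>2 E(2x)\<close> vanishes outside it because \<open>E\<close> is homogeneous there (in
  the plane, up to a constant, which is subtracted). In terms of \<open>t = |x|\<^sup>2\<close> the derivative of \<open>E\<close> is
  \<open>t\<^sup>-\<^sup>d\<^sup>/\<^sup>2 M(t)\<close>, where the smooth function \<open>M\<close> is constant on either side of \<open>[1/4, 1]\<close>.\<close>

lemma ex_dyadic_kernel:
  "\<exists>(\<phi> :: real^'d \<Rightarrow> real) \<kappa>. smooth_on UNIV \<phi> \<and> (\<forall>x. 1 \<le> norm x \<longrightarrow> \<phi> x = 0) \<and>
     continuous_on UNIV \<kappa> \<and> (\<forall>x. 1 \<le> norm x \<longrightarrow> \<kappa> x = 0) \<and> (\<forall>x. 0 \<le> \<kappa> x) \<and> 0 < integral\<^sup>L lborel \<kappa> \<and>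
     (\<forall>x. laplacian \<phi> x = \<kappa> x - 2 ^ CARD('d) * \<kappa> (2 *\<^sub>R x))"
proof -
  let ?d = "real CARD('d)"
  define m where "m t = flat 0 (1 * t + (- 1/4)) * flat 0 ((-1) * t + 1)" for t
  have m_smooth: "Ck_real k m" for k
    unfolding m_def[abs_def] by (intro Ck_real_mult Ck_real_affine Ck_real_flat)
  have m_nonneg: "0 \<le> m t" for t by (simp add: m_def flat_def)
  have m_zero: "m t = 0" if "t \<le> 1/4 \<or> 1 \<le> t" for t using that by (auto simp: m_def flat_def)
  have m_pos: "0 < m t" if "1/4 < t" "t < 1" for t using that by (simp add: m_def flat_def)
  obtain F where F: "\<forall>t. (F has_real_derivative m t) (at t)"
    using ex_antiderivative[of m] m_smooth[of 0] by auto
  define M where "M t = F t - F (1/4)" for t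
  have M: "(M has_real_derivative m t) (at t)" for t
    unfolding M_def[abs_def] using F by (auto intro!: derivative_eq_intros)
  have M_smooth: "Ck_real k M" for k using M m_smooth by (rule Ck_real_antiderivative)
  have M_low: "M t = 0" if "t \<le> 1/4" for t
  proof -
    have "M t = M (1/4)"
      by (rule constant_on_interval_DERIV_zero[OF convex_real_interval(2)[of "1/4"] M]) (use m_zero that in simp_all)
    then show ?thesis by (simp add: M_def)
  qed
  have M_high: "M t = M 1" if "1 \<le> t" for t
    by (rule constant_on_interval_DERIV_zero[OF convex_real_interval(1)[of 1] M]) (simp_all add: m_zero that)
  define N where "N t = M t + (-1) * M (4 * t + 0)" for t
  have N_smooth: "Ck_real k N" for k
    unfolding N_def[abs_def] by (rule Ck_real_add[OF M_smooth Ck_real_mult[OF Ck_real_const Ck_real_affine[OF M_smooth]]])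
  have N_low: "N t = 0" if "t \<le> 1/16" for t using that by (simp add: N_def M_low)
  have N_high: "N t = 0" if "1 \<le> t" for t using that M_high[of t] M_high[of "4 * t"] by (simp add: N_def)
  have N: "(N has_real_derivative (m t - 4 * m (4 * t))) (at t)" for t
  proof -
    have "((\<lambda>t. M (4 * t + 0)) has_real_derivative m (4 * t + 0) * 4) (at t)"
      by (rule DERIV_chain2[OF M]) (auto intro!: derivative_eq_intros)
    then show ?thesis unfolding N_def[abs_def] using M by (auto intro!: derivative_eq_intros)
  qed
  define p where "p t = t powr (- ?d / 2) * N t" for t
  have p_smooth: "Ck_real k p" for k
    unfolding p_def[abs_def] using N_smooth N_low by (intro Ck_real_powr_mult[of "1/16"]) auto
  obtain p' where p': "\<forall>t. (p has_real_derivative p' t) (at t)" using p_smooth[of 1] by auto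
  obtain P0 where P0: "\<forall>t. (P0 has_real_derivative p t) (at t)"
    using ex_antiderivative[of p] p_smooth[of 0] by auto
  define P where "P t = P0 t - P0 1" for t
  have P: "(P has_real_derivative p t) (at t)" for t
    unfolding P_def[abs_def] using P0 by (auto intro!: derivative_eq_intros)
  have P_smooth: "Ck_real k P" for k using P p_smooth by (rule Ck_real_antiderivative)
  have P_high: "P t = 0" if "1 \<le> t" for t
  proof -
    have "P t = P 1"
      by (rule constant_on_interval_DERIV_zero[OF convex_real_interval(1)[of 1] P]) (simp_all add: p_def N_high that)
    then show ?thesis by (simp add: P_def)
  qed
  have ode: "4 * t * p' t + 2 * ?d * p t = 4 * t * t powr (- ?d / 2) * (m t - 4 * m (4 * t))" if "0 \<le> t" for t
  proof (cases "t = 0")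
    case True
    then show ?thesis using N_low[of 0] by (simp add: p_def)
  next
    case False
    with that have t: "0 < t" by simp
    have "(p has_real_derivative (- ?d / 2) * t powr (- ?d / 2 - 1) * N t + t powr (- ?d / 2) * (m t - 4 * m (4 * t))) (at t)"
      unfolding p_def[abs_def] using t by (auto intro!: derivative_eq_intros N)
    then have "p' t = (- ?d / 2) * t powr (- ?d / 2 - 1) * N t + t powr (- ?d / 2) * (m t - 4 * m (4 * t))"
      using p' DERIV_unique by blast
    then have "t * p' t = (- ?d / 2) * (t * t powr (- ?d / 2 - 1)) * N t
        + t * t powr (- ?d / 2) * (m t - 4 * m (4 * t))"
      by (simp only: distrib_left mult_ac)
    also have "t * t powr (- ?d / 2 - 1) = t powr (- ?d / 2)"
      using t by (simp add: powr_diff)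
    finally have "t * p' t = (- ?d / 2) * t powr (- ?d / 2) * N t + t * t powr (- ?d / 2) * (m t - 4 * m (4 * t))" .
    then show ?thesis by (simp add: p_def algebra_simps)
  qed
  define k where "k t = 4 * (t * (t powr (- ?d / 2) * m t))" for t
  have k_cont: "Ck_real 0 k"
  proof -
    have "Ck_real 0 (\<lambda>t. t powr (- ?d / 2) * m t)"
      by (rule Ck_real_powr_mult[of "1/4"]) (auto intro: m_smooth simp: m_zero simp del: Ck_real.simps)
    then show ?thesis unfolding k_def[abs_def] by (auto intro!: continuous_intros)
  qed
  define \<phi> where "\<phi> x = P (x \<bullet> x)" for x :: "real^'d"
  define \<kappa> where "\<kappa> x = k (x \<bullet> x)" for x :: "real^'d"
  have norm1: "1 \<le> x \<bullet> x" if "1 \<le> norm x" for x :: "real^'d"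
    using that by (simp add: dot_square_norm)
  have "smooth_on UNIV \<phi>"
    unfolding smooth_on_def \<phi>_def[abs_def]
    by (rule allI) (rule Ck_on_compose_real[OF P_smooth Ck_on_norm_square])
  moreover have "\<forall>x. 1 \<le> norm x \<longrightarrow> \<phi> x = 0" using P_high norm1 by (simp add: \<phi>_def)
  moreover have \<kappa>_cont: "continuous_on UNIV \<kappa>"
    using Ck_on_compose_real[OF k_cont Ck_on_norm_square] by (simp add: \<kappa>_def[abs_def])
  moreover have \<kappa>_zero: "\<forall>x. 1 \<le> norm x \<longrightarrow> \<kappa> x = 0" using m_zero norm1 by (simp add: \<kappa>_def k_def)
  moreover have \<kappa>_nonneg: "\<forall>x. 0 \<le> \<kappa> x" using m_nonneg by (simp add: \<kappa>_def k_def)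
  moreover have "0 < integral\<^sup>L lborel \<kappa>"
  proof (rule ccontr)
    assume neg: "\<not> 0 < integral\<^sup>L lborel \<kappa>"
    have int: "integrable lborel \<kappa>"
      by (rule integrable_continuous_compact_support[OF \<kappa>_cont compact_cball[of 0 1]]) (use \<kappa>_zero in auto)
    have "0 \<le> integral\<^sup>L lborel \<kappa>" using \<kappa>_nonneg by simp
    with neg have "integral\<^sup>L lborel \<kappa> = 0" by linarith
    then have ae: "AE x in lborel. \<kappa> x = 0"
      using integral_nonneg_eq_0_iff_AE[OF int] \<kappa>_nonneg by simp
    let ?S = "{x::real^'d. 1/4 < x \<bullet> x \<and> x \<bullet> x < 1}"
    have "?S \<in> null_sets lborel"
    proof -
      have "open ?S" by (intro open_Collect_conj open_Collect_less continuous_intros)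
      moreover have "AE x in lborel. x \<notin> ?S"
        using ae
      proof eventually_elim
        case (elim x)
        show ?case
        proof
          assume x: "x \<in> ?S"
          then have "1/4 < x \<bullet> x" by simp
          then have "0 < x \<bullet> x" by linarith
          then have "0 < \<kappa> x"
            unfolding \<kappa>_def k_def using x m_pos[of "x \<bullet> x"] by (intro mult_pos_pos) auto
          with elim show False by simp
        qed
      qed
      ultimately show ?thesis by (intro AE_iff_null_sets[THEN iffD2]) auto
    qed
    then have "negligible ?S" by (simp add: negligible_iff_null_sets null_sets_completionI)
    moreover have "open ?S" by (intro open_Collect_conj open_Collect_less continuous_intros)
    moreover obtain i :: 'd where True by simp
    have "(3/4) *\<^sub>R axis i 1 \<in> ?S" by (simp add: inner_axis_axis)
    ultimately show False using open_not_negligible by blast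
  qed
  moreover have "laplacian \<phi> x = \<kappa> x - 2 ^ CARD('d) * \<kappa> (2 *\<^sub>R x)" for x
  proof -
    let ?t = "x \<bullet> x"
    have pw: "(4 * ?t) powr (- ?d / 2) = ?t powr (- ?d / 2) / 2 ^ CARD('d)"
    proof -
      have "(4::real) powr (- ?d / 2) = (2 powr 2) powr (- ?d / 2)" by simp
      also have "\<dots> = 2 powr (- ?d)" by (simp only: powr_powr) simp
      also have "\<dots> = 1 / 2 ^ CARD('d)" by (simp add: powr_minus powr_realpow divide_inverse)
      finally show ?thesis by (simp add: powr_mult)
    qed
    have "laplacian \<phi> x = 4 * ?t * p' ?t + 2 * ?d * p ?t"
      unfolding \<phi>_def[abs_def] by (rule laplacian_radial) (use P p' in auto)
    also have "\<dots> = 4 * ?t * ?t powr (- ?d / 2) * (m ?t - 4 * m (4 * ?t))" by (rule ode) simp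
    also have "\<dots> = k ?t - 2 ^ CARD('d) * k (4 * ?t)"
      unfolding k_def pw by (simp add: right_diff_distrib mult_ac)
    also have "\<dots> = \<kappa> x - 2 ^ CARD('d) * \<kappa> (2 *\<^sub>R x)" by (simp add: \<kappa>_def)
    finally show ?thesis .
  qed
  ultimately show ?thesis by (intro exI[of _ \<phi>] exI[of _ \<kappa>]) blast
qed

lemma integral_lborel_affine:
  fixes f :: "real ^ 'd \<Rightarrow> real"
  assumes "f \<in> borel_measurable borel" "s \<noteq> 0"
  shows "integral\<^sup>L lborel f = \<bar>s\<bar> ^ CARD('d) * integral\<^sup>L lborel (\<lambda>y. f (v + s *\<^sub>R y))"
proof -
  have "integral\<^sup>L lborel f = integral\<^sup>L (density (distr lborel borel (\<lambda>x. v + s *\<^sub>R x)) (\<lambda>_. \<bar>s\<bar> ^ DIM(real^'d))) f"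
    using lborel_affine[OF assms(2), of v] by simp
  also have "\<dots> = integral\<^sup>L (distr lborel borel (\<lambda>x. v + s *\<^sub>R x)) (\<lambda>x. \<bar>s\<bar> ^ CARD('d) *\<^sub>R f x)"
    using assms(1) by (subst integral_density) auto
  also have "\<dots> = integral\<^sup>L lborel (\<lambda>y. \<bar>s\<bar> ^ CARD('d) *\<^sub>R f (v + s *\<^sub>R y))"
    using assms(1) by (subst integral_distr) auto
  finally show ?thesis by simp
qed

section \<open>Interior continuity\<close>

lemma telescoping_geometric_bound:
  fixes a :: "nat \<Rightarrow> real"
  assumes "\<And>n. N \<le> n \<Longrightarrow> \<bar>a n - a (Suc n)\<bar> \<le> A * (1/2) ^ n"
  shows "convergent a" "\<And>n. N \<le> n \<Longrightarrow> \<bar>a n - lim a\<bar> \<le> 2 * A * (1/2) ^ n"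
proof -
  have step: "\<bar>a n - a (n + k)\<bar> \<le> 2 * A * (1/2) ^ n" if "N \<le> n" for n k
  proof -
    have "\<bar>a n - a (n + k)\<bar> \<le> 2 * A * (1/2) ^ n * (1 - (1/2) ^ k)"
    proof (induction k)
      case (Suc k)
      have "\<bar>a (n + k) - a (Suc (n + k))\<bar> \<le> A * (1/2) ^ (n + k)" using that by (intro assms) simp
      with Suc have "\<bar>a n - a (n + Suc k)\<bar> \<le> 2 * A * (1/2) ^ n * (1 - (1/2) ^ k) + A * (1/2) ^ (n + k)" by simp
      also have "\<dots> = 2 * A * (1/2) ^ n * (1 - (1/2) ^ Suc k)" by (simp add: power_add field_simps)
      finally show ?case .
    qed simp
    also have "\<dots> \<le> 2 * A * (1/2) ^ n * 1"
    proof (intro mult_left_mono)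
      have "0 \<le> A * (1/2) ^ n" using assms[OF that] abs_ge_zero order_trans by blast
      then show "0 \<le> 2 * A * (1/2) ^ n" by simp
    qed simp
    finally show ?thesis by simp
  qed
  have lim0: "(\<lambda>n. 2 * A * (1/2) ^ n) \<longlonglongrightarrow> 0"
    by (intro tendsto_mult_right_zero LIMSEQ_power_zero) simp
  have "Cauchy a"
  proof (rule CauchyI')
    fix e :: real assume "0 < e"
    then obtain n0 where n0: "\<forall>n\<ge>n0. \<bar>2 * A * (1/2) ^ n\<bar> < e" using LIMSEQ_D[OF lim0] by auto
    show "\<exists>M. \<forall>m\<ge>M. \<forall>n>m. dist (a m) (a n) < e"
    proof (intro exI[of _ "max N n0"] allI impI)
      fix m n assume "max N n0 \<le> m" "m < n"
      then show "dist (a m) (a n) < e"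
        using step[of m "n - m"] n0[rule_format, of m] by (simp add: dist_real_def)
    qed
  qed
  then show conv: "convergent a" by (simp add: Cauchy_convergent)
  fix n assume n: "N \<le> n"
  have "(\<lambda>k. \<bar>a n - a (k + n)\<bar>) \<longlonglongrightarrow> \<bar>a n - lim a\<bar>"
    using conv by (intro tendsto_intros LIMSEQ_ignore_initial_segment) (simp add: convergent_LIMSEQ_iff)
  then show "\<bar>a n - lim a\<bar> \<le> 2 * A * (1/2) ^ n"
    by (rule LIMSEQ_le_const2) (use step[OF n] in \<open>auto simp: add.commute\<close>)
qed

text \<open>A weak solution of \<open>\<Delta>q = - div G\<close> with bounded \<open>G\<close> has a continuous representative. Testing with a scaled and
  translated \<open>\<phi>\<close> bounds the difference of two successive regularisations \<open>q * \<kappa>\<^sub>n\<close> by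
  \<open>sup |G| \<cdot> \<parallel>\<nabla>\<phi>\<^sub>n\<parallel>\<^sub>1\<close>, which is of order \<open>2\<^sup>-\<^sup>n\<close>. Hence they converge locally uniformly, and their limit is
  a multiple of \<open>q\<close> as a distribution.\<close>

lemma weak_solution_AE_eq_continuous:
  fixes \<Omega> :: "(real ^ 'd) set" and G :: "'d \<Rightarrow> real ^ 'd \<Rightarrow> real"
  assumes \<Omega>: "open \<Omega>" and q: "integrable (lebesgue_on \<Omega>) q"
    and G: "\<forall>i. G i \<in> borel_measurable (lebesgue_on \<Omega>)" "\<forall>i. \<forall>x\<in>\<Omega>. \<bar>G i x\<bar> \<le> B"
    and eq: "\<forall>\<phi>\<in>test_functions \<Omega>. (\<integral>x. q x * laplacian \<phi> x \<partial>lebesgue_on \<Omega>)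
      = (\<Sum>i\<in>UNIV. \<integral>x. G i x * partial_deriv i \<phi> x \<partial>lebesgue_on \<Omega>)"
  shows "\<exists>Q. continuous_on \<Omega> Q \<and> (AE x in lebesgue. x \<in> \<Omega> \<longrightarrow> q x = Q x)"
proof -
  let ?M = "lebesgue_on \<Omega>"
  let ?d = "CARD('d)"
  obtain \<phi> \<kappa> :: "real^'d \<Rightarrow> real" where \<phi>: "smooth_on UNIV \<phi>" "\<forall>x. 1 \<le> norm x \<longrightarrow> \<phi> x = 0"
    and \<kappa>: "continuous_on UNIV \<kappa>" "\<forall>x. 1 \<le> norm x \<longrightarrow> \<kappa> x = 0" "\<forall>x. 0 \<le> \<kappa> x" "0 < integral\<^sup>L lborel \<kappa>"
    and lap: "\<forall>x. laplacian \<phi> x = \<kappa> x - 2 ^ ?d * \<kappa> (2 *\<^sub>R x)"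
    using ex_dyadic_kernel by blast
  have \<phi>_test: "\<phi> \<in> test_functions UNIV"
    by (rule test_functionsI[OF \<phi>(1) compact_cball[of 0 1]]) (use \<phi>(2) in auto)
  define c where "c = integral\<^sup>L lborel \<kappa>"
  have \<kappa>_meas[measurable]: "\<kappa> \<in> borel_measurable borel" using \<kappa>(1) by (rule borel_measurable_continuous_onI)
  have \<kappa>_int: "integrable lborel \<kappa>"
    by (rule integrable_continuous_compact_support[OF \<kappa>(1) compact_cball[of 0 1]]) (use \<kappa>(2) in auto)
  have "\<exists>b\<ge>0. \<forall>x. \<bar>\<kappa> x\<bar> \<le> b"
    by (rule continuous_compact_support_bounded[OF \<kappa>(1) compact_cball[of 0 1]]) (use \<kappa>(2) in auto)
  then obtain b where b: "0 \<le> b" "\<forall>x. \<bar>\<kappa> x\<bar> \<le> b" by blast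

  \<comment> \<open>A Borel representative of \<open>q\<close>, extended by zero, for use with Fubini's theorem on Borel measures.\<close>
  obtain q0 where q0: "q0 \<in> borel_measurable lborel" "AE x in lborel. indicator \<Omega> x * q x = q0 x"
    using completion_ex_borel_measurable_real[of "\<lambda>x. indicator \<Omega> x * q x" lborel] q
    unfolding integrable_lebesgue_on_iff[OF \<Omega>] by auto
  note q0_meas[measurable] = q0(1)
  have q0_ae: "AE x in lebesgue. indicator \<Omega> x * q x = q0 x" using q0(2) by (rule AE_completion)
  have q0_int: "integrable lborel q0"
  proof -
    have "integrable lebesgue q0"
      using q[unfolded integrable_lebesgue_on_iff[OF \<Omega>]] measurable_completion[OF q0(1)] q0_ae
      by (rule integrable_cong_AE_imp)
    then show ?thesis using q0(1) by (simp add: integrable_completion)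
  qed
  have q0_eq: "(\<integral>x. q x * f x \<partial>?M) = (\<integral>x. q0 x * f x \<partial>lborel)"
    if f: "f \<in> borel_measurable borel" for f
  proof -
    have qm: "(\<lambda>x. indicator \<Omega> x * q x) \<in> borel_measurable lebesgue"
      using q[unfolded integrable_lebesgue_on_iff[OF \<Omega>]] by (rule borel_measurable_integrable)
    have fm: "f \<in> borel_measurable lebesgue" using f by (intro measurable_completion) simp
    have "(\<integral>x. q x * f x \<partial>?M) = (\<integral>x. (indicator \<Omega> x * q x) * f x \<partial>lebesgue)"
      using \<Omega> by (simp add: integral_restrict_space mult.assoc)
    also have "\<dots> = (\<integral>x. q0 x * f x \<partial>lebesgue)"
    proof (rule integral_cong_AE)
      show "(\<lambda>x. (indicator \<Omega> x * q x) * f x) \<in> borel_measurable lebesgue"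
        by (rule borel_measurable_times[OF qm fm])
      show "(\<lambda>x. q0 x * f x) \<in> borel_measurable lebesgue"
        by (rule borel_measurable_times[OF measurable_completion[OF q0(1)] fm])
      show "AE x in lebesgue. indicator \<Omega> x * q x * f x = q0 x * f x" using q0_ae by eventually_elim simp
    qed
    also have "\<dots> = (\<integral>x. q0 x * f x \<partial>lborel)"
      using q0(1) f by (intro integral_completion borel_measurable_times) auto
    finally show ?thesis .
  qed

  define \<kappa>n where "\<kappa>n n x = (2 ^ n) ^ ?d * \<kappa> (2 ^ n *\<^sub>R x)" for n and x :: "real^'d"
  define qn where "qn n x = (\<integral>y. q0 y * \<kappa>n n (x - y) \<partial>lborel)" for n x
  have \<kappa>n_meas[measurable]: "\<kappa>n n \<in> borel_measurable borel" for n
    unfolding \<kappa>n_def[abs_def] by measurable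
  have \<kappa>n_cont: "continuous_on UNIV (\<kappa>n n)" for n
    unfolding \<kappa>n_def[abs_def]
    by (intro continuous_intros continuous_on_compose2[OF \<kappa>(1)]) auto
  have \<kappa>n_bound: "\<bar>\<kappa>n n x\<bar> \<le> (2 ^ n) ^ ?d * b" for n x
    using b by (simp add: \<kappa>n_def abs_mult)
  have qn_int: "integrable lborel (\<lambda>y. q0 y * \<kappa>n n (x - y))" for n x
  proof (rule Bochner_Integration.integrable_bound[OF integrable_mult_left[OF q0_int, of "(2 ^ n) ^ ?d * b"]])
    show "AE y in lborel. norm (q0 y * \<kappa>n n (x - y)) \<le> norm (q0 y * ((2 ^ n) ^ ?d * b))"
      using \<kappa>n_bound b by (intro AE_I2) (auto simp: abs_mult intro!: mult_left_mono)
  qed measurable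

  let ?N = "\<lambda>i. \<integral>x. \<bar>partial_deriv i \<phi> x\<bar> \<partial>lborel"
  define A where "A = (\<Sum>i\<in>UNIV. B * ?N i)"
  \<comment> \<open>The test function is \<open>\<phi>\<close>, reflected, centred at \<open>x\<close> and shrunk to radius \<open>2\<^sup>-\<^sup>n\<close>; the factor \<open>cn\<close> is chosen
    so that its Laplacian is the difference of the two rescaled kernels.\<close>
  have diff: "\<bar>qn n x - qn (Suc n) x\<bar> \<le> A * (1/2) ^ n" if sub: "cball x ((1/2) ^ n) \<subseteq> \<Omega>" for n x
  proof -
    define s where "s = - ((2::real) ^ n)"
    define v where "v = (2::real) ^ n *\<^sub>R x"
    define cn where "cn = ((2::real) ^ n) ^ ?d / (2 ^ n)\<^sup>2"
    have s: "s \<noteq> 0" "\<bar>s\<bar> = 2 ^ n" by (auto simp: s_def)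
    define \<eta> where "\<eta> y = cn * \<phi> (v + s *\<^sub>R y)" for y
    have vs: "v + s *\<^sub>R y = 2 ^ n *\<^sub>R (x - y)" for y by (simp add: v_def s_def algebra_simps)
    have \<eta>_smooth: "smooth_on UNIV \<eta>"
      unfolding smooth_on_def \<eta>_def[abs_def]
      by (rule allI) (rule Ck_on_mult[OF Ck_on_const Ck_on_affine_comp[OF smooth_on_Ck[OF \<phi>(1)]]])
    have \<eta>_test: "\<eta> \<in> test_functions \<Omega>"
    proof (rule test_functionsI[OF \<eta>_smooth compact_cball sub])
      fix y assume "y \<notin> cball x ((1/2) ^ n)"
      then have "1 \<le> 2 ^ n * norm (x - y)" by (simp add: dist_norm field_simps power_one_over)
      then have "1 \<le> norm (v + s *\<^sub>R y)" unfolding vs by simp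
      then show "\<eta> y = 0" using \<phi>(2) by (simp add: \<eta>_def)
    qed
    have pd: "partial_deriv i (\<lambda>y. a * f (v + s *\<^sub>R y)) = (\<lambda>y. (a * s) * partial_deriv i f (v + s *\<^sub>R y))"
      if "smooth_on UNIV f" for i a f
    proof
      fix y
      have d: "f differentiable (at z)" for z using that by (rule smooth_on_differentiable)
      then have "(\<lambda>y. f (v + s *\<^sub>R y)) differentiable (at y)"
        using has_derivative_affine_comp[of f v s y] by (auto simp: differentiable_def)
      then show "partial_deriv i (\<lambda>y. a * f (v + s *\<^sub>R y)) y = (a * s) * partial_deriv i f (v + s *\<^sub>R y)"
        by (simp add: partial_deriv_cmult partial_deriv_affine_comp d)
    qed
    have pd\<eta>: "partial_deriv i \<eta> = (\<lambda>y. (cn * s) * partial_deriv i \<phi> (v + s *\<^sub>R y))" for i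
      unfolding \<eta>_def[abs_def] by (rule pd[OF \<phi>(1)])
    have lap\<eta>: "laplacian \<eta> y = \<kappa>n n (x - y) - \<kappa>n (Suc n) (x - y)" for y
    proof -
      have "laplacian \<eta> y = cn * s\<^sup>2 * laplacian \<phi> (v + s *\<^sub>R y)"
        unfolding laplacian_def pd\<eta> pd[OF smooth_on_partial_deriv[OF \<phi>(1)]]
        by (simp add: sum_distrib_left power2_eq_square mult.assoc)
      also have "cn * s\<^sup>2 = (2 ^ n) ^ ?d" by (simp add: cn_def s_def)
      also have "(2 ^ n) ^ ?d * laplacian \<phi> (v + s *\<^sub>R y) = \<kappa>n n (x - y) - \<kappa>n (Suc n) (x - y)"
        unfolding lap[rule_format] vs \<kappa>n_def by (simp add: power_mult_distrib algebra_simps)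
      finally show ?thesis .
    qed
    have "qn n x - qn (Suc n) x = (\<integral>y. q0 y * laplacian \<eta> y \<partial>lborel)"
      unfolding qn_def lap\<eta> using qn_int by (simp add: right_diff_distrib)
    also have "\<dots> = (\<integral>y. q y * laplacian \<eta> y \<partial>?M)"
      using test_functions_continuous[OF laplacian_test_function[OF \<eta>_test]]
      by (intro q0_eq[symmetric] borel_measurable_continuous_onI)
    also have "\<dots> = (\<Sum>i\<in>UNIV. \<integral>y. G i y * partial_deriv i \<eta> y \<partial>?M)"
      using eq \<eta>_test by blast
    finally have e1: "qn n x - qn (Suc n) x = (\<Sum>i\<in>UNIV. \<integral>y. G i y * partial_deriv i \<eta> y \<partial>?M)" .
    have e2: "\<bar>\<integral>y. G i y * partial_deriv i \<eta> y \<partial>?M\<bar>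
        \<le> B * ?N i * (1/2) ^ n" for i
    proof -
      note pt = test_functions_partial[OF \<eta>_test, of i]
      have pc: "continuous_on UNIV (partial_deriv i \<eta>)" by (rule test_functions_continuous[OF pt])
      have pi: "integrable (?M) (partial_deriv i \<eta>)"
        using L1_loc_mult_test_integrable[OF \<Omega> continuous_imp_L1_loc[OF continuous_on_const[of UNIV 1]] pt] by simp
      have zero: "\<bar>partial_deriv i \<eta> y\<bar> = 0" if "y \<notin> \<Omega>" for y
        using test_functions_support[OF pt] that by auto
      have Bpi: "integrable (?M) (\<lambda>y. B * \<bar>partial_deriv i \<eta> y\<bar>)"
        using pi by (intro integrable_mult_right integrable_abs)
      have "norm (\<integral>y. G i y * partial_deriv i \<eta> y \<partial>?M)
          \<le> (\<integral>y. norm (G i y * partial_deriv i \<eta> y) \<partial>?M)"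
        by (rule integral_norm_bound)
      also have "\<dots> \<le> (\<integral>y. B * \<bar>partial_deriv i \<eta> y\<bar> \<partial>?M)"
      proof (rule integral_mono')
        show "integrable (?M) (\<lambda>y. B * \<bar>partial_deriv i \<eta> y\<bar>)" by (rule Bpi)
        fix y assume "y \<in> space (?M)"
        then have "\<bar>G i y\<bar> \<le> B" using G(2) by simp
        then show "norm (G i y * partial_deriv i \<eta> y) \<le> B * \<bar>partial_deriv i \<eta> y\<bar>"
          "0 \<le> B * \<bar>partial_deriv i \<eta> y\<bar>"
          using abs_ge_zero[of "G i y"] by (auto simp: abs_mult intro!: mult_right_mono mult_nonneg_nonneg)
      qed
      also have "\<dots> = B * (\<integral>y. \<bar>partial_deriv i \<eta> y\<bar> \<partial>?M)" by simp
      also have "(\<integral>y. \<bar>partial_deriv i \<eta> y\<bar> \<partial>?M) = (\<integral>y. \<bar>partial_deriv i \<eta> y\<bar> \<partial>lborel)"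
        unfolding LINT_lebesgue_on[OF \<Omega>, symmetric]
        using zero pc by (intro set_integral_lebesgue_eq_lborel borel_measurable_abs borel_measurable_continuous_onI) auto
      also have "\<dots> = \<bar>cn * s\<bar> * (\<integral>y. \<bar>partial_deriv i \<phi> (v + s *\<^sub>R y)\<bar> \<partial>lborel)"
        unfolding pd\<eta> by (simp add: abs_mult)
      also have "\<dots> = (1/2) ^ n * ?N i"
      proof -
        have "(\<lambda>x. \<bar>partial_deriv i \<phi> x\<bar>) \<in> borel_measurable borel"
          using test_functions_continuous[OF test_functions_partial[OF \<phi>_test]]
          by (intro borel_measurable_abs borel_measurable_continuous_onI)
        from integral_lborel_affine[OF this s(1), of v]
        have "?N i = (2 ^ n) ^ ?d * (\<integral>y. \<bar>partial_deriv i \<phi> (v + s *\<^sub>R y)\<bar> \<partial>lborel)"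
          by (simp add: s(2))
        then show ?thesis
          using s(2) by (simp add: cn_def abs_mult field_simps power2_eq_square power_one_over)
      qed
      finally show ?thesis by (simp add: mult_ac)
    qed
    have "\<bar>qn n x - qn (Suc n) x\<bar> \<le> (\<Sum>i\<in>UNIV. \<bar>\<integral>y. G i y * partial_deriv i \<eta> y \<partial>?M\<bar>)"
      unfolding e1 by (rule sum_abs)
    also have "\<dots> \<le> (\<Sum>i\<in>UNIV. B * ?N i * (1/2) ^ n)"
      by (intro sum_mono e2)
    also have "\<dots> = A * (1/2) ^ n" by (simp add: A_def sum_distrib_right)
    finally show ?thesis .
  qed

  define Q where "Q x = lim (\<lambda>n. qn n x)" for x
  have rate: "\<bar>qn n x - Q x\<bar> \<le> 2 * A * (1/2) ^ n" if "cball x ((1/2) ^ N) \<subseteq> \<Omega>" "N \<le> n" for x N n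
  proof -
    have "\<bar>qn m x - qn (Suc m) x\<bar> \<le> A * (1/2) ^ m" if "N \<le> m" for m
    proof (rule diff)
      have "(1/2::real) ^ m \<le> (1/2) ^ N" using that by (intro power_decreasing) auto
      then show "cball x ((1/2) ^ m) \<subseteq> \<Omega>"
        using subset_cball[of "(1/2) ^ m" "(1/2) ^ N" x] \<open>cball x ((1/2) ^ N) \<subseteq> \<Omega>\<close> by blast
    qed
    from telescoping_geometric_bound(2)[OF this that(2)] show ?thesis by (simp add: Q_def)
  qed
  have geo0: "(\<lambda>n. 2 * A * (1/2) ^ n) \<longlonglongrightarrow> 0"
    by (intro tendsto_mult_right_zero LIMSEQ_power_zero) simp

  have qn_cont: "continuous_on UNIV (qn n)" for n
  proof (rule continuous_on_sequentiallyI)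
    fix u and x :: "real^'d" assume u: "u \<longlonglongrightarrow> x"
    show "(\<lambda>k. qn n (u k)) \<longlonglongrightarrow> qn n x"
      unfolding qn_def
    proof (rule integral_dominated_convergence[where w = "\<lambda>y. \<bar>q0 y\<bar> * ((2 ^ n) ^ ?d * b)"])
      show "integrable lborel (\<lambda>y. \<bar>q0 y\<bar> * ((2 ^ n) ^ ?d * b))"
        using q0_int by (intro integrable_mult_left integrable_abs)
      show "AE y in lborel. (\<lambda>k. q0 y * \<kappa>n n (u k - y)) \<longlonglongrightarrow> q0 y * \<kappa>n n (x - y)"
      proof (rule AE_I2)
        fix y
        have "isCont (\<kappa>n n) (x - y)" using \<kappa>n_cont by (simp add: continuous_on_eq_continuous_at)
        then show "(\<lambda>k. q0 y * \<kappa>n n (u k - y)) \<longlonglongrightarrow> q0 y * \<kappa>n n (x - y)"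
          by (intro tendsto_mult tendsto_const isCont_tendsto_compose[of _ "\<kappa>n n"] tendsto_diff u)
      qed
      show "AE y in lborel. norm (q0 y * \<kappa>n n (u k - y)) \<le> \<bar>q0 y\<bar> * ((2 ^ n) ^ ?d * b)" for k
        using \<kappa>n_bound by (intro AE_I2) (auto simp: abs_mult intro!: mult_left_mono)
    qed measurable
  qed

  have Q_cont: "continuous_on \<Omega> Q"
  proof (rule continuous_at_imp_continuous_on, rule ballI)
    fix x0 assume "x0 \<in> \<Omega>"
    then obtain r where r: "r > 0" "cball x0 r \<subseteq> \<Omega>" using \<Omega> open_contains_cball by blast
    obtain N where N: "(1/2::real) ^ N < r / 2" using real_arch_pow_inv[of "r / 2" "1/2"] r(1) by auto
    have sub: "cball x ((1/2) ^ N) \<subseteq> \<Omega>" if "x \<in> ball x0 (r / 2)" for x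
    proof
      fix y assume "y \<in> cball x ((1/2) ^ N)"
      then have "dist x0 y \<le> r" using that N dist_triangle[of x0 y x] by simp
      then show "y \<in> \<Omega>" using r(2) by auto
    qed
    have "uniform_limit (ball x0 (r / 2)) qn Q sequentially"
    proof (rule uniform_limitI)
      fix e :: real assume "0 < e"
      then have "\<forall>\<^sub>F n in sequentially. 2 * A * (1/2) ^ n < e" by (rule order_tendstoD(2)[OF geo0])
      with eventually_ge_at_top[of N]
      show "\<forall>\<^sub>F n in sequentially. \<forall>x\<in>ball x0 (r / 2). dist (qn n x) (Q x) < e"
      proof eventually_elim
        case (elim n)
        then show ?case using rate[OF sub, of _ n] by (force simp: dist_real_def)
      qed
    qed
    then have "continuous_on (ball x0 (r / 2)) Q"
      by (rule uniform_limit_theorem[rotated])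
        (auto intro!: always_eventually continuous_on_subset[OF qn_cont])
    then show "isCont Q x0" using r(1) by (simp add: continuous_on_eq_continuous_at)
  qed

  \<comment> \<open>Moving the regularisation to \<open>\<zeta>\<close> by Fubini's theorem gives \<open>Q = c q\<close> as distributions.\<close>
  have weak: "(\<integral>x. Q x * \<zeta> x \<partial>lborel) = c * (\<integral>x. q0 x * \<zeta> x \<partial>lborel)" and
    Q\<zeta>_meas: "(\<lambda>x. Q x * \<zeta> x) \<in> borel_measurable borel"
    if \<zeta>: "\<zeta> \<in> test_functions \<Omega>" for \<zeta>
  proof -
    obtain K where K: "compact K" "K \<subseteq> \<Omega>" "\<forall>x. x \<notin> K \<longrightarrow> \<zeta> x = 0"
      using test_functions_support[OF \<zeta>] by blast
    let ?I = "\<lambda>n y. \<integral>w. \<kappa> w * \<zeta> (y + (1/2) ^ n *\<^sub>R w) \<partial>lborel"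
    note \<zeta>_cont = test_functions_continuous[OF \<zeta>]
    have \<zeta>_meas[measurable]: "\<zeta> \<in> borel_measurable borel" using \<zeta>_cont by (rule borel_measurable_continuous_onI)
    have \<zeta>_int: "integrable lborel \<zeta>"
      by (rule integrable_continuous_compact_support[OF \<zeta>_cont K(1)]) (use K(3) in blast)
    have "\<exists>z\<ge>0. \<forall>x. \<bar>\<zeta> x\<bar> \<le> z"
      by (rule continuous_compact_support_bounded[OF \<zeta>_cont K(1)]) (use K(3) in blast)
    then obtain z where z: "0 \<le> z" "\<forall>x. \<bar>\<zeta> x\<bar> \<le> z" by blast
    have "integrable lborel (\<lambda>x. indicator K x *\<^sub>R (Q x * \<zeta> x))"
      by (intro borel_integrable_compact[OF K(1)] continuous_on_mult continuous_on_subset[OF Q_cont K(2)]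
          continuous_on_subset[OF \<zeta>_cont]) simp
    also have "(\<lambda>x. indicator K x *\<^sub>R (Q x * \<zeta> x)) = (\<lambda>x. Q x * \<zeta> x)"
      using K(3) by (auto simp: indicator_def fun_eq_iff)
    finally have Q\<zeta>_int: "integrable lborel (\<lambda>x. Q x * \<zeta> x)" .
    then show "(\<lambda>x. Q x * \<zeta> x) \<in> borel_measurable borel" by auto
    have qn\<zeta>_int: "integrable lborel (\<lambda>x. qn n x * \<zeta> x)" for n
      using test_functions_integrable_mult[OF \<zeta> qn_cont[of n]] by (simp add: mult.commute)
    obtain e where e: "0 < e" "(\<Union>x\<in>K. cball x e) \<subseteq> \<Omega>"
      using compact_subset_open_imp_cball_epsilon_subset[OF K(1) \<Omega> K(2)] by auto
    obtain N where N: "(1/2::real) ^ N < e" using real_arch_pow_inv[of e "1/2"] e(1) by auto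
    have sub: "cball x ((1/2) ^ N) \<subseteq> \<Omega>" if "x \<in> K" for x
    proof -
      have "cball x ((1/2) ^ N) \<subseteq> cball x e" using N by (intro subset_cball) simp
      then show ?thesis using e(2) that by blast
    qed
    have lim1: "(\<lambda>n. \<integral>x. qn n x * \<zeta> x \<partial>lborel) \<longlonglongrightarrow> (\<integral>x. Q x * \<zeta> x \<partial>lborel)"
    proof (rule Lim_null[THEN iffD2], rule Lim_null_comparison)
      show "(\<lambda>n. 2 * A * (1/2) ^ n * (\<integral>x. \<bar>\<zeta> x\<bar> \<partial>lborel)) \<longlonglongrightarrow> 0"
        using tendsto_mult_left_zero[OF geo0] by simp
      show "\<forall>\<^sub>F n in sequentially. norm ((\<integral>x. qn n x * \<zeta> x \<partial>lborel) - (\<integral>x. Q x * \<zeta> x \<partial>lborel))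
          \<le> 2 * A * (1/2) ^ n * (\<integral>x. \<bar>\<zeta> x\<bar> \<partial>lborel)"
        using eventually_ge_at_top[of N]
      proof eventually_elim
        case (elim n)
        have "(\<integral>x. qn n x * \<zeta> x \<partial>lborel) - (\<integral>x. Q x * \<zeta> x \<partial>lborel) = (\<integral>x. qn n x * \<zeta> x - Q x * \<zeta> x \<partial>lborel)"
          using qn\<zeta>_int Q\<zeta>_int by simp
        also have "norm \<dots> \<le> (\<integral>x. norm (qn n x * \<zeta> x - Q x * \<zeta> x) \<partial>lborel)"
          by (rule integral_norm_bound)
        also have "\<dots> \<le> (\<integral>x. 2 * A * (1/2) ^ n * \<bar>\<zeta> x\<bar> \<partial>lborel)"
        proof (rule integral_mono)
          show "integrable lborel (\<lambda>x. norm (qn n x * \<zeta> x - Q x * \<zeta> x))"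
            using qn\<zeta>_int Q\<zeta>_int by (intro integrable_norm Bochner_Integration.integrable_diff)
          show "integrable lborel (\<lambda>x. 2 * A * (1/2) ^ n * \<bar>\<zeta> x\<bar>)"
            using \<zeta>_int by (intro integrable_mult_right integrable_abs)
          fix x
          show "norm (qn n x * \<zeta> x - Q x * \<zeta> x) \<le> 2 * A * (1/2) ^ n * \<bar>\<zeta> x\<bar>"
          proof (cases "x \<in> K")
            case True
            have "norm (qn n x * \<zeta> x - Q x * \<zeta> x) = \<bar>qn n x - Q x\<bar> * \<bar>\<zeta> x\<bar>"
              by (simp add: left_diff_distrib[symmetric] abs_mult)
            also have "\<dots> \<le> 2 * A * (1/2) ^ n * \<bar>\<zeta> x\<bar>"
              by (intro mult_right_mono rate[OF sub[OF True] elim]) simp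
            finally show ?thesis .
          next
            case False
            then show ?thesis using K(3) by simp
          qed
        qed
        also have "\<dots> = 2 * A * (1/2) ^ n * (\<integral>x. \<bar>\<zeta> x\<bar> \<partial>lborel)" by simp
        finally show ?case .
      qed
    qed
    have swap: "(\<integral>x. qn n x * \<zeta> x \<partial>lborel) = (\<integral>y. q0 y * ?I n y \<partial>lborel)" for n
    proof -
      have prod_int: "integrable (lborel \<Otimes>\<^sub>M lborel) (\<lambda>(x, y). q0 y * \<kappa>n n (x - y) * \<zeta> x)"
      proof (rule Bochner_Integration.integrable_bound)
        show "integrable (lborel \<Otimes>\<^sub>M lborel) (\<lambda>(x, y). ((2 ^ n) ^ ?d * b) * (\<zeta> x * q0 y))"
        proof (rule lborel_pair.Fubini_integrable)
          show "(\<lambda>(x, y). ((2 ^ n) ^ ?d * b) * (\<zeta> x * q0 y)) \<in> borel_measurable (lborel \<Otimes>\<^sub>M lborel)" by measurable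
          have "(\<lambda>x. \<integral>y. norm (case (x, y) of (x, y) \<Rightarrow> ((2 ^ n) ^ ?d * b) * (\<zeta> x * q0 y)) \<partial>lborel)
              = (\<lambda>x. ((2 ^ n) ^ ?d * b * (\<integral>y. \<bar>q0 y\<bar> \<partial>lborel)) * \<bar>\<zeta> x\<bar>)"
            using b(1) by (simp add: abs_mult fun_eq_iff mult_ac)
          then show "integrable lborel (\<lambda>x. \<integral>y. norm (case (x, y) of (x, y) \<Rightarrow> ((2 ^ n) ^ ?d * b) * (\<zeta> x * q0 y)) \<partial>lborel)"
            using \<zeta>_int by (simp add: integrable_abs)
          show "AE x in lborel. integrable lborel (\<lambda>y. case (x, y) of (x, y) \<Rightarrow> ((2 ^ n) ^ ?d * b) * (\<zeta> x * q0 y))"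
            using q0_int by simp
        qed
        show "(\<lambda>(x, y). q0 y * \<kappa>n n (x - y) * \<zeta> x) \<in> borel_measurable (lborel \<Otimes>\<^sub>M lborel)" by measurable
        have "\<bar>q0 y * \<kappa>n n (x - y) * \<zeta> x\<bar> \<le> \<bar>((2 ^ n) ^ ?d * b) * (\<zeta> x * q0 y)\<bar>" for x y
        proof -
          have "\<bar>\<kappa>n n (x - y)\<bar> * (\<bar>\<zeta> x\<bar> * \<bar>q0 y\<bar>) \<le> ((2 ^ n) ^ ?d * b) * (\<bar>\<zeta> x\<bar> * \<bar>q0 y\<bar>)"
            by (intro mult_right_mono \<kappa>n_bound) simp
          then show ?thesis using b(1) by (simp add: abs_mult mult_ac)
        qed
        then show "AE x in lborel \<Otimes>\<^sub>M lborel. norm (case x of (x, y) \<Rightarrow> q0 y * \<kappa>n n (x - y) * \<zeta> x)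
          \<le> norm (case x of (x, y) \<Rightarrow> ((2 ^ n) ^ ?d * b) * (\<zeta> x * q0 y))"
          by (intro AE_I2) auto
      qed
      have "(\<integral>x. qn n x * \<zeta> x \<partial>lborel) = (\<integral>x. (\<integral>y. q0 y * \<kappa>n n (x - y) * \<zeta> x \<partial>lborel) \<partial>lborel)"
        by (simp add: qn_def)
      also have "\<dots> = (\<integral>y. (\<integral>x. q0 y * \<kappa>n n (x - y) * \<zeta> x \<partial>lborel) \<partial>lborel)"
        using lborel_pair.Fubini_integral[OF prod_int] by simp
      also have "(\<lambda>y. \<integral>x. q0 y * \<kappa>n n (x - y) * \<zeta> x \<partial>lborel)
          = (\<lambda>y. q0 y * ?I n y)"
      proof
        fix y
        have "(\<integral>x. \<kappa>n n (x - y) * \<zeta> x \<partial>lborel)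
            = \<bar>(1/2) ^ n\<bar> ^ ?d * (\<integral>w. \<kappa>n n ((y + (1/2) ^ n *\<^sub>R w) - y) * \<zeta> (y + (1/2) ^ n *\<^sub>R w) \<partial>lborel)"
          by (rule integral_lborel_affine) auto
        also have "\<dots> = ?I n y"
          by (simp add: \<kappa>n_def mult.assoc power_one_over flip: power_mult_distrib)
        finally show "(\<integral>x. q0 y * \<kappa>n n (x - y) * \<zeta> x \<partial>lborel)
          = q0 y * ?I n y" by (simp add: mult.assoc)
      qed
      finally show ?thesis .
    qed
    have in_bound: "\<bar>\<kappa> w * \<zeta> (y + (1/2) ^ n *\<^sub>R w)\<bar> \<le> \<kappa> w * z" for n w y
      using z \<kappa>(3) by (auto simp: abs_mult intro!: mult_left_mono)
    have inner: "(\<lambda>n. ?I n y) \<longlonglongrightarrow> (\<integral>w. \<kappa> w * \<zeta> y \<partial>lborel)" for y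
    proof (rule integral_dominated_convergence[where w = "\<lambda>w. \<kappa> w * z"])
      show "integrable lborel (\<lambda>w. \<kappa> w * z)" using \<kappa>_int by simp
      show "AE w in lborel. (\<lambda>n. \<kappa> w * \<zeta> (y + (1/2) ^ n *\<^sub>R w)) \<longlonglongrightarrow> \<kappa> w * \<zeta> y"
      proof (rule AE_I2)
        fix w
        have "(\<lambda>n. y + (1/2) ^ n *\<^sub>R w) \<longlonglongrightarrow> y + 0 *\<^sub>R w"
          by (intro tendsto_intros LIMSEQ_power_zero) simp
        moreover have "isCont \<zeta> y" using \<zeta>_cont by (simp add: continuous_on_eq_continuous_at)
        ultimately show "(\<lambda>n. \<kappa> w * \<zeta> (y + (1/2) ^ n *\<^sub>R w)) \<longlonglongrightarrow> \<kappa> w * \<zeta> y"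
          by (intro tendsto_mult tendsto_const isCont_tendsto_compose[of _ \<zeta>]) auto
      qed
      show "AE w in lborel. norm (\<kappa> w * \<zeta> (y + (1/2) ^ n *\<^sub>R w)) \<le> \<kappa> w * z" for n
        using in_bound by simp
    qed measurable
    have lim2: "(\<lambda>n. \<integral>y. q0 y * ?I n y \<partial>lborel)
        \<longlonglongrightarrow> (\<integral>y. q0 y * (\<integral>w. \<kappa> w * \<zeta> y \<partial>lborel) \<partial>lborel)"
    proof (rule integral_dominated_convergence[where w = "\<lambda>y. \<bar>q0 y\<bar> * (c * z)"])
      show "integrable lborel (\<lambda>y. \<bar>q0 y\<bar> * (c * z))" using q0_int by (intro integrable_mult_left integrable_abs)
      show "AE y in lborel. (\<lambda>n. q0 y * ?I n y)
          \<longlonglongrightarrow> q0 y * (\<integral>w. \<kappa> w * \<zeta> y \<partial>lborel)"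
        by (intro AE_I2 tendsto_mult tendsto_const inner)
      have "\<bar>?I n y\<bar> \<le> c * z" for n y
      proof -
        have "norm (?I n y) \<le> (\<integral>w. norm (\<kappa> w * \<zeta> (y + (1/2) ^ n *\<^sub>R w)) \<partial>lborel)"
          by (rule integral_norm_bound)
        also have "\<dots> \<le> (\<integral>w. \<kappa> w * z \<partial>lborel)"
          using \<kappa>_int in_bound \<kappa>(3) z(1) by (intro integral_mono') auto
        also have "\<dots> = c * z" by (simp add: c_def)
        finally show ?thesis by simp
      qed
      then show "AE y in lborel. norm (q0 y * ?I n y) \<le> \<bar>q0 y\<bar> * (c * z)" for n
        by (intro AE_I2) (auto simp: abs_mult intro!: mult_left_mono)
    qed measurable
    have "(\<integral>x. Q x * \<zeta> x \<partial>lborel) = (\<integral>y. q0 y * (\<integral>w. \<kappa> w * \<zeta> y \<partial>lborel) \<partial>lborel)"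
      using LIMSEQ_unique[OF lim1[unfolded swap] lim2] .
    also have "\<dots> = (\<integral>y. c * (q0 y * \<zeta> y) \<partial>lborel)"
      by (intro Bochner_Integration.integral_cong) (auto simp: c_def)
    also have "\<dots> = c * (\<integral>x. q0 x * \<zeta> x \<partial>lborel)" by simp
    finally show "(\<integral>x. Q x * \<zeta> x \<partial>lborel) = c * (\<integral>x. q0 x * \<zeta> x \<partial>lborel)" .
  qed

  have QL: "Q \<in> L1_loc \<Omega>"
    unfolding L1_loc_def
  proof safe
    fix K assume K: "compact K" "K \<subseteq> \<Omega>"
    then have "integrable lborel (\<lambda>x. indicator K x *\<^sub>R Q x)"
      by (intro borel_integrable_compact continuous_on_subset[OF Q_cont])
    then show "set_integrable lebesgue K Q"
      unfolding set_integrable_def using integrable_completion borel_measurable_integrable by blast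
  qed
  have qL: "q \<in> L1_loc \<Omega>"
    unfolding L1_loc_def
  proof safe
    fix K assume K: "compact K" "K \<subseteq> \<Omega>"
    have "set_integrable lebesgue \<Omega> q"
      using q by (simp add: integrable_lebesgue_on_iff[OF \<Omega>] set_integrable_def)
    then show "set_integrable lebesgue K q"
      by (rule set_integrable_subset) (use K in \<open>auto simp: compact_imp_closed\<close>)
  qed
  have wL: "(\<lambda>x. 1 * Q x + (- c) * q x) \<in> L1_loc \<Omega>" using QL qL by (rule L1_loc_lincomb)
  have "(LINT x:\<Omega>|lebesgue. (1 * Q x + (- c) * q x) * \<zeta> x) = 0" if \<zeta>: "\<zeta> \<in> test_functions \<Omega>" for \<zeta>
  proof -
    have zero: "\<zeta> x = 0" if "x \<notin> \<Omega>" for x using test_functions_support[OF \<zeta>] that by blast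
    have "(\<integral>x. Q x * \<zeta> x \<partial>?M) = (\<integral>x. Q x * \<zeta> x \<partial>lborel)"
      unfolding LINT_lebesgue_on[OF \<Omega>, symmetric]
      using Q\<zeta>_meas[OF \<zeta>] zero by (intro set_integral_lebesgue_eq_lborel) auto
    also have "\<dots> = c * (\<integral>x. q x * \<zeta> x \<partial>?M)"
      using weak[OF \<zeta>] q0_eq[OF borel_measurable_continuous_onI[OF test_functions_continuous[OF \<zeta>]]] by simp
    finally show ?thesis
      using L1_loc_mult_test_integrable[OF \<Omega> QL \<zeta>] L1_loc_mult_test_integrable[OF \<Omega> qL \<zeta>]
      by (simp add: LINT_lebesgue_on[OF \<Omega>] left_diff_distrib mult.assoc)
  qed
  then have "AE x in lebesgue. x \<in> \<Omega> \<longrightarrow> 1 * Q x + (- c) * q x = 0"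
    using AE_zero_if_orthogonal_to_test_functions[OF \<Omega> wL] by blast
  then have "AE x in lebesgue. x \<in> \<Omega> \<longrightarrow> q x = Q x / c"
    by eventually_elim (use \<kappa>(4) in \<open>auto simp: c_def field_simps\<close>)
  moreover have "continuous_on \<Omega> (\<lambda>x. Q x / c)"
    using \<kappa>(4) by (intro continuous_intros Q_cont) (simp add: c_def)
  ultimately show ?thesis by blast
qed

section \<open>The right-hand side \<open>\<Phi>\<^sup>2 \<nabla>a\<close>\<close>

text \<open>The inclusions have their closures in \<open>D\<close>, so off \<open>D\<close> only the background value \<open>a0\<close> contributes to the
  sum. On the interfaces the sum is zero, which is still bounded and measurable.\<close>

lemma class_A_contrast:
  assumes \<Omega>: "open \<Omega>" and a: "a \<in> class_A \<Omega> D alo ahi a0"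
  shows "a \<in> borel_measurable (lebesgue_on \<Omega>)"
    and "\<exists>B\<ge>0. \<forall>x\<in>\<Omega>. \<bar>a x - a0\<bar> \<le> B"
    and "\<forall>x\<in>\<Omega> - D. a x = a0"
proof -
  obtain k A \<alpha> where
    A: "\<forall>i\<in>{1..k::nat}. smooth_domain (A i) \<and> A i \<subseteq> \<Omega> \<and> connected (frontier (A i))"
    and comp: "compactly_contained (\<Union>i\<in>{1..k}. closure (A i)) D"
    and \<alpha>: "\<forall>i\<in>{1..k}. Ck_closure 2 (A i) (\<alpha> i) \<and> (\<forall>x\<in>closure (A i). \<alpha> i x \<in> {alo..ahi})"
    and A0: "A 0 = \<Omega> - (\<Union>i\<in>{1..k}. closure (A i))"
    and \<alpha>0: "\<forall>x\<in>A 0. \<alpha> 0 x = a0"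
    and sum: "\<forall>x\<in>\<Omega>. a x = (\<Sum>i=0..k. \<alpha> i x * indicator (A i) x)"
    using a unfolding class_A_def mem_Collect_eq by (elim exE conjE) (rule that; assumption)
  have borelA: "A i \<in> sets borel" if "i \<in> {0..k}" for i
  proof (cases "i = 0")
    case True
    have "closed (\<Union>i\<in>{1..k}. closure (A i))" by (intro closed_UN) auto
    then show ?thesis using True \<Omega> by (auto simp: A0)
  next
    case False
    then have "open (A i)" using A that by (auto simp: smooth_domain_def domain_of_class_def)
    then show ?thesis by simp
  qed
  have meas: "(\<lambda>x. \<alpha> i x * indicator (A i) x) \<in> borel_measurable borel" if i: "i \<in> {0..k}" for i
  proof (cases "i = 0")
    case True
    then have "(\<lambda>x. \<alpha> i x * indicator (A i) x) = (\<lambda>x. a0 * indicator (A i) x)"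
      using \<alpha>0 by (auto simp: indicator_def fun_eq_iff)
    then show ?thesis using borelA[OF i] by simp
  next
    case False
    then have "continuous_on (closure (A i)) (\<alpha> i)"
      using \<alpha> i by (auto simp: numeral_2_eq_2)
    then have "continuous_on (A i) (\<alpha> i)" by (rule continuous_on_subset) (rule closure_subset)
    from borel_measurable_continuous_on_indicator[OF borelA[OF i] this]
    show ?thesis by (simp add: mult.commute)
  qed
  define f where "f x = (\<Sum>i=0..k. \<alpha> i x * indicator (A i) x)" for x
  have "f \<in> borel_measurable borel" unfolding f_def[abs_def] by (intro borel_measurable_sum meas) auto
  then have "f \<in> borel_measurable lebesgue" by (intro measurable_completion) simp
  then have "f \<in> borel_measurable (lebesgue_on \<Omega>)" by (rule measurable_restrict_space1)
  moreover have "\<And>x. x \<in> space (lebesgue_on \<Omega>) \<Longrightarrow> f x = a x" using sum by (simp add: f_def)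
  ultimately show "a \<in> borel_measurable (lebesgue_on \<Omega>)" using measurable_cong by blast
  let ?c = "\<bar>alo\<bar> + \<bar>ahi\<bar> + \<bar>a0\<bar>"
  have term_bound: "\<bar>\<alpha> i x * indicator (A i) x\<bar> \<le> ?c" if i: "i \<in> {0..k}" for i x
  proof (cases "x \<in> A i")
    case True
    show ?thesis
    proof (cases "i = 0")
      case True
      then show ?thesis using \<alpha>0 \<open>x \<in> A i\<close> by simp
    next
      case False
      then have "\<alpha> i x \<in> {alo..ahi}" using \<alpha> i \<open>x \<in> A i\<close> closure_subset by fastforce
      then show ?thesis using \<open>x \<in> A i\<close> by auto
    qed
  qed simp
  have "\<bar>a x - a0\<bar> \<le> (\<Sum>i=0..k. ?c) + \<bar>a0\<bar>" if "x \<in> \<Omega>" for x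
  proof -
    have "\<bar>a x\<bar> \<le> (\<Sum>i=0..k. \<bar>\<alpha> i x * indicator (A i) x\<bar>)"
      using sum that sum_abs[of "\<lambda>i. \<alpha> i x * indicator (A i) x" "{0..k}"] by simp
    also have "\<dots> \<le> (\<Sum>i=0..k. ?c)" by (intro sum_mono term_bound)
    finally show ?thesis by linarith
  qed
  moreover have "0 \<le> (\<Sum>i=0..k. ?c) + \<bar>a0\<bar>" by (intro add_nonneg_nonneg sum_nonneg) auto
  ultimately show "\<exists>B\<ge>0. \<forall>x\<in>\<Omega>. \<bar>a x - a0\<bar> \<le> B" by blast
  show "\<forall>x\<in>\<Omega> - D. a x = a0"
  proof
    fix x assume x: "x \<in> \<Omega> - D"
    have "(\<Union>i\<in>{1..k}. closure (A i)) \<subseteq> D"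
      using comp order_trans[OF closure_subset] unfolding compactly_contained_def by blast
    then have notin: "x \<notin> closure (A i)" if "i \<in> {1..k}" for i
      using that x by blast
    then have x0: "x \<in> A 0" using x by (auto simp: A0)
    have "\<alpha> i x * indicator (A i) x = (if i = 0 then a0 else 0)" if "i \<in> {0..k}" for i
      using that notin[of i] x0 \<alpha>0 closure_subset[of "A i"] by (auto simp: indicator_def)
    then have "(\<Sum>i=0..k. \<alpha> i x * indicator (A i) x) = (\<Sum>i=0..k. if i = 0 then a0 else 0)"
      by (intro sum.cong) auto
    then show "a x = a0" using sum x by simp
  qed
qed

text \<open>The factor \<open>g\<close> is only differentiable in \<open>\<Omega>\<close>; near points outside, the product is zero
  because the support of \<open>\<eta>\<close> is compact in \<open>\<Omega>\<close>.\<close>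

lemma C1_times_test_function:
  fixes g :: "real ^ 'd \<Rightarrow> real"
  assumes \<Omega>: "open \<Omega>" and g: "\<forall>x\<in>\<Omega>. g differentiable (at x)" "continuous_on \<Omega> (partial_deriv i g)"
    and \<eta>: "\<eta> \<in> test_functions \<Omega>"
  shows "(\<lambda>x. g x * \<eta> x) differentiable (at x)"
    and "continuous_on UNIV (partial_deriv i (\<lambda>x. g x * \<eta> x))"
    and "x \<in> \<Omega> \<Longrightarrow> partial_deriv i (\<lambda>x. g x * \<eta> x) x = g x * partial_deriv i \<eta> x + partial_deriv i g x * \<eta> x"
proof -
  obtain K where K: "compact K" "K \<subseteq> \<Omega>" "\<forall>x. x \<notin> K \<longrightarrow> \<eta> x = 0"
    using test_functions_support[OF \<eta>] by blast
  have oK: "open (- K)" using K(1) by (simp add: compact_imp_closed open_Compl)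
  have cover: "UNIV = \<Omega> \<union> - K" using K(2) by blast
  note d\<eta> = test_functions_differentiable[OF \<eta>]
  have zero: "g y * \<eta> y = 0" if "y \<in> - K" for y using K(3) that by simp
  show "(\<lambda>x. g x * \<eta> x) differentiable (at x)" for x
  proof (cases "x \<in> \<Omega>")
    case True
    then show ?thesis using g(1) d\<eta> by (intro differentiable_mult) auto
  next
    case False
    then have "x \<in> - K" using K(2) by blast
    then show ?thesis
      by (rule differentiable_cong_open[OF oK, of x "\<lambda>x. 0"]) (simp_all add: zero)
  qed
  show pd: "partial_deriv i (\<lambda>x. g x * \<eta> x) x = g x * partial_deriv i \<eta> x + partial_deriv i g x * \<eta> x"
    if "x \<in> \<Omega>" for x
    using g(1) that d\<eta> by (intro partial_deriv_mult) auto
  have cg: "continuous_on \<Omega> g"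
    using g(1) by (auto intro!: continuous_at_imp_continuous_on differentiable_imp_continuous_within)
  have "continuous_on \<Omega> (\<lambda>x. g x * partial_deriv i \<eta> x + partial_deriv i g x * \<eta> x)"
    by (intro continuous_on_add continuous_on_mult cg g(2)
        continuous_on_subset[OF test_functions_continuous[OF \<eta>] subset_UNIV]
        continuous_on_subset[OF test_functions_continuous[OF test_functions_partial[OF \<eta>]] subset_UNIV])
  then have c1: "continuous_on \<Omega> (partial_deriv i (\<lambda>x. g x * \<eta> x))"
    by (rule continuous_on_eq) (simp add: pd)
  have pd0: "partial_deriv i (\<lambda>x. g x * \<eta> x) x = 0" if "x \<in> - K" for x
    using partial_deriv_cong_open[OF oK that, of "\<lambda>x. g x * \<eta> x" "\<lambda>x. 0"] zero by simp
  have c2: "continuous_on (- K) (partial_deriv i (\<lambda>x. g x * \<eta> x))"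
    by (rule continuous_on_eq[of _ "\<lambda>x. 0"]) (simp_all add: pd0)
  show "continuous_on UNIV (partial_deriv i (\<lambda>x. g x * \<eta> x))"
    unfolding cover by (rule continuous_on_open_Un[OF \<Omega> oK c1 c2])
qed

lemma continuous_on_imp_measurable_lebesgue_on:
  fixes f :: "real ^ 'd \<Rightarrow> real"
  assumes "open \<Omega>" "continuous_on \<Omega> f"
  shows "f \<in> borel_measurable (lebesgue_on \<Omega>)"
  using assms by (intro continuous_imp_measurable_on_sets_lebesgue) auto

lemma contrast_times_continuous_bounded:
  fixes h :: "real ^ 'd \<Rightarrow> real"
  assumes D: "compactly_contained D \<Omega>" and b: "0 \<le> B" "\<forall>x\<in>\<Omega>. \<bar>b x\<bar> \<le> B" "\<forall>x\<in>\<Omega> - D. b x = 0"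
    and h: "continuous_on \<Omega> h"
  shows "\<exists>C\<ge>0. \<forall>x\<in>\<Omega>. \<bar>b x * h x\<bar> \<le> C"
proof -
  have "compact (h ` closure D)"
    using D h by (intro compact_continuous_image)
      (auto simp: compactly_contained_def intro: continuous_on_subset)
  then have "bounded (h ` closure D)" by (rule compact_imp_bounded)
  then obtain C where C: "0 < C" "\<forall>x\<in>closure D. \<bar>h x\<bar> \<le> C"
    unfolding bounded_pos by auto
  have "\<bar>b x * h x\<bar> \<le> B * C" if x: "x \<in> \<Omega>" for x
  proof (cases "x \<in> D")
    case True
    then have "\<bar>h x\<bar> \<le> C" using C(2) closure_subset by blast
    then show ?thesis using b(1,2) x by (auto simp: abs_mult intro!: mult_mono)
  next
    case False
    then show ?thesis using b(1,3) C(1) x by simp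
  qed
  then show ?thesis using b(1) C(1) by (intro exI[of _ "B * C"]) auto
qed

text \<open>Since \<open>\<Phi>\<^sup>2 \<nabla>a = \<nabla>(\<Phi>\<^sup>2 (a - a0)) - (a - a0) \<nabla>\<Phi>\<^sup>2\<close>, the difference \<open>\<psi> - \<Phi>\<^sup>2 (a - a0)\<close> has as
  its Laplacian the divergence of a bounded field.\<close>

lemma potential_minus_contrast_AE_continuous:
  fixes \<Omega> D :: "(real ^ 'd) set"
  assumes \<Omega>: "open \<Omega>" "bounded \<Omega>" and D: "compactly_contained D \<Omega>" and \<Phi>: "Ck_on 1 \<Omega> \<Phi>"
    and \<psi>: "\<psi> \<in> L2 \<Omega>"
    and dec: "\<forall>\<phi>\<in>test_functions \<Omega>. \<forall>i. U i \<phi> = dist_grad \<Omega> \<psi> i \<phi> + \<Psi> i \<phi>"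
    and div: "\<forall>\<phi>\<in>test_functions \<Omega>. dist_div \<Psi> \<phi> = 0"
    and a: "a \<in> class_A \<Omega> D alo ahi a0" and U: "is_weighted_grad \<Omega> D a0 \<Phi> a U"
  shows "\<exists>Q. continuous_on \<Omega> Q \<and> (AE x in lebesgue. x \<in> \<Omega> \<longrightarrow> \<psi> x - (a x - a0) * (\<Phi> x * \<Phi> x) = Q x)"
proof -
  let ?M = "lebesgue_on \<Omega>"
  define b where "b x = a x - a0" for x
  define g where "g x = \<Phi> x * \<Phi> x" for x
  have D\<Omega>: "D \<subseteq> \<Omega>" using D closure_subset unfolding compactly_contained_def by blast
  have bm: "b \<in> borel_measurable (?M)"
    using class_A_contrast(1)[OF \<Omega>(1) a] unfolding b_def[abs_def] by simp
  obtain B where B: "0 \<le> B" "\<forall>x\<in>\<Omega>. \<bar>b x\<bar> \<le> B"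
    using class_A_contrast(2)[OF \<Omega>(1) a] unfolding b_def by blast
  have b0: "\<forall>x\<in>\<Omega> - D. b x = 0" using class_A_contrast(3)[OF \<Omega>(1) a] by (simp add: b_def)
  have \<Phi>d: "\<forall>x\<in>\<Omega>. \<Phi> differentiable (at x)" and \<Phi>c: "\<And>i. continuous_on \<Omega> (partial_deriv i \<Phi>)"
    using \<Phi> by auto
  have \<Phi>cont: "continuous_on \<Omega> \<Phi>" using \<Phi> by (rule Ck_on_imp_continuous_on)
  have gd: "\<forall>x\<in>\<Omega>. g differentiable (at x)"
    unfolding g_def[abs_def] using \<Phi>d by (auto intro: differentiable_mult)
  have gcont: "continuous_on \<Omega> g" unfolding g_def[abs_def] by (intro continuous_on_mult \<Phi>cont)
  have gc: "continuous_on \<Omega> (partial_deriv i g)" for i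
  proof -
    have "continuous_on \<Omega> (\<lambda>x. \<Phi> x * partial_deriv i \<Phi> x + partial_deriv i \<Phi> x * \<Phi> x)"
      by (intro continuous_on_add continuous_on_mult \<Phi>cont \<Phi>c)
    then show ?thesis
      by (rule continuous_on_eq) (use \<Phi>d in \<open>simp add: g_def[abs_def] partial_deriv_mult\<close>)
  qed
  interpret finite_measure "?M"
    using \<Omega> by (intro finite_measure_lebesgue_on bounded_set_imp_lmeasurable) auto
  have bounded_integrable: "integrable (?M) (\<lambda>x. b x * h x)" if h: "continuous_on \<Omega> h" for h
  proof -
    obtain C where "0 \<le> C" "\<forall>x\<in>\<Omega>. \<bar>b x * h x\<bar> \<le> C"
      using contrast_times_continuous_bounded[OF D B b0 h] by blast
    then show ?thesis
      using bm continuous_on_imp_measurable_lebesgue_on[OF \<Omega>(1) h]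
      by (intro integrable_const_bound[of _ C]) auto
  qed
  define q where "q x = \<psi> x - b x * g x" for x
  define G where "G i x = b x * partial_deriv i g x" for i x
  have sq: "square_integrable (?M) \<psi>" using \<psi> L2_iff_square_integrable[OF \<Omega>(1)] by blast
  have qint: "integrable (?M) q"
    unfolding q_def[abs_def]
    by (intro Bochner_Integration.integrable_diff square_integrable_imp_integrable[OF sq] bounded_integrable gcont)
  have Gm: "\<forall>i. G i \<in> borel_measurable (?M)"
    unfolding G_def[abs_def] using bounded_integrable[OF gc] by auto
  have "\<forall>i. \<exists>C\<ge>0. \<forall>x\<in>\<Omega>. \<bar>G i x\<bar> \<le> C"
    unfolding G_def using contrast_times_continuous_bounded[OF D B b0 gc] by blast
  then obtain C where C: "\<forall>i. 0 \<le> C i \<and> (\<forall>x\<in>\<Omega>. \<bar>G i x\<bar> \<le> C i)" by metis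
  have Gb: "\<forall>i. \<forall>x\<in>\<Omega>. \<bar>G i x\<bar> \<le> (\<Sum>i\<in>UNIV. C i)"
  proof (intro allI ballI)
    fix i x assume "x \<in> \<Omega>"
    then have "\<bar>G i x\<bar> \<le> C i" using C by blast
    also have "C i \<le> (\<Sum>i\<in>UNIV. C i)" using C by (intro member_le_sum) auto
    finally show "\<bar>G i x\<bar> \<le> (\<Sum>i\<in>UNIV. C i)" .
  qed
  have "(\<integral>x. q x * laplacian \<phi> x \<partial>?M) = (\<Sum>i\<in>UNIV. \<integral>x. G i x * partial_deriv i \<phi> x \<partial>?M)"
    if \<phi>: "\<phi> \<in> test_functions \<Omega>" for \<phi>
  proof -
    note D1 = test_functions_partial[OF \<phi>]
    note D2 = test_functions_partial[OF D1]
    have c1: "continuous_on \<Omega> (partial_deriv i \<phi>)" for i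
      using test_functions_continuous[OF D1] by (rule continuous_on_subset) simp
    have c2: "continuous_on \<Omega> (laplacian \<phi>)"
      using test_functions_continuous[OF laplacian_test_function[OF \<phi>]] by (rule continuous_on_subset) simp
    have int_pp: "integrable (?M) (\<lambda>x. \<psi> x * partial_deriv i (partial_deriv i \<phi>) x)" for i
      by (rule square_integrable_mult[OF sq test_function_square_integrable(1)[OF \<Omega>(1) D2]])
    have "(\<Sum>i\<in>UNIV. U i (partial_deriv i \<phi>))
        = (\<Sum>i\<in>UNIV. dist_grad \<Omega> \<psi> i (partial_deriv i \<phi>)) - dist_div \<Psi> \<phi>"
      using dec D1 by (simp add: dist_div_def sum.distrib)
    also have "\<dots> = - (\<integral>x. \<psi> x * laplacian \<phi> x \<partial>?M)"
      using div \<phi> int_pp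
      by (simp add: dist_grad_def LINT_lebesgue_on[OF \<Omega>(1)] laplacian_def sum_distrib_left sum_negf)
    finally have e1: "(\<Sum>i\<in>UNIV. U i (partial_deriv i \<phi>)) = - (\<integral>x. \<psi> x * laplacian \<phi> x \<partial>?M)" .
    let ?S = "\<lambda>x. \<Sum>i\<in>UNIV. weak_partial \<Omega> i (\<lambda>y. (\<Phi> y)\<^sup>2 * partial_deriv i \<phi> y) x"
    have "(\<Sum>i\<in>UNIV. U i (partial_deriv i \<phi>)) = weighted_grad \<Omega> D a0 \<Phi> a (\<lambda>i. partial_deriv i \<phi>)"
      using U[unfolded is_weighted_grad_def, rule_format, of "\<lambda>i. partial_deriv i \<phi>"]
        test_function_H10[OF \<Omega>(1) D1] by simp
    also have "\<dots> = - (LINT x:\<Omega>|lebesgue. b x * ?S x)"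
    proof -
      have "(\<lambda>x. indicator D x *\<^sub>R (b x * ?S x)) = (\<lambda>x. indicator \<Omega> x *\<^sub>R (b x * ?S x))"
        using b0 D\<Omega> by (auto simp: indicator_def fun_eq_iff)
      then show ?thesis by (simp add: weighted_grad_def set_lebesgue_integral_def b_def[symmetric])
    qed
    also have "(LINT x:\<Omega>|lebesgue. b x * ?S x)
        = (\<integral>x. b x * (g x * laplacian \<phi> x + (\<Sum>i\<in>UNIV. partial_deriv i g x * partial_deriv i \<phi> x)) \<partial>?M)"
      unfolding LINT_lebesgue_on[OF \<Omega>(1)]
    proof -
      let ?T = "\<lambda>x. g x * laplacian \<phi> x + (\<Sum>i\<in>UNIV. partial_deriv i g x * partial_deriv i \<phi> x)"
      have "AE x in ?M. weak_partial \<Omega> i (\<lambda>y. (\<Phi> y)\<^sup>2 * partial_deriv i \<phi> y) x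
          = g x * partial_deriv i (partial_deriv i \<phi>) x + partial_deriv i g x * partial_deriv i \<phi> x" for i
      proof -
        note C1 = C1_times_test_function[OF \<Omega>(1) gd gc[of i] D1[of i]]
        have "AE x in ?M. weak_partial \<Omega> i (\<lambda>y. g y * partial_deriv i \<phi> y) x
            = partial_deriv i (\<lambda>y. g y * partial_deriv i \<phi> y) x"
          by (rule weak_partial_AE_eq[OF \<Omega>(1) is_weak_partial_C1[OF C1(1,2)]])
        moreover have "(\<lambda>y. (\<Phi> y)\<^sup>2 * partial_deriv i \<phi> y) = (\<lambda>y. g y * partial_deriv i \<phi> y)"
          by (simp add: g_def power2_eq_square)
        ultimately show ?thesis
          unfolding AE_lebesgue_on_iff[OF \<Omega>(1)] by (elim eventually_mono) (simp add: C1(3))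
      qed
      then have "AE x in ?M. \<forall>i\<in>UNIV. weak_partial \<Omega> i (\<lambda>y. (\<Phi> y)\<^sup>2 * partial_deriv i \<phi> y) x
          = g x * partial_deriv i (partial_deriv i \<phi>) x + partial_deriv i g x * partial_deriv i \<phi> x"
        by (intro AE_finite_allI) auto
      then have ae: "AE x in ?M. ?T x = ?S x"
        by eventually_elim (simp add: laplacian_def sum.distrib sum_distrib_left)
      have Tm: "?T \<in> borel_measurable (?M)"
        by (intro continuous_on_imp_measurable_lebesgue_on[OF \<Omega>(1)] continuous_on_add continuous_on_mult
            continuous_on_sum gcont gc c1 c2)
      have Sm: "?S \<in> borel_measurable (?M)"
        by (rule measurable_lebesgue_on_cong_AE[OF \<Omega>(1) Tm ae])
      show "(\<integral>x. b x * ?S x \<partial>?M) = (\<integral>x. b x * ?T x \<partial>?M)"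
      proof (rule integral_cong_AE)
        show "(\<lambda>x. b x * ?S x) \<in> borel_measurable (?M)" by (rule borel_measurable_times[OF bm Sm])
        show "(\<lambda>x. b x * ?T x) \<in> borel_measurable (?M)" by (rule borel_measurable_times[OF bm Tm])
        show "AE x in ?M. b x * ?S x = b x * ?T x" using ae by eventually_elim simp
      qed
    qed
    finally have e2: "(\<integral>x. \<psi> x * laplacian \<phi> x \<partial>?M)
        = (\<integral>x. b x * (g x * laplacian \<phi> x + (\<Sum>i\<in>UNIV. partial_deriv i g x * partial_deriv i \<phi> x)) \<partial>?M)"
      using e1 by simp
    have i1: "integrable (?M) (\<lambda>x. b x * (g x * laplacian \<phi> x))"
      by (intro bounded_integrable continuous_on_mult gcont c2)
    have i2: "integrable (?M) (\<lambda>x. b x * (partial_deriv i g x * partial_deriv i \<phi> x))" for i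
      by (intro bounded_integrable continuous_on_mult gc c1)
    have i3: "integrable (?M) (\<lambda>x. \<psi> x * laplacian \<phi> x)"
      by (rule square_integrable_mult[OF sq test_function_square_integrable(1)[OF \<Omega>(1) laplacian_test_function[OF \<phi>]]])
    have "(\<integral>x. q x * laplacian \<phi> x \<partial>?M)
        = (\<integral>x. \<psi> x * laplacian \<phi> x \<partial>?M) - (\<integral>x. b x * (g x * laplacian \<phi> x) \<partial>?M)"
      using i1 i3 by (simp add: q_def left_diff_distrib mult.assoc)
    also have "\<dots> = (\<Sum>i\<in>UNIV. \<integral>x. b x * (partial_deriv i g x * partial_deriv i \<phi> x) \<partial>?M)"
      unfolding e2 using i1 i2 by (simp add: distrib_left sum_distrib_left)
    finally show ?thesis by (simp add: G_def mult.assoc)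
  qed
  then have "\<exists>Q. continuous_on \<Omega> Q \<and> (AE x in lebesgue. x \<in> \<Omega> \<longrightarrow> q x = Q x)"
    by (intro weak_solution_AE_eq_continuous[OF \<Omega>(1) qint Gm Gb] ballI)
  then show ?thesis by (simp add: q_def b_def g_def)
qed

text \<open>Up to continuous terms \<open>\<psi>\<close> is \<open>a h\<close>, and where \<open>h\<close> does not vanish this can be solved for \<open>a\<close>.\<close>

lemma ess_continuous_at_cong_continuous_factor:
  fixes \<Omega> :: "(real ^ 'd) set"
  assumes \<Omega>: "open \<Omega>" "x \<in> \<Omega>" and Q: "continuous_on \<Omega> Q" and h: "continuous_on \<Omega> h"
    and eq: "AE y in lebesgue. y \<in> \<Omega> \<longrightarrow> \<psi> y - (a y - a0) * h y = Q y"
  shows "ess_continuous_at \<Omega> a x \<Longrightarrow> ess_continuous_at \<Omega> \<psi> x"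
    and "h x \<noteq> 0 \<Longrightarrow> ess_continuous_at \<Omega> \<psi> x \<Longrightarrow> ess_continuous_at \<Omega> a x"
proof -
  have Qx: "isCont Q x" and hx: "isCont h x"
    using Q h \<Omega> by (auto simp: continuous_on_eq_continuous_at)
  show "ess_continuous_at \<Omega> \<psi> x" if a: "ess_continuous_at \<Omega> a x"
  proof -
    obtain f where f: "AE y in lebesgue. y \<in> \<Omega> \<longrightarrow> f y = a y" "isCont f x"
      using a by (auto simp: ess_continuous_at_def)
    have "isCont (\<lambda>y. Q y + (f y - a0) * h y) x"
      by (intro isCont_add isCont_mult isCont_diff f(2) Qx hx) simp
    moreover have "AE y in lebesgue. y \<in> \<Omega> \<longrightarrow> Q y + (f y - a0) * h y = \<psi> y"
      using eq f(1) by eventually_elim auto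
    ultimately show ?thesis
      unfolding ess_continuous_at_def by (intro exI[of _ "\<lambda>y. Q y + (f y - a0) * h y"] conjI)
  qed
  show "ess_continuous_at \<Omega> a x" if hx0: "h x \<noteq> 0" and \<psi>: "ess_continuous_at \<Omega> \<psi> x"
  proof -
    obtain f where f: "AE y in lebesgue. y \<in> \<Omega> \<longrightarrow> f y = \<psi> y" "isCont f x"
      using \<psi> by (auto simp: ess_continuous_at_def)
    \<comment> \<open>Away from \<open>x\<close> the factor \<open>h\<close> may vanish; there the given representative of \<open>a\<close> is kept.\<close>
    define k where "k y = (if h y = 0 then a y else a0 + (f y - Q y) / h y)" for y
    have "isCont (\<lambda>y. a0 + (f y - Q y) / h y) x"
      using hx0 by (intro isCont_add isCont_divide isCont_diff f(2) Qx hx) simp_all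
    moreover have "\<forall>\<^sub>F y in nhds x. h y \<noteq> 0"
      using tendsto_imp_eventually_ne[OF isContD[OF hx] hx0] hx0 by (simp add: eventually_nhds_conv_at)
    then have "\<forall>\<^sub>F y in nhds x. k y = a0 + (f y - Q y) / h y"
      by eventually_elim (simp add: k_def)
    ultimately have "isCont k x" by (simp cong: isCont_cong)
    moreover have "AE y in lebesgue. y \<in> \<Omega> \<longrightarrow> k y = a y"
      using eq f(1) by eventually_elim (auto simp: k_def field_simps)
    ultimately show ?thesis
      unfolding ess_continuous_at_def by (intro exI[of _ k] conjI)
  qed
qed

theorem lemma2p6:
  fixes \<Omega> D :: "(real ^ 'd) set"
    and \<Phi> :: "real ^ 'd \<Rightarrow> real"
    and alo ahi a0 :: real
    and U :: "'d \<Rightarrow> (real ^ 'd \<Rightarrow> real) \<Rightarrow> real"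
  assumes "CARD('d) \<in> {2, 3}"
    and "C1_domain \<Omega>" and "bounded \<Omega>"
    and "compactly_contained D \<Omega>"
    and "0 < alo" and "alo \<le> ahi" and "0 < a0"
    and "Ck_on 1 \<Omega> \<Phi>"
    and "U \<in> Hminus1_vec \<Omega>"
  shows "\<exists>\<psi>\<in>L2 \<Omega>. \<exists>\<Psi>\<in>Hminus1_vec \<Omega>.
    (\<forall>\<phi>\<in>test_functions \<Omega>. \<forall>i. U i \<phi> = dist_grad \<Omega> \<psi> i \<phi> + \<Psi> i \<phi>) \<and>
    (\<forall>\<phi>\<in>test_functions \<Omega>. dist_div \<Psi> \<phi> = 0) \<and>
    (\<forall>a\<in>class_A \<Omega> D alo ahi a0. is_weighted_grad \<Omega> D a0 \<Phi> a U \<longrightarrow>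
      (\<forall>x\<in>\<Omega>. ess_continuous_at \<Omega> a x \<longrightarrow> ess_continuous_at \<Omega> \<psi> x) \<and>
      (\<forall>x\<in>\<Omega>. \<not> ess_continuous_at \<Omega> a x \<and> \<Phi> x \<noteq> 0 \<longrightarrow> \<not> ess_continuous_at \<Omega> \<psi> x))"
proof -
  have \<Omega>: "open \<Omega>" using assms(2) by (simp add: C1_domain_def domain_of_class_def)
  obtain \<psi> \<Psi> where \<psi>: "\<psi> \<in> L2 \<Omega>" and \<Psi>: "\<Psi> \<in> Hminus1_vec \<Omega>"
    and dec: "\<forall>\<phi>\<in>test_functions \<Omega>. \<forall>i. U i \<phi> = dist_grad \<Omega> \<psi> i \<phi> + \<Psi> i \<phi>"
    and div: "\<forall>\<phi>\<in>test_functions \<Omega>. dist_div \<Psi> \<phi> = 0"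
    using ex_decomposition[OF \<Omega> assms(3,9)] by blast
  have h: "continuous_on \<Omega> (\<lambda>x. \<Phi> x * \<Phi> x)"
    using Ck_on_imp_continuous_on[OF assms(8)] by (intro continuous_on_mult)
  have "(\<forall>x\<in>\<Omega>. ess_continuous_at \<Omega> a x \<longrightarrow> ess_continuous_at \<Omega> \<psi> x) \<and>
      (\<forall>x\<in>\<Omega>. \<not> ess_continuous_at \<Omega> a x \<and> \<Phi> x \<noteq> 0 \<longrightarrow> \<not> ess_continuous_at \<Omega> \<psi> x)"
    if a: "a \<in> class_A \<Omega> D alo ahi a0" and U: "is_weighted_grad \<Omega> D a0 \<Phi> a U" for a
  proof -
    obtain Q where Q: "continuous_on \<Omega> Q"
      "AE y in lebesgue. y \<in> \<Omega> \<longrightarrow> \<psi> y - (a y - a0) * (\<Phi> y * \<Phi> y) = Q y"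
      using potential_minus_contrast_AE_continuous[OF \<Omega> assms(3,4,8) \<psi> dec div a U] by blast
    have "ess_continuous_at \<Omega> a x \<Longrightarrow> ess_continuous_at \<Omega> \<psi> x"
      "\<Phi> x \<noteq> 0 \<Longrightarrow> ess_continuous_at \<Omega> \<psi> x \<Longrightarrow> ess_continuous_at \<Omega> a x" if "x \<in> \<Omega>" for x
      using ess_continuous_at_cong_continuous_factor[OF \<Omega> that Q(1) h Q(2)] by simp_all
    then show ?thesis by blast
  qed
  with \<psi> \<Psi> dec div show ?thesis by blast
qed

end
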